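(* In the setting described in the context, let $M'$ be an $S'\rtimes^{\beta'}_{H'}G$-module, $M$ an $S\rtimes^\beta_HG$-module and $\tau\colon M'\to M$ an $S'\rtimes^{\beta'}_{H'}G$-linear map (with $M$ regarded as an $S'\rtimes^{\beta'}_{H'}G$-module by restriction along the ring map induced by $f$). Let $\Phi\colon S\otimes_{S'}M'\to M$ be the $S$-linear map $s\otimes m'\mapsto s\cdot\tau(m')$. Suppose that (a) the secret $H$-action on $S\otimes_{S'}M'$ is non-trivial, (b) the action of $G$ on $\mathrm{Irr}_L(H/H')$ has exactly two orbits, and (c) the length of $\ker\Phi$ as an $S$-module is at most $|\mathrm{Irr}_L(H/H')|-1$. Then $\Phi$ factors through the coinvariants $(S\otimes_{S'}M')_H$ under the secret $H$-action, and the induced map $(S\otimes_{S'}M')_H\to M$ is injective.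
   Context: Let $L$ be a field of characteristic zero and $G$ a group. For an $L$-algebra $S$ with $G$ acting by $L$-algebra automorphisms, the skew-group ring $S\rtimes G$ is the free left $S$-module on $G$ with $(sg)(s'g')=(s(g\cdot s'))(gg')$. For a normal subgroup $N$ of $G$, a $G$-equivariant trivialisation is a group homomorphism $\beta\colon N\to S^\times$ with $\beta(n)s\beta(n)^{-1}=n\cdot s$ and $\beta(gng^{-1})=g\cdot\beta(n)$; then $S\rtimes^\beta_NG:=(S\rtimes G)/(S\rtimes G)\{\beta(n)^{-1}n-1:n\in N\}$ is a ring. Assume: $S,S'$ are $L$-algebras with $G$-actions by $L$-algebra automorphisms; $f\colon S'\to S$ is a $G$-equivariant $L$-algebra homomorphism; $H'\le H$ are normal subgroups of $G$ with $H'$ of finite index in $H$; $\beta\colon H\to S^\times$ and $\beta'\colon H'\to S'^\times$ are $G$-equivariant trivialisations with $f\circ\beta'=\beta|_{H'}$. The secret $H$-action on $S\otimes_{S'}M'$ is the action by left $S$-linear automorphisms $h\star(s\otimes m')=s\beta(h)^{-1}\otimes h\cdot m'$ (where $M'$ carries its $G$-action). $\mathrm{Irr}_L(H/H')$ is the set of isomorphism classes of simple $L[H/H']$-modules; $g\in G$ acts on it by $[V]\mapsto[gV]$, where $gV=\{[g]v\}$ with $h\cdot[g]v=[g](g^{-1}hg)v$. *)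

theory Defs
  imports "HOL-Library.Extended_Nat" "HOL-Algebra.Free_Abelian_Groups" "HOL-Algebra.QuotRing"
    "HOL-Algebra.Group_Action" "HOL-Algebra.Module"
begin

section \<open>Algebras, modules over noncommutative rings\<close>

text \<open>The library's \<^locale>\<open>algebra\<close> and \<^locale>\<open>module\<close> assume a commutative algebra, respectively
  a commutative ring of scalars.  The following are their noncommutative versions over the
  same record type; both are unital and associative.\<close>

locale assoc_algebra = module L A + A?: ring A
  for L :: "('l, 'p) ring_scheme" (structure) and A :: "('l, 'a, 'q) module_scheme" (structure) +
  assumes smult_mult_left:
      "\<lbrakk>a \<in> carrier L; x \<in> carrier A; y \<in> carrier A\<rbrakk> \<Longrightarrow>
        (a \<odot>\<^bsub>A\<^esub> x) \<otimes>\<^bsub>A\<^esub> y = a \<odot>\<^bsub>A\<^esub> (x \<otimes>\<^bsub>A\<^esub> y)"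
    and smult_mult_right:
      "\<lbrakk>a \<in> carrier L; x \<in> carrier A; y \<in> carrier A\<rbrakk> \<Longrightarrow>
        x \<otimes>\<^bsub>A\<^esub> (a \<odot>\<^bsub>A\<^esub> y) = a \<odot>\<^bsub>A\<^esub> (x \<otimes>\<^bsub>A\<^esub> y)"

definition alg_hom ::
  "('l, 'p) ring_scheme \<Rightarrow> ('l, 'a, 'q) module_scheme \<Rightarrow> ('l, 'b, 'r) module_scheme \<Rightarrow> ('a \<Rightarrow> 'b) set"
  where "alg_hom L A B =
    {\<phi> \<in> ring_hom A B. \<forall>a\<in>carrier L. \<forall>x\<in>carrier A. \<phi> (a \<odot>\<^bsub>A\<^esub> x) = a \<odot>\<^bsub>B\<^esub> \<phi> x}"

locale left_module = R?: ring R + M?: abelian_group M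
  for R :: "('r, 'p) ring_scheme" (structure) and M :: "('r, 'm, 'q) module_scheme" (structure) +
  assumes smult_closed:
      "\<lbrakk>a \<in> carrier R; x \<in> carrier M\<rbrakk> \<Longrightarrow> a \<odot>\<^bsub>M\<^esub> x \<in> carrier M"
    and smult_l_distr:
      "\<lbrakk>a \<in> carrier R; b \<in> carrier R; x \<in> carrier M\<rbrakk> \<Longrightarrow>
        (a \<oplus>\<^bsub>R\<^esub> b) \<odot>\<^bsub>M\<^esub> x = a \<odot>\<^bsub>M\<^esub> x \<oplus>\<^bsub>M\<^esub> b \<odot>\<^bsub>M\<^esub> x"
    and smult_r_distr:
      "\<lbrakk>a \<in> carrier R; x \<in> carrier M; y \<in> carrier M\<rbrakk> \<Longrightarrow>
        a \<odot>\<^bsub>M\<^esub> (x \<oplus>\<^bsub>M\<^esub> y) = a \<odot>\<^bsub>M\<^esub> x \<oplus>\<^bsub>M\<^esub> a \<odot>\<^bsub>M\<^esub> y"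
    and smult_assoc1:
      "\<lbrakk>a \<in> carrier R; b \<in> carrier R; x \<in> carrier M\<rbrakk> \<Longrightarrow>
        (a \<otimes>\<^bsub>R\<^esub> b) \<odot>\<^bsub>M\<^esub> x = a \<odot>\<^bsub>M\<^esub> (b \<odot>\<^bsub>M\<^esub> x)"
    and smult_one:
      "x \<in> carrier M \<Longrightarrow> \<one>\<^bsub>R\<^esub> \<odot>\<^bsub>M\<^esub> x = x"

definition lin_hom ::
  "('r, 'p) ring_scheme \<Rightarrow> ('r, 'a, 'q) module_scheme \<Rightarrow> ('r, 'b, 's) module_scheme \<Rightarrow> ('a \<Rightarrow> 'b) set"
  where "lin_hom R M N =
    {\<phi> \<in> hom (add_monoid M) (add_monoid N).
      \<forall>a\<in>carrier R. \<forall>x\<in>carrier M. \<phi> (a \<odot>\<^bsub>M\<^esub> x) = a \<odot>\<^bsub>N\<^esub> \<phi> x}"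

text \<open>Module records extend ring records; the multiplicative fields carry no meaning and are
  left \<^const>\<open>undefined\<close> where a module is constructed from scratch.\<close>

definition restrict_scalars :: "('a \<Rightarrow> 'b) \<Rightarrow> ('b, 'm, 'p) module_scheme \<Rightarrow> ('a, 'm) module"
  where "restrict_scalars \<phi> M =
    \<lparr>carrier = carrier M, monoid.mult = monoid.mult M, one = one M, ring.zero = ring.zero M, add = add M,
     smult = (\<lambda>a. smult M (\<phi> a))\<rparr>"

definition simple_module :: "('r, 'p) ring_scheme \<Rightarrow> ('r, 'm) module \<Rightarrow> bool"
  where "simple_module R M \<longleftrightarrow> left_module R M \<and> carrier M \<noteq> {\<zero>\<^bsub>M\<^esub>} \<and>
    (\<forall>N. submodule N R M \<longrightarrow> N = {\<zero>\<^bsub>M\<^esub>} \<or> N = carrier M)"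

definition module_length :: "('r, 'p) ring_scheme \<Rightarrow> ('r, 'm) module \<Rightarrow> enat"
  where "module_length R M =
    Sup {enat n | n. \<exists>N. (\<forall>i\<le>n. submodule (N i) R M) \<and> (\<forall>i<n. N i \<subset> N (Suc i))}"

text \<open>The map on a quotient (whose elements are cosets) induced by a map that is constant on
  cosets.\<close>

definition on_cosets :: "('a \<Rightarrow> 'b) \<Rightarrow> 'a set \<Rightarrow> 'b"
  where "on_cosets h C = the_elem (h ` C)"

definition quot_module :: "('r, 'm) module \<Rightarrow> 'm set \<Rightarrow> ('r, 'm set) module"
  where "quot_module M N =
    \<lparr>carrier = a_rcosets\<^bsub>M\<^esub> N, monoid.mult = undefined, one = undefined, ring.zero = N, add = set_add M,
     smult = (\<lambda>a. on_cosets (\<lambda>x. N +>\<^bsub>M\<^esub> (a \<odot>\<^bsub>M\<^esub> x)))\<rparr>"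


section \<open>Skew-group rings and trivialisations\<close>

text \<open>The formal sum of the terms \<open>a g \<cdot> g\<close> is encoded by its coefficient function \<open>a\<close>, which
  vanishes outside the group.  In the product, the coefficient at \<open>k\<close> collects
  \<open>(a g \<cdot> g) (b g' \<cdot> g')\<close> over all \<open>g g' = k\<close>.\<close>

definition skew_group_ring ::
  "('g, 'p) monoid_scheme \<Rightarrow> ('s, 'q) ring_scheme \<Rightarrow> ('g \<Rightarrow> 's \<Rightarrow> 's) \<Rightarrow> ('g \<Rightarrow> 's) ring"
  where "skew_group_ring G S act =
    \<lparr>carrier = {a. a ` carrier G \<subseteq> carrier S \<and> (\<forall>g. g \<notin> carrier G \<longrightarrow> a g = \<zero>\<^bsub>S\<^esub>) \<and>
                   finite {g \<in> carrier G. a g \<noteq> \<zero>\<^bsub>S\<^esub>}},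
     monoid.mult = (\<lambda>a b k. if k \<in> carrier G
               then (\<Oplus>\<^bsub>S\<^esub>g\<in>{g \<in> carrier G. a g \<noteq> \<zero>\<^bsub>S\<^esub>}. a g \<otimes>\<^bsub>S\<^esub> act g (b (inv\<^bsub>G\<^esub> g \<otimes>\<^bsub>G\<^esub> k)))
               else \<zero>\<^bsub>S\<^esub>),
     one = (\<lambda>k. if k = \<one>\<^bsub>G\<^esub> then \<one>\<^bsub>S\<^esub> else \<zero>\<^bsub>S\<^esub>),
     ring.zero = (\<lambda>k. \<zero>\<^bsub>S\<^esub>),
     add = (\<lambda>a b k. a k \<oplus>\<^bsub>S\<^esub> b k)\<rparr>"

definition skew_elem :: "('s, 'q) ring_scheme \<Rightarrow> 's \<Rightarrow> 'g \<Rightarrow> 'g \<Rightarrow> 's"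
  where "skew_elem S s g = (\<lambda>k. if k = g then s else \<zero>\<^bsub>S\<^esub>)"

definition equivariant_trivialisation ::
  "('g, 'p) monoid_scheme \<Rightarrow> ('s, 'q) ring_scheme \<Rightarrow> ('g \<Rightarrow> 's \<Rightarrow> 's) \<Rightarrow> 'g set \<Rightarrow> ('g \<Rightarrow> 's) \<Rightarrow> bool"
  where "equivariant_trivialisation G S act N \<beta> \<longleftrightarrow>
    \<beta> \<in> hom (G\<lparr>carrier := N\<rparr>) (units_of S) \<and>
    (\<forall>n\<in>N. \<forall>s\<in>carrier S. \<beta> n \<otimes>\<^bsub>S\<^esub> s \<otimes>\<^bsub>S\<^esub> inv\<^bsub>S\<^esub> (\<beta> n) = act n s) \<and>
    (\<forall>g\<in>carrier G. \<forall>n\<in>N. \<beta> (g \<otimes>\<^bsub>G\<^esub> n \<otimes>\<^bsub>G\<^esub> inv\<^bsub>G\<^esub> g) = act g (\<beta> n))"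

text \<open>\<open>(S \<rtimes> G) C\<close> is the set of finite sums of products \<open>r x\<close>, i.e. the left ideal
  generated by \<open>C\<close>.\<close>

definition left_ideal_gen :: "('a, 'p) ring_scheme \<Rightarrow> 'a set \<Rightarrow> 'a set"
  where "left_ideal_gen R C = generate (add_monoid R) {r \<otimes>\<^bsub>R\<^esub> x | r x. r \<in> carrier R \<and> x \<in> C}"

definition triv_ideal ::
  "('g, 'p) monoid_scheme \<Rightarrow> ('s, 'q) ring_scheme \<Rightarrow> ('g \<Rightarrow> 's \<Rightarrow> 's) \<Rightarrow> 'g set \<Rightarrow> ('g \<Rightarrow> 's) \<Rightarrow> ('g \<Rightarrow> 's) set"
  where "triv_ideal G S act N \<beta> =
    (let R = skew_group_ring G S act
     in left_ideal_gen R {skew_elem S (inv\<^bsub>S\<^esub> (\<beta> n)) n \<ominus>\<^bsub>R\<^esub> \<one>\<^bsub>R\<^esub> | n. n \<in> N})"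

definition skew_quot ::
  "('g, 'p) monoid_scheme \<Rightarrow> ('s, 'q) ring_scheme \<Rightarrow> ('g \<Rightarrow> 's \<Rightarrow> 's) \<Rightarrow> 'g set \<Rightarrow> ('g \<Rightarrow> 's) \<Rightarrow> ('g \<Rightarrow> 's) set ring"
  where "skew_quot G S act N \<beta> = skew_group_ring G S act Quot triv_ideal G S act N \<beta>"

definition skew_class ::
  "('g, 'p) monoid_scheme \<Rightarrow> ('s, 'q) ring_scheme \<Rightarrow> ('g \<Rightarrow> 's \<Rightarrow> 's) \<Rightarrow> 'g set \<Rightarrow> ('g \<Rightarrow> 's) \<Rightarrow>
    ('g \<Rightarrow> 's) \<Rightarrow> ('g \<Rightarrow> 's) set"
  where "skew_class G S act N \<beta> a = triv_ideal G S act N \<beta> +>\<^bsub>skew_group_ring G S act\<^esub> a"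

text \<open>The images in \<open>S \<rtimes>\<^sup>\<beta>\<^sub>N G\<close> of a coefficient \<open>s\<close> and of a group element \<open>g\<close>.\<close>

definition skew_coeff ::
  "('g, 'p) monoid_scheme \<Rightarrow> ('s, 'q) ring_scheme \<Rightarrow> ('g \<Rightarrow> 's \<Rightarrow> 's) \<Rightarrow> 'g set \<Rightarrow> ('g \<Rightarrow> 's) \<Rightarrow>
    's \<Rightarrow> ('g \<Rightarrow> 's) set"
  where "skew_coeff G S act N \<beta> s = skew_class G S act N \<beta> (skew_elem S s \<one>\<^bsub>G\<^esub>)"

definition skew_grp ::
  "('g, 'p) monoid_scheme \<Rightarrow> ('s, 'q) ring_scheme \<Rightarrow> ('g \<Rightarrow> 's \<Rightarrow> 's) \<Rightarrow> 'g set \<Rightarrow> ('g \<Rightarrow> 's) \<Rightarrow>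
    'g \<Rightarrow> ('g \<Rightarrow> 's) set"
  where "skew_grp G S act N \<beta> g = skew_class G S act N \<beta> (skew_elem S \<one>\<^bsub>S\<^esub> g)"

text \<open>The ring map \<open>S' \<rtimes>\<^sup>\<beta>\<^sup>'\<^sub>N\<^sub>' G \<rightarrow> S \<rtimes>\<^sup>\<beta>\<^sub>N G\<close> induced by \<open>f\<close> is defined on cosets by
  applying \<open>f\<close> to all coefficients; the quotient of the target is given by \<open>N\<close> and \<open>\<beta>\<close>.\<close>

definition skew_map ::
  "('g, 'p) monoid_scheme \<Rightarrow> ('s, 'q) ring_scheme \<Rightarrow> ('g \<Rightarrow> 's \<Rightarrow> 's) \<Rightarrow> 'g set \<Rightarrow> ('g \<Rightarrow> 's) \<Rightarrow>
    ('t \<Rightarrow> 's) \<Rightarrow> ('g \<Rightarrow> 't) set \<Rightarrow> ('g \<Rightarrow> 's) set"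
  where "skew_map G S act N \<beta> f = on_cosets (\<lambda>a. skew_class G S act N \<beta>
    (\<lambda>g. if g \<in> carrier G then f (a g) else \<zero>\<^bsub>S\<^esub>))"


section \<open>Extension of scalars\<close>

text \<open>\<open>S \<otimes>\<^bsub>S'\<^esub> N\<close>, where \<open>S\<close> is a right \<open>S'\<close>-module through \<open>f\<close>: the free abelian group on
  \<open>S \<times> N\<close> modulo the subgroup generated by the usual relations.  Elements are cosets.\<close>

definition tensor_free ::
  "('s, 'p) ring_scheme \<Rightarrow> ('t, 'm) module \<Rightarrow> ('s \<times> 'm \<Rightarrow>\<^sub>0 int) monoid"
  where "tensor_free S N = free_Abelian_group (carrier S \<times> carrier N)"

definition tensor_rels ::
  "('s, 'p) ring_scheme \<Rightarrow> ('t, 'q) ring_scheme \<Rightarrow> ('t \<Rightarrow> 's) \<Rightarrow> ('t, 'm) module \<Rightarrow> ('s \<times> 'm \<Rightarrow>\<^sub>0 int) set"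
  where "tensor_rels S S' f N = generate (tensor_free S N)
    ({frag_of (s \<oplus>\<^bsub>S\<^esub> t, m) - (frag_of (s, m) + frag_of (t, m)) | s t m.
        s \<in> carrier S \<and> t \<in> carrier S \<and> m \<in> carrier N} \<union>
     {frag_of (s, m \<oplus>\<^bsub>N\<^esub> n) - (frag_of (s, m) + frag_of (s, n)) | s m n.
        s \<in> carrier S \<and> m \<in> carrier N \<and> n \<in> carrier N} \<union>
     {frag_of (s \<otimes>\<^bsub>S\<^esub> f r, m) - frag_of (s, r \<odot>\<^bsub>N\<^esub> m) | s r m.
        s \<in> carrier S \<and> r \<in> carrier S' \<and> m \<in> carrier N})"

text \<open>The additive endomorphism \<open>s \<otimes> m \<mapsto> u (s, m)\<^sub>1 \<otimes> u (s, m)\<^sub>2\<close> of \<open>S \<otimes>\<^bsub>S'\<^esub> N\<close>.\<close>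

definition tensor_endo ::
  "('s, 'p) ring_scheme \<Rightarrow> ('t, 'q) ring_scheme \<Rightarrow> ('t \<Rightarrow> 's) \<Rightarrow> ('t, 'm) module \<Rightarrow>
    ('s \<times> 'm \<Rightarrow> 's \<times> 'm) \<Rightarrow> ('s \<times> 'm \<Rightarrow>\<^sub>0 int) set \<Rightarrow> ('s \<times> 'm \<Rightarrow>\<^sub>0 int) set"
  where "tensor_endo S S' f N u =
    on_cosets (\<lambda>c. tensor_rels S S' f N #>\<^bsub>tensor_free S N\<^esub> frag_extend (\<lambda>p. frag_of (u p)) c)"

definition base_change ::
  "('s, 'p) ring_scheme \<Rightarrow> ('t, 'q) ring_scheme \<Rightarrow> ('t \<Rightarrow> 's) \<Rightarrow> ('t, 'm) module \<Rightarrow>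
    ('s, ('s \<times> 'm \<Rightarrow>\<^sub>0 int) set) module"
  where "base_change S S' f N =
    (let Q = tensor_free S N Mod tensor_rels S S' f N in
      \<lparr>carrier = carrier Q, monoid.mult = undefined, one = undefined, ring.zero = one Q, add = monoid.mult Q,
       smult = (\<lambda>r. tensor_endo S S' f N (\<lambda>(s, m). (r \<otimes>\<^bsub>S\<^esub> s, m)))\<rparr>)"

text \<open>The additive map \<open>S \<otimes>\<^bsub>S'\<^esub> N \<rightarrow> M\<close>, \<open>s \<otimes> m \<mapsto> s \<tau>(m)\<close>, for an \<open>S\<close>-module \<open>M\<close>.\<close>

definition base_change_lift ::
  "('s, 'n) module \<Rightarrow> ('m \<Rightarrow> 'n) \<Rightarrow> ('s \<times> 'm \<Rightarrow>\<^sub>0 int) set \<Rightarrow> 'n"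
  where "base_change_lift M \<tau> = on_cosets (\<lambda>c. \<Oplus>\<^bsub>M\<^esub>p\<in>Poly_Mapping.keys c.
    [Poly_Mapping.lookup c p] \<cdot>\<^bsub>M\<^esub> (fst p \<odot>\<^bsub>M\<^esub> \<tau> (snd p)))"

text \<open>Coinvariants of a module \<open>T\<close> under operators \<open>act h\<close>: the quotient by the subgroup
  generated by all \<open>h x - x\<close>.  It is an \<open>S\<close>-submodule when the operators are \<open>S\<close>-linear.\<close>

definition coinv_kernel :: "('h \<Rightarrow> 'm \<Rightarrow> 'm) \<Rightarrow> 'h set \<Rightarrow> ('r, 'm) module \<Rightarrow> 'm set"
  where "coinv_kernel act H T =
    generate (add_monoid T) {act h x \<ominus>\<^bsub>T\<^esub> x | h x. h \<in> H \<and> x \<in> carrier T}"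

definition coinvariants :: "('h \<Rightarrow> 'm \<Rightarrow> 'm) \<Rightarrow> 'h set \<Rightarrow> ('r, 'm) module \<Rightarrow> ('r, 'm set) module"
  where "coinvariants act H T = quot_module T (coinv_kernel act H T)"


section \<open>Isomorphism classes of simple modules over a group ring\<close>

definition group_ring :: "('l, 'p) ring_scheme \<Rightarrow> ('q, 'r) monoid_scheme \<Rightarrow> ('q \<Rightarrow> 'l) ring"
  where "group_ring L Q = skew_group_ring Q L (\<lambda>_ a. a)"

text \<open>Isomorphism classes are formed among the modules whose elements are drawn from the type
  of subsets of \<open>L[Q]\<close>.  This type is large enough to represent every class, because a simple
  module is isomorphic to the quotient of \<open>L[Q]\<close> by a maximal left ideal, whose elements are
  cosets.\<close>

definition simple_iso ::
  "('l, 'p) ring_scheme \<Rightarrow> ('q, 'r) monoid_scheme \<Rightarrow> ('q \<Rightarrow> 'l, ('q \<Rightarrow> 'l) set) module rel"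
  where "simple_iso L Q = {(V, W). simple_module (group_ring L Q) V \<and> simple_module (group_ring L Q) W \<and>
    (\<exists>\<phi>\<in>lin_hom (group_ring L Q) V W. bij_betw \<phi> (carrier V) (carrier W))}"

definition Irr ::
  "('l, 'p) ring_scheme \<Rightarrow> ('q, 'r) monoid_scheme \<Rightarrow> ('q \<Rightarrow> 'l, ('q \<Rightarrow> 'l) set) module set set"
  where "Irr L Q = {V. simple_module (group_ring L Q) V} // simple_iso L Q"

definition subquot :: "('g, 'p) monoid_scheme \<Rightarrow> 'g set \<Rightarrow> 'g set \<Rightarrow> 'g set monoid"
  where "subquot G H H' = G\<lparr>carrier := H\<rparr> Mod H'"

text \<open>The automorphism \<open>q \<mapsto> g\<inverse> q g\<close> of \<open>L[H/H']\<close>: the coefficient of the image at \<open>p\<close> is the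
  coefficient of the argument at \<open>g p g\<inverse>\<close>.\<close>

definition conj_group_ring ::
  "('l, 'p) ring_scheme \<Rightarrow> ('g, 'r) monoid_scheme \<Rightarrow> 'g set \<Rightarrow> 'g set \<Rightarrow> 'g \<Rightarrow> ('g set \<Rightarrow> 'l) \<Rightarrow> 'g set \<Rightarrow> 'l"
  where "conj_group_ring L G H H' g a = (\<lambda>p. if p \<in> carrier (subquot G H H')
    then a ((\<lambda>x. g \<otimes>\<^bsub>G\<^esub> x \<otimes>\<^bsub>G\<^esub> inv\<^bsub>G\<^esub> g) ` p) else \<zero>\<^bsub>L\<^esub>)"

text \<open>\<open>g V\<close> has the same elements as \<open>V\<close> (writing \<open>v\<close> for the symbol \<open>[g] v\<close>), and \<open>h\<close> acts on
  it as \<open>g\<inverse> h g\<close> acts on \<open>V\<close>.\<close>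

definition twist ::
  "('l, 'p) ring_scheme \<Rightarrow> ('g, 'r) monoid_scheme \<Rightarrow> 'g set \<Rightarrow> 'g set \<Rightarrow> 'g \<Rightarrow>
    ('g set \<Rightarrow> 'l, 'v) module \<Rightarrow> ('g set \<Rightarrow> 'l, 'v) module"
  where "twist L G H H' g V = restrict_scalars (conj_group_ring L G H H' g) V"

definition irr_action ::
  "('l, 'p) ring_scheme \<Rightarrow> ('g, 'r) monoid_scheme \<Rightarrow> 'g set \<Rightarrow> 'g set \<Rightarrow> 'g \<Rightarrow>
    ('g set \<Rightarrow> 'l, ('g set \<Rightarrow> 'l) set) module set \<Rightarrow> ('g set \<Rightarrow> 'l, ('g set \<Rightarrow> 'l) set) module set"
  where "irr_action L G H H' g C = simple_iso L (subquot G H H') `` (twist L G H H' g ` C)"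


section \<open>The secret action\<close>

definition secret_action ::
  "('g, 'p) monoid_scheme \<Rightarrow> ('s, 'q) ring_scheme \<Rightarrow> ('t, 'r) ring_scheme \<Rightarrow> ('t \<Rightarrow> 's) \<Rightarrow>
    ('g \<Rightarrow> 't \<Rightarrow> 't) \<Rightarrow> 'g set \<Rightarrow> ('g \<Rightarrow> 's) \<Rightarrow> ('g \<Rightarrow> 't) \<Rightarrow> (('g \<Rightarrow> 't) set, 'm) module \<Rightarrow>
    'g \<Rightarrow> ('s \<times> 'm \<Rightarrow>\<^sub>0 int) set \<Rightarrow> ('s \<times> 'm \<Rightarrow>\<^sub>0 int) set"
  where "secret_action G S S' f act' H' \<beta> \<beta>' M' h =
    tensor_endo S S' f (restrict_scalars (skew_coeff G S' act' H' \<beta>') M')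
      (\<lambda>(s, m). (s \<otimes>\<^bsub>S\<^esub> inv\<^bsub>S\<^esub> (\<beta> h), skew_grp G S' act' H' \<beta>' h \<odot>\<^bsub>M'\<^esub> m))"

end

theory Submission
  imports Defs
begin

text \<open>The group algebra \<open>L[H/H']\<close> acts on \<open>T = S \<otimes>\<^bsub>S'\<^esub> M'\<close> through the secret action, \<open>S\<close>-linearly, and \<open>G\<close>
  acts semilinearly with \<open>g \<circ> (h \<star>) = (g h g\<inverse> \<star>) \<circ> g\<close>; the kernel \<open>K\<close> of \<open>\<Phi>\<close> is stable under both and
  contains all \<open>h \<star> x - x\<close>.  Hence the set of simple \<open>L[H/H']\<close>-modules that embed in \<open>K\<close> is a union of
  \<open>G\<close>-orbits.  Since the secret action is non-trivial, the span \<open>C\<close> of the \<open>h \<star> x - x\<close> is non-zero; averaging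
  over \<open>H/H'\<close> annihilates \<open>C\<close>, so a simple submodule of \<open>C\<close> is non-trivial.  If \<open>x \<in> K\<close> were not in \<open>C\<close>, its
  average would be a non-zero invariant of \<open>K\<close>, so the trivial module would embed as well.  The two orbits
  then give embeddings of every simple module, and the sums of the images of the first \<open>i\<close> of them
  form a strictly increasing chain of \<open>S\<close>-submodules of \<open>K\<close> that is too long.  So \<open>K = C\<close>.\<close>


section \<open>Skew group rings\<close>

text \<open>The kernel contains the differences because \<open>h\<close> in \<open>H\<close> acts on
  \<open>M\<close> as \<open>\<beta> h\<close>, which cancels the inverse in the secret action. The
  two orbits can be told apart because twisting preserves triviality of a module; so one trivial and
  one non-trivial simple module in the kernel are enough to reach every class. The main obstacle is
  that length counts \<open>S\<close>-submodules, while the simple modules live over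
  \<open>L[H/H']\<close>: the image of one embedding need not be stable under \<open>S\<close>.
  Therefore the images of all homomorphisms from a given simple module are summed. Multiplication by
  an element of \<open>S\<close> commutes with the secret action, so it sends one homomorphism to
  another, and the sum is an \<open>S\<close>-submodule. The chain is strict because a simple
  submodule of a sum of images of simple modules is isomorphic to one of these modules. One step for
  each class gives one step more than condition (c) allows. Characteristic zero enters only through
  the invertibility of the order of \<open>H/H'\<close> in \<open>L\<close>.\<close>

locale skew_action = G: group G + S: ring S
  for G :: "('g, 'p) monoid_scheme" and S :: "('s, 'q) ring_scheme" (structure) +
  fixes act :: "'g \<Rightarrow> 's \<Rightarrow> 's"
  assumes act_hom: "g \<in> carrier G \<Longrightarrow> act g \<in> ring_hom S S"
    and act_1: "x \<in> carrier S \<Longrightarrow> act \<one>\<^bsub>G\<^esub> x = x"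
    and act_mult: "\<lbrakk>g \<in> carrier G; h \<in> carrier G; x \<in> carrier S\<rbrakk> \<Longrightarrow>
      act (g \<otimes>\<^bsub>G\<^esub> h) x = act g (act h x)"
begin

abbreviation "SG \<equiv> skew_group_ring G S act"

abbreviation supp :: "('g \<Rightarrow> 's) \<Rightarrow> 'g set"
  where "supp a \<equiv> {g \<in> carrier G. a g \<noteq> \<zero>}"

abbreviation delta :: "'s \<Rightarrow> 'g \<Rightarrow> 'g \<Rightarrow> 's"
  where "delta \<equiv> skew_elem S"

lemma act_closed [simp]: "\<lbrakk>g \<in> carrier G; x \<in> carrier S\<rbrakk> \<Longrightarrow> act g x \<in> carrier S"
  using act_hom by (auto simp: ring_hom_def)

lemma act_add: "\<lbrakk>g \<in> carrier G; x \<in> carrier S; y \<in> carrier S\<rbrakk> \<Longrightarrow>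
    act g (x \<oplus> y) = act g x \<oplus> act g y"
  using act_hom by (auto simp: ring_hom_def)

lemma act_times: "\<lbrakk>g \<in> carrier G; x \<in> carrier S; y \<in> carrier S\<rbrakk> \<Longrightarrow>
    act g (x \<otimes> y) = act g x \<otimes> act g y"
  using act_hom by (auto simp: ring_hom_def)

lemma act_one [simp]: "g \<in> carrier G \<Longrightarrow> act g \<one> = \<one>"
  using act_hom by (auto simp: ring_hom_def)

lemma act_zero [simp]:
  assumes "g \<in> carrier G" shows "act g \<zero> = \<zero>"
proof -
  have "act g \<zero> \<oplus> act g \<zero> = act g \<zero>"
    using act_add[OF assms S.zero_closed S.zero_closed] by simp
  then show ?thesis
    using assms by (metis S.add.l_cancel_one act_closed S.zero_closed)
qed

lemma in_carrier_iff: "a \<in> carrier SG \<longleftrightarrow>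
    (\<forall>g \<in> carrier G. a g \<in> carrier S) \<and> (\<forall>g. g \<notin> carrier G \<longrightarrow> a g = \<zero>) \<and> finite (supp a)"
  by (auto simp: skew_group_ring_def image_subset_iff)

lemma coeff_closed: "a \<in> carrier SG \<Longrightarrow> a g \<in> carrier S"
  by (cases "g \<in> carrier G") (auto simp: in_carrier_iff)

lemma coeff_outside: "\<lbrakk>a \<in> carrier SG; g \<notin> carrier G\<rbrakk> \<Longrightarrow> a g = \<zero>"
  by (auto simp: in_carrier_iff)

lemma finite_supp: "a \<in> carrier SG \<Longrightarrow> finite (supp a)"
  by (auto simp: in_carrier_iff)

lemma add_apply: "(a \<oplus>\<^bsub>SG\<^esub> b) k = a k \<oplus> b k"
  by (simp add: skew_group_ring_def)

lemma zero_apply: "\<zero>\<^bsub>SG\<^esub> k = \<zero>"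
  by (simp add: skew_group_ring_def)

lemma delta_closed [simp]: "\<lbrakk>s \<in> carrier S; g \<in> carrier G\<rbrakk> \<Longrightarrow> delta s g \<in> carrier SG"
  by (auto simp: in_carrier_iff skew_elem_def)

lemma one_eq_delta: "\<one>\<^bsub>SG\<^esub> = delta \<one> \<one>\<^bsub>G\<^esub>"
  by (simp add: skew_group_ring_def skew_elem_def)

lemma abelian_group_SG: "abelian_group SG"
proof (rule abelian_groupI)
  fix a b assume a: "a \<in> carrier SG" and b: "b \<in> carrier SG"
  note [simp] = coeff_closed[OF a] coeff_closed[OF b] finite_supp[OF a] finite_supp[OF b]
  have "finite (supp (\<lambda>k. a k \<oplus> b k))"
    by (rule finite_subset[of _ "supp a \<union> supp b"]) (use a b in auto)
  then show "a \<oplus>\<^bsub>SG\<^esub> b \<in> carrier SG"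
    using a b by (auto simp: in_carrier_iff add_apply)
  show "a \<oplus>\<^bsub>SG\<^esub> b = b \<oplus>\<^bsub>SG\<^esub> a"
    using a b by (auto simp: add_apply S.a_comm)
next
  fix a assume a: "a \<in> carrier SG"
  note [simp] = coeff_closed[OF a]
  have "(\<lambda>k. \<ominus> a k) \<in> carrier SG"
    using a by (auto simp: in_carrier_iff cong: conj_cong) 
  moreover have "(\<lambda>k. \<ominus> a k) \<oplus>\<^bsub>SG\<^esub> a = \<zero>\<^bsub>SG\<^esub>"
    using a by (auto simp: add_apply zero_apply S.l_neg)
  ultimately show "\<exists>b\<in>carrier SG. b \<oplus>\<^bsub>SG\<^esub> a = \<zero>\<^bsub>SG\<^esub>"
    by blast
next
  fix a assume "a \<in> carrier SG"
  from coeff_closed[OF this] show "\<zero>\<^bsub>SG\<^esub> \<oplus>\<^bsub>SG\<^esub> a = a"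
    by (simp add: fun_eq_iff add_apply zero_apply)
qed (auto simp: in_carrier_iff[of "\<zero>\<^bsub>SG\<^esub>"] add_apply zero_apply fun_eq_iff intro!: S.a_assoc coeff_closed)

sublocale SG: abelian_group SG
  by (rule abelian_group_SG)

lemma delta_add: "\<lbrakk>s \<in> carrier S; t \<in> carrier S\<rbrakk> \<Longrightarrow>
    delta (s \<oplus> t) g = delta s g \<oplus>\<^bsub>SG\<^esub> delta t g"
  by (auto simp: skew_elem_def add_apply)

text \<open>Elements are finite sums of monomials, so an identity that is additive in an element
  need only be checked on \<open>delta s g\<close>. The induction is on the size of the support; one
  coefficient at a time is split off.\<close>

lemma skew_induct [consumes 1, case_names zero delta add]:
  assumes a: "a \<in> carrier SG" and zero: "P \<zero>\<^bsub>SG\<^esub>"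
    and delta: "\<And>s g. \<lbrakk>s \<in> carrier S; g \<in> carrier G\<rbrakk> \<Longrightarrow> P (delta s g)"
    and add: "\<And>a b. \<lbrakk>a \<in> carrier SG; b \<in> carrier SG; P a; P b\<rbrakk> \<Longrightarrow> P (a \<oplus>\<^bsub>SG\<^esub> b)"
  shows "P a"
  using a
proof (induction "card (supp a)" arbitrary: a rule: less_induct)
  case less
  show ?case
  proof (cases "supp a = {}")
    case True
    with less.prems have "a = \<zero>\<^bsub>SG\<^esub>"
      by (auto simp: fun_eq_iff zero_apply in_carrier_iff)
    with zero show ?thesis by simp
  next
    case False
    then obtain g where g: "g \<in> carrier G" "a g \<noteq> \<zero>" by auto
    let ?b = "a(g := \<zero>)"
    have fin: "finite (supp a)" using less.prems by (rule finite_supp)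
    have sub: "supp ?b = supp a - {g}" by auto
    have b: "?b \<in> carrier SG"
      using less.prems fin unfolding in_carrier_iff sub by auto
    have "card (supp ?b) < card (supp a)"
      unfolding sub using g fin by (intro card_Diff1_less) auto
    with less.hyps b have "P ?b" by blast
    moreover have "P (delta (a g) g)" using delta less.prems g by (simp add: coeff_closed)
    moreover have "a = ?b \<oplus>\<^bsub>SG\<^esub> delta (a g) g"
      using coeff_closed[OF less.prems] by (auto simp: fun_eq_iff add_apply skew_elem_def)
    ultimately show ?thesis
      using add b less.prems g by (metis coeff_closed delta_closed)
  qed
qed

text \<open>The defining sum over the support may be taken over any larger finite set, since a zero
  coefficient contributes zero. This puts several products over one common index set.\<close>

lemma mult_apply:
  assumes a: "a \<in> carrier SG" and b: "b \<in> carrier SG"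
    and "finite A" "supp a \<subseteq> A" "A \<subseteq> carrier G" "k \<in> carrier G"
  shows "(a \<otimes>\<^bsub>SG\<^esub> b) k = (\<Oplus>g\<in>A. a g \<otimes> act g (b (inv\<^bsub>G\<^esub> g \<otimes>\<^bsub>G\<^esub> k)))"
proof -
  have "(a \<otimes>\<^bsub>SG\<^esub> b) k = (\<Oplus>g\<in>supp a. a g \<otimes> act g (b (inv\<^bsub>G\<^esub> g \<otimes>\<^bsub>G\<^esub> k)))"
    using assms by (simp add: skew_group_ring_def)
  also have "\<dots> = (\<Oplus>g\<in>A. a g \<otimes> act g (b (inv\<^bsub>G\<^esub> g \<otimes>\<^bsub>G\<^esub> k)))"
    by (rule S.add.finprod_mono_neutral_cong_left) (use assms coeff_closed[OF a] coeff_closed[OF b] in \<open>auto simp: subset_iff\<close>)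
  finally show ?thesis .
qed

lemma mult_outside: "k \<notin> carrier G \<Longrightarrow> (a \<otimes>\<^bsub>SG\<^esub> b) k = \<zero>"
  by (simp add: skew_group_ring_def)

lemma delta_mult_apply:
  assumes "s \<in> carrier S" "g \<in> carrier G" "b \<in> carrier SG" "k \<in> carrier G"
  shows "(delta s g \<otimes>\<^bsub>SG\<^esub> b) k = s \<otimes> act g (b (inv\<^bsub>G\<^esub> g \<otimes>\<^bsub>G\<^esub> k))"
proof -
  note [simp] = coeff_closed[OF assms(3)]
  have "(delta s g \<otimes>\<^bsub>SG\<^esub> b) k
      = (\<Oplus>h\<in>{g}. delta s g h \<otimes> act h (b (inv\<^bsub>G\<^esub> h \<otimes>\<^bsub>G\<^esub> k)))"
    by (rule mult_apply[OF delta_closed[OF assms(1,2)] assms(3)])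
      (use assms in \<open>auto simp: skew_elem_def\<close>)
  also have "\<dots> = delta s g g \<otimes> act g (b (inv\<^bsub>G\<^esub> g \<otimes>\<^bsub>G\<^esub> k))"
    using assms by (subst S.finsum_insert) (auto simp: skew_elem_def)
  finally show ?thesis by (simp add: skew_elem_def)
qed

lemma delta_mult_delta:
  assumes "s \<in> carrier S" "g \<in> carrier G" "t \<in> carrier S" "h \<in> carrier G"
  shows "delta s g \<otimes>\<^bsub>SG\<^esub> delta t h = delta (s \<otimes> act g t) (g \<otimes>\<^bsub>G\<^esub> h)"
proof
  fix k
  show "(delta s g \<otimes>\<^bsub>SG\<^esub> delta t h) k = delta (s \<otimes> act g t) (g \<otimes>\<^bsub>G\<^esub> h) k"
  proof (cases "k \<in> carrier G")
    case True
    then have "inv\<^bsub>G\<^esub> g \<otimes>\<^bsub>G\<^esub> k = h \<longleftrightarrow> k = g \<otimes>\<^bsub>G\<^esub> h"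
      using assms by (metis G.inv_solve_left)
    then show ?thesis
      using True assms by (simp add: delta_mult_apply) (simp add: skew_elem_def)
  next
    case False
    then show ?thesis using assms by (auto simp: mult_outside skew_elem_def)
  qed
qed

text \<open>Proved coefficientwise, without closedness of the product, which is itself derived later
  by reduction to monomials with the help of distributivity.\<close>

lemma l_distr_SG:
  assumes "a \<in> carrier SG" "b \<in> carrier SG" "c \<in> carrier SG"
  shows "(a \<oplus>\<^bsub>SG\<^esub> b) \<otimes>\<^bsub>SG\<^esub> c = a \<otimes>\<^bsub>SG\<^esub> c \<oplus>\<^bsub>SG\<^esub> b \<otimes>\<^bsub>SG\<^esub> c"
proof
  fix k
  note [simp] = assms[THEN coeff_closed] assms[THEN finite_supp]
  let ?A = "supp a \<union> supp b"
  let ?c = "\<lambda>g. act g (c (inv\<^bsub>G\<^esub> g \<otimes>\<^bsub>G\<^esub> k))"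
  show "((a \<oplus>\<^bsub>SG\<^esub> b) \<otimes>\<^bsub>SG\<^esub> c) k = (a \<otimes>\<^bsub>SG\<^esub> c \<oplus>\<^bsub>SG\<^esub> b \<otimes>\<^bsub>SG\<^esub> c) k"
  proof (cases "k \<in> carrier G")
    case True
    have fin: "finite ?A" using assms by simp
    have "((a \<oplus>\<^bsub>SG\<^esub> b) \<otimes>\<^bsub>SG\<^esub> c) k = (\<Oplus>g\<in>?A. (a \<oplus>\<^bsub>SG\<^esub> b) g \<otimes> ?c g)"
      by (rule mult_apply) (use assms True fin in \<open>auto simp: add_apply\<close>)
    also have "\<dots> = (\<Oplus>g\<in>?A. a g \<otimes> ?c g \<oplus> b g \<otimes> ?c g)"
      by (rule S.finsum_cong') (use assms True in \<open>auto simp: add_apply S.l_distr\<close>)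
    also have "\<dots> = (\<Oplus>g\<in>?A. a g \<otimes> ?c g) \<oplus> (\<Oplus>g\<in>?A. b g \<otimes> ?c g)"
      by (rule S.finsum_addf) (use assms in auto)
    also have "\<dots> = (a \<otimes>\<^bsub>SG\<^esub> c) k \<oplus> (b \<otimes>\<^bsub>SG\<^esub> c) k"
      using assms True fin by (simp add: mult_apply[where A="?A"])
    finally show ?thesis by (simp add: add_apply)
  next
    case False
    then show ?thesis by (simp add: add_apply mult_outside)
  qed
qed

lemma r_distr_SG:
  assumes "a \<in> carrier SG" "b \<in> carrier SG" "c \<in> carrier SG"
  shows "c \<otimes>\<^bsub>SG\<^esub> (a \<oplus>\<^bsub>SG\<^esub> b) = c \<otimes>\<^bsub>SG\<^esub> a \<oplus>\<^bsub>SG\<^esub> c \<otimes>\<^bsub>SG\<^esub> b"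
proof
  fix k
  note [simp] = assms[THEN coeff_closed] assms[THEN finite_supp]
  let ?t = "\<lambda>x g. c g \<otimes> act g (x (inv\<^bsub>G\<^esub> g \<otimes>\<^bsub>G\<^esub> k))"
  show "(c \<otimes>\<^bsub>SG\<^esub> (a \<oplus>\<^bsub>SG\<^esub> b)) k = (c \<otimes>\<^bsub>SG\<^esub> a \<oplus>\<^bsub>SG\<^esub> c \<otimes>\<^bsub>SG\<^esub> b) k"
  proof (cases "k \<in> carrier G")
    case True
    have "(c \<otimes>\<^bsub>SG\<^esub> (a \<oplus>\<^bsub>SG\<^esub> b)) k = (\<Oplus>g\<in>supp c. ?t (a \<oplus>\<^bsub>SG\<^esub> b) g)"
      by (rule mult_apply) (use assms True in auto)
    also have "\<dots> = (\<Oplus>g\<in>supp c. ?t a g \<oplus> ?t b g)"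
      by (rule S.finsum_cong') (use assms True in \<open>auto simp: add_apply S.r_distr act_add\<close>)
    also have "\<dots> = (\<Oplus>g\<in>supp c. ?t a g) \<oplus> (\<Oplus>g\<in>supp c. ?t b g)"
      by (rule S.finsum_addf) (use assms in auto)
    also have "\<dots> = (c \<otimes>\<^bsub>SG\<^esub> a) k \<oplus> (c \<otimes>\<^bsub>SG\<^esub> b) k"
      using assms True by (simp add: mult_apply[where A="supp c"])
    finally show ?thesis by (simp add: add_apply)
  next
    case False
    then show ?thesis by (simp add: add_apply mult_outside)
  qed
qed

lemma zero_mult_SG:
  assumes "a \<in> carrier SG"
  shows "\<zero>\<^bsub>SG\<^esub> \<otimes>\<^bsub>SG\<^esub> a = \<zero>\<^bsub>SG\<^esub>"
proof
  fix k show "(\<zero>\<^bsub>SG\<^esub> \<otimes>\<^bsub>SG\<^esub> a) k = \<zero>\<^bsub>SG\<^esub> k"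
    using assms by (cases "k \<in> carrier G")
      (simp_all add: mult_apply[where A="{}"] mult_outside zero_apply)
qed

lemma mult_zero_SG:
  assumes "a \<in> carrier SG"
  shows "a \<otimes>\<^bsub>SG\<^esub> \<zero>\<^bsub>SG\<^esub> = \<zero>\<^bsub>SG\<^esub>"
proof
  fix k
  have "k \<in> carrier G \<Longrightarrow> (a \<otimes>\<^bsub>SG\<^esub> \<zero>\<^bsub>SG\<^esub>) k = \<zero>"
    using assms coeff_closed[OF assms] finite_supp[OF assms]
    by (subst mult_apply[where A="supp a"]) (auto simp: zero_apply intro!: S.add.finprod_one_eqI)
  then show "(a \<otimes>\<^bsub>SG\<^esub> \<zero>\<^bsub>SG\<^esub>) k = \<zero>\<^bsub>SG\<^esub> k"
    by (cases "k \<in> carrier G") (simp_all add: mult_outside zero_apply)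
qed

lemma mult_closed_SG [simp]:
  assumes "a \<in> carrier SG" "b \<in> carrier SG"
  shows "a \<otimes>\<^bsub>SG\<^esub> b \<in> carrier SG"
  using assms
proof (induction arbitrary: b rule: skew_induct)
  case (delta s g)
  show ?case using delta(3)
  proof (induction rule: skew_induct)
    case (delta t h)
    then show ?case using \<open>s \<in> carrier S\<close> \<open>g \<in> carrier G\<close> by (simp add: delta_mult_delta)
  qed (simp_all add: mult_zero_SG r_distr_SG delta)
qed (simp_all add: zero_mult_SG l_distr_SG)

text \<open>Biadditivity reduces this to three monomials, where it expresses that each
  \<open>act g\<close> is multiplicative and that \<open>act\<close> respects products in
  \<open>G\<close>.\<close>

lemma assoc_SG:
  assumes "a \<in> carrier SG" "b \<in> carrier SG" "c \<in> carrier SG"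
  shows "a \<otimes>\<^bsub>SG\<^esub> b \<otimes>\<^bsub>SG\<^esub> c = a \<otimes>\<^bsub>SG\<^esub> (b \<otimes>\<^bsub>SG\<^esub> c)"
  using assms
proof (induction rule: skew_induct)
  case a: (delta s g)
  from a(3,4) show ?case
  proof (induction rule: skew_induct)
    case b: (delta t h)
    from b(3) show ?case
    proof (induction rule: skew_induct)
      case (delta u k)
      then show ?case
        using a(1,2) b(1,2)
        by (simp add: delta_mult_delta S.m_assoc G.m_assoc act_times act_mult)
    qed (use a b in \<open>simp_all add: mult_zero_SG r_distr_SG\<close>)
  qed (use a in \<open>simp_all add: mult_zero_SG zero_mult_SG r_distr_SG l_distr_SG\<close>)
qed (simp_all add: zero_mult_SG l_distr_SG)

lemma ring_SG: "ring SG"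
proof (rule ringI)
  show "monoid SG"
  proof (rule monoidI)
    fix a assume "a \<in> carrier SG"
    then show "\<one>\<^bsub>SG\<^esub> \<otimes>\<^bsub>SG\<^esub> a = a" unfolding one_eq_delta
      by (induction rule: skew_induct)
        (simp_all add: mult_zero_SG r_distr_SG delta_mult_delta act_1)
  next
    fix a assume "a \<in> carrier SG"
    then show "a \<otimes>\<^bsub>SG\<^esub> \<one>\<^bsub>SG\<^esub> = a" unfolding one_eq_delta
      by (induction rule: skew_induct)
        (simp_all add: zero_mult_SG l_distr_SG delta_mult_delta)
  qed (auto simp: assoc_SG one_eq_delta)
qed (auto simp: abelian_group_SG l_distr_SG r_distr_SG)

sublocale SG: ring SG
  by (rule ring_SG)

end


section \<open>The ideal of a trivialisation and the quotient ring\<close>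

locale skew_trivialisation = skew_action G S act
  for G :: "('g, 'p) monoid_scheme" and S :: "('s, 'q) ring_scheme" (structure)
    and act :: "'g \<Rightarrow> 's \<Rightarrow> 's" +
  fixes N :: "'g set" and \<beta> :: "'g \<Rightarrow> 's"
  assumes N: "N \<lhd> G" and \<beta>: "equivariant_trivialisation G S act N \<beta>"
begin

abbreviation "J \<equiv> triv_ideal G S act N \<beta>"
abbreviation "SQ \<equiv> skew_quot G S act N \<beta>"

definition rel :: "'g \<Rightarrow> 'g \<Rightarrow> 's"
  where "rel n = delta (inv (\<beta> n)) n \<ominus>\<^bsub>SG\<^esub> \<one>\<^bsub>SG\<^esub>"

lemma N_carrier [simp]: "n \<in> N \<Longrightarrow> n \<in> carrier G"
  using normal_imp_subgroup[OF N] by (rule subgroup.mem_carrier)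

lemma beta_Units: "n \<in> N \<Longrightarrow> \<beta> n \<in> Units S"
  using \<beta> by (auto simp: equivariant_trivialisation_def hom_def units_of_def)

lemma beta_closed [simp]: "n \<in> N \<Longrightarrow> \<beta> n \<in> carrier S"
  by (simp add: beta_Units S.Units_closed)

lemma inv_beta_closed [simp]: "n \<in> N \<Longrightarrow> inv (\<beta> n) \<in> carrier S"
  by (simp add: beta_Units)

lemma beta_conj: "\<lbrakk>g \<in> carrier G; n \<in> N\<rbrakk> \<Longrightarrow>
    \<beta> (g \<otimes>\<^bsub>G\<^esub> n \<otimes>\<^bsub>G\<^esub> inv\<^bsub>G\<^esub> g) = act g (\<beta> n)"
  using \<beta> by (auto simp: equivariant_trivialisation_def)

lemma beta_mult: "\<lbrakk>m \<in> N; n \<in> N\<rbrakk> \<Longrightarrow> \<beta> (m \<otimes>\<^bsub>G\<^esub> n) = \<beta> m \<otimes> \<beta> n"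
  using \<beta> by (auto simp: equivariant_trivialisation_def hom_def units_of_def)

text \<open>Conjugation by \<open>\<beta> n\<close> is the action of \<open>n\<close>, so the
  inverse of \<open>\<beta> n\<close> can be moved past \<open>s\<close>. This relation makes
  \<open>J\<close> two-sided and, later, makes the secret action compatible with the relations of
  the tensor product.\<close>

lemma inv_beta_act:
  assumes "n \<in> N" "s \<in> carrier S"
  shows "inv (\<beta> n) \<otimes> act n s = s \<otimes> inv (\<beta> n)"
proof -
  have "act n s = \<beta> n \<otimes> s \<otimes> inv (\<beta> n)"
    using \<beta> assms by (auto simp: equivariant_trivialisation_def)
  then show ?thesis
    using assms by (simp add: S.m_assoc[symmetric] beta_Units)
qed

lemma inv_unique_beta:
  assumes "n \<in> N" "x \<in> carrier S" "x \<otimes> \<beta> n = \<one>"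
  shows "x = inv (\<beta> n)"
proof -
  have "x = x \<otimes> (\<beta> n \<otimes> inv (\<beta> n))"
    using assms by (simp add: beta_Units)
  also have "\<dots> = inv (\<beta> n)"
    using assms by (simp add: S.m_assoc[symmetric])
  finally show ?thesis .
qed

text \<open>An inverse is determined by its product with \<open>\<beta>\<close>, so the equivariance
  of \<open>\<beta>\<close> carries over to the inverses.\<close>

lemma act_inv_beta:
  assumes "g \<in> carrier G" "n \<in> N"
  shows "act g (inv (\<beta> n)) = inv (\<beta> (g \<otimes>\<^bsub>G\<^esub> n \<otimes>\<^bsub>G\<^esub> inv\<^bsub>G\<^esub> g))"
proof (rule inv_unique_beta)
  show "g \<otimes>\<^bsub>G\<^esub> n \<otimes>\<^bsub>G\<^esub> inv\<^bsub>G\<^esub> g \<in> N"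
    using N assms by (simp add: normal.inv_op_closed2)
  show "act g (inv (\<beta> n)) \<otimes> \<beta> (g \<otimes>\<^bsub>G\<^esub> n \<otimes>\<^bsub>G\<^esub> inv\<^bsub>G\<^esub> g) = \<one>"
    using assms by (simp add: beta_conj act_times[symmetric] beta_Units)
qed (use assms in simp)

lemma inv_beta_mult:
  assumes "m \<in> N" "n \<in> N"
  shows "inv (\<beta> (m \<otimes>\<^bsub>G\<^esub> n)) = inv (\<beta> n) \<otimes> inv (\<beta> m)"
proof (rule inv_unique_beta[symmetric])
  show "m \<otimes>\<^bsub>G\<^esub> n \<in> N"
    using normal_imp_subgroup[OF N] assms by (simp add: subgroup.m_closed)
  have "inv (\<beta> n) \<otimes> inv (\<beta> m) \<otimes> (\<beta> m \<otimes> \<beta> n)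
      = inv (\<beta> n) \<otimes> (inv (\<beta> m) \<otimes> \<beta> m) \<otimes> \<beta> n"
    using assms by (simp add: S.m_assoc del: S.Units_l_inv)
  with assms show "inv (\<beta> n) \<otimes> inv (\<beta> m) \<otimes> \<beta> (m \<otimes>\<^bsub>G\<^esub> n) = \<one>"
    by (simp add: beta_mult beta_Units)
qed (use assms in simp)

lemma rel_closed [simp]: "n \<in> N \<Longrightarrow> rel n \<in> carrier SG"
  by (simp add: rel_def)

lemma J_eq_generate: "J = generate (add_monoid SG) {r \<otimes>\<^bsub>SG\<^esub> rel n | r n. r \<in> carrier SG \<and> n \<in> N}"
proof -
  have "{r \<otimes>\<^bsub>SG\<^esub> x | r x. r \<in> carrier SG \<and> x \<in> {rel n | n. n \<in> N}}
     = {r \<otimes>\<^bsub>SG\<^esub> rel n | r n. r \<in> carrier SG \<and> n \<in> N}" by blast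
  then show ?thesis
    by (simp add: triv_ideal_def left_ideal_gen_def Let_def rel_def)
qed

lemma J_subgroup: "subgroup J (add_monoid SG)"
  unfolding J_eq_generate by (rule SG.add.generate_is_subgroup) auto

text \<open>The way in which membership in \<open>J\<close> is exploited: a property that defines a
  subgroup and holds for the multiples of the generators holds on all of \<open>J\<close>.\<close>

lemma J_minimal:
  assumes "subgroup K (add_monoid SG)" "\<And>r n. \<lbrakk>r \<in> carrier SG; n \<in> N\<rbrakk> \<Longrightarrow> r \<otimes>\<^bsub>SG\<^esub> rel n \<in> K"
  shows "J \<subseteq> K"
  unfolding J_eq_generate by (rule SG.add.generate_subgroup_incl) (use assms in auto)

lemma mult_rel_in_J: "\<lbrakk>r \<in> carrier SG; n \<in> N\<rbrakk> \<Longrightarrow> r \<otimes>\<^bsub>SG\<^esub> rel n \<in> J"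
  unfolding J_eq_generate by (rule generate.incl) auto

text \<open>Moving a generator past a monomial only conjugates \<open>n\<close> by \<open>g\<close>:
  both products have the coefficient s \<beta>(n)^-1 at n g, minus s at g. Hence the left ideal
  \<open>J\<close> is also closed under multiplication from the right.\<close>

lemma rel_mult_delta:
  assumes "n \<in> N" "s \<in> carrier S" "g \<in> carrier G"
  shows "rel n \<otimes>\<^bsub>SG\<^esub> delta s g = delta s g \<otimes>\<^bsub>SG\<^esub> rel (inv\<^bsub>G\<^esub> g \<otimes>\<^bsub>G\<^esub> n \<otimes>\<^bsub>G\<^esub> g)"
proof -
  let ?m = "inv\<^bsub>G\<^esub> g \<otimes>\<^bsub>G\<^esub> n \<otimes>\<^bsub>G\<^esub> g"
  have m: "?m \<in> N"
    using N assms by (simp add: normal.inv_op_closed1)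
  have gm1: "g \<otimes>\<^bsub>G\<^esub> ?m = n \<otimes>\<^bsub>G\<^esub> g"
    using assms by (simp add: G.m_assoc[symmetric])
  have gm: "n \<otimes>\<^bsub>G\<^esub> g \<otimes>\<^bsub>G\<^esub> inv\<^bsub>G\<^esub> g = n"
    using assms by (simp add: G.m_assoc)
  have "rel n \<otimes>\<^bsub>SG\<^esub> delta s g
      = delta (inv (\<beta> n) \<otimes> act n s) (n \<otimes>\<^bsub>G\<^esub> g) \<ominus>\<^bsub>SG\<^esub> delta s g"
    using assms
    by (simp add: rel_def a_minus_def SG.l_distr SG.l_minus delta_mult_delta)
  moreover have "delta s g \<otimes>\<^bsub>SG\<^esub> rel ?m
      = delta (s \<otimes> act g (inv (\<beta> ?m))) (g \<otimes>\<^bsub>G\<^esub> ?m) \<ominus>\<^bsub>SG\<^esub> delta s g"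
    using assms m
    by (simp add: rel_def a_minus_def SG.r_distr SG.r_minus delta_mult_delta)
  ultimately show ?thesis
    using assms m by (simp only: gm gm1 act_inv_beta inv_beta_act)
qed

lemma rel_mult_in_J:
  assumes "x \<in> carrier SG" "r \<in> carrier SG" "n \<in> N"
  shows "r \<otimes>\<^bsub>SG\<^esub> rel n \<otimes>\<^bsub>SG\<^esub> x \<in> J"
  using assms
proof (induction rule: skew_induct)
  case zero
  then show ?case using subgroup.one_closed[OF J_subgroup] by (simp add: mult_zero_SG)
next
  case (delta s g)
  have "inv\<^bsub>G\<^esub> g \<otimes>\<^bsub>G\<^esub> n \<otimes>\<^bsub>G\<^esub> g \<in> N"
    using N delta by (simp add: normal.inv_op_closed1)
  then show ?case
    using mult_rel_in_J[of "r \<otimes>\<^bsub>SG\<^esub> delta s g" "inv\<^bsub>G\<^esub> g \<otimes>\<^bsub>G\<^esub> n \<otimes>\<^bsub>G\<^esub> g"] delta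
    by (simp add: SG.m_assoc rel_mult_delta)
next
  case (add a b)
  then show ?case using subgroup.m_closed[OF J_subgroup] by (simp add: SG.r_distr)
qed

lemma J_ideal: "ideal J SG"
proof (rule idealI[OF ring_SG J_subgroup])
  fix a x assume a: "a \<in> J" and x: "x \<in> carrier SG"
  have sub: "J \<subseteq> carrier SG" using subgroup.subset[OF J_subgroup] by simp
  have zero: "\<zero>\<^bsub>SG\<^esub> \<in> J" and add: "\<And>y z. \<lbrakk>y \<in> J; z \<in> J\<rbrakk> \<Longrightarrow> y \<oplus>\<^bsub>SG\<^esub> z \<in> J"
    and minus: "\<And>y. y \<in> J \<Longrightarrow> \<ominus>\<^bsub>SG\<^esub> y \<in> J"
    using subgroup.one_closed[OF J_subgroup] subgroup.m_closed[OF J_subgroup]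
      subgroup.m_inv_closed[OF J_subgroup] by (simp_all add: a_inv_def)
  \<comment> \<open>The elements that multiplication by \<open>x\<close> sends into \<open>J\<close>
    form a subgroup. It contains the multiples of the generators, hence \<open>J\<close>. The other
    side is treated in the same way.\<close>
  have "subgroup {a \<in> carrier SG. x \<otimes>\<^bsub>SG\<^esub> a \<in> J} (add_monoid SG)"
    by (rule SG.add.subgroupI)
      (use x zero add minus in \<open>auto simp: SG.r_distr SG.r_minus a_inv_def[symmetric] intro: exI[of _ "\<zero>\<^bsub>SG\<^esub>"]\<close>)
  then have "J \<subseteq> {a \<in> carrier SG. x \<otimes>\<^bsub>SG\<^esub> a \<in> J}"
    by (rule J_minimal) (use x in \<open>simp add: SG.m_assoc[symmetric] mult_rel_in_J\<close>)
  with a show "x \<otimes>\<^bsub>SG\<^esub> a \<in> J" by auto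
  have "subgroup {a \<in> carrier SG. a \<otimes>\<^bsub>SG\<^esub> x \<in> J} (add_monoid SG)"
    by (rule SG.add.subgroupI)
      (use x zero add minus in \<open>auto simp: SG.l_distr SG.l_minus a_inv_def[symmetric] intro: exI[of _ "\<zero>\<^bsub>SG\<^esub>"]\<close>)
  then have "J \<subseteq> {a \<in> carrier SG. a \<otimes>\<^bsub>SG\<^esub> x \<in> J}"
    by (rule J_minimal) (use x in \<open>simp add: rel_mult_in_J\<close>)
  with a show "a \<otimes>\<^bsub>SG\<^esub> x \<in> J" by auto
qed

sublocale J: ideal J SG
  by (rule J_ideal)

abbreviation "cls \<equiv> skew_class G S act N \<beta>"
abbreviation "coef \<equiv> skew_coeff G S act N \<beta>"
abbreviation "grp \<equiv> skew_grp G S act N \<beta>"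

lemma cls_hom: "cls \<in> ring_hom SG SQ"
proof -
  have "cls = (\<lambda>a. J +>\<^bsub>SG\<^esub> a)" by (simp add: skew_class_def fun_eq_iff)
  then show ?thesis using J.rcos_ring_hom by (simp add: skew_quot_def)
qed

lemma cls_closed [simp]: "a \<in> carrier SG \<Longrightarrow> cls a \<in> carrier SQ"
  using cls_hom by (rule ring_hom_closed)

lemma cls_eq: "\<lbrakk>a \<in> carrier SG; b \<in> carrier SG; a \<ominus>\<^bsub>SG\<^esub> b \<in> J\<rbrakk> \<Longrightarrow> cls a = cls b"
  unfolding skew_class_def using SG.quotient_eq_iff_same_a_r_cos[OF J_ideal] by blast

lemma coef_closed [simp]: "s \<in> carrier S \<Longrightarrow> coef s \<in> carrier SQ"
  by (simp add: skew_coeff_def)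

lemma grp_closed [simp]: "g \<in> carrier G \<Longrightarrow> grp g \<in> carrier SQ"
  by (simp add: skew_grp_def)

lemma coef_hom: "coef \<in> ring_hom S SQ"
proof (rule ring_hom_memI)
  show "coef \<one> = \<one>\<^bsub>SQ\<^esub>"
    using ring_hom_one[OF cls_hom] by (simp add: skew_coeff_def one_eq_delta)
next
  fix s t assume st: "s \<in> carrier S" "t \<in> carrier S"
  then show "coef (s \<otimes> t) = coef s \<otimes>\<^bsub>SQ\<^esub> coef t"
    unfolding skew_coeff_def
    by (subst ring_hom_mult[OF cls_hom, symmetric]) (simp_all add: delta_mult_delta act_1)
  from st show "coef (s \<oplus> t) = coef s \<oplus>\<^bsub>SQ\<^esub> coef t"
    unfolding skew_coeff_def
    by (subst ring_hom_add[OF cls_hom, symmetric]) (simp_all add: delta_add)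
qed simp

lemma grp_mult: "\<lbrakk>g \<in> carrier G; h \<in> carrier G\<rbrakk> \<Longrightarrow> grp (g \<otimes>\<^bsub>G\<^esub> h) = grp g \<otimes>\<^bsub>SQ\<^esub> grp h"
  unfolding skew_grp_def
  by (subst ring_hom_mult[OF cls_hom, symmetric]) (simp_all add: delta_mult_delta)

lemma grp_one: "grp \<one>\<^bsub>G\<^esub> = \<one>\<^bsub>SQ\<^esub>"
  using ring_hom_one[OF cls_hom] by (simp add: skew_grp_def one_eq_delta)

lemma grp_coef: "\<lbrakk>g \<in> carrier G; s \<in> carrier S\<rbrakk> \<Longrightarrow>
    grp g \<otimes>\<^bsub>SQ\<^esub> coef s = coef (act g s) \<otimes>\<^bsub>SQ\<^esub> grp g"
  unfolding skew_grp_def skew_coeff_def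
  by (simp add: ring_hom_mult[OF cls_hom, symmetric] delta_mult_delta act_1)

text \<open>Multiply the generator \<beta>(n)^-1 n - 1 by \<beta>(n). Applied over \<open>S\<close>,
  this makes \<open>\<Phi>\<close> invariant under the secret action; applied over
  \<open>S'\<close>, it makes \<open>H'\<close> act trivially.\<close>

lemma grp_eq_coef_beta:
  assumes "n \<in> N" shows "grp n = coef (\<beta> n)"
proof -
  have "delta (\<beta> n) \<one>\<^bsub>G\<^esub> \<otimes>\<^bsub>SG\<^esub> rel n = delta \<one> n \<ominus>\<^bsub>SG\<^esub> delta (\<beta> n) \<one>\<^bsub>G\<^esub>"
    using assms
    by (simp add: rel_def a_minus_def SG.r_distr SG.r_minus delta_mult_delta act_1 beta_Units)
  then show ?thesis
    unfolding skew_grp_def skew_coeff_def using assms mult_rel_in_J[of "delta (\<beta> n) \<one>\<^bsub>G\<^esub>" n]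
    by (intro cls_eq) auto
qed

end

text \<open>Evaluates maps defined on cosets: \<open>the_elem\<close> has a determined value only if
  all representatives give the same result.\<close>

lemma on_cosets_const:
  assumes "C \<noteq> {}" "\<And>x. x \<in> C \<Longrightarrow> h x = y"
  shows "on_cosets h C = y"
proof -
  have "h ` C = {y}" using assms by auto
  then show ?thesis by (simp add: on_cosets_def)
qed

section \<open>Functoriality in the coefficient ring\<close>

locale skew_change = S: skew_trivialisation G S act N \<beta> + S': skew_trivialisation G S' act' N' \<beta>'
  for G :: "('g, 'p) monoid_scheme" and S :: "('s, 'q) ring_scheme"
    and act :: "'g \<Rightarrow> 's \<Rightarrow> 's" and N :: "'g set" and \<beta> :: "'g \<Rightarrow> 's"
    and S' :: "('t, 'r) ring_scheme" and act' :: "'g \<Rightarrow> 't \<Rightarrow> 't"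
    and N' :: "'g set" and \<beta>' :: "'g \<Rightarrow> 't" +
  fixes f :: "'t \<Rightarrow> 's"
  assumes f: "f \<in> ring_hom S' S"
    and f_act: "\<lbrakk>g \<in> carrier G; x \<in> carrier S'\<rbrakk> \<Longrightarrow> f (act' g x) = act g (f x)"
    and N'_N: "N' \<subseteq> N"
    and f_beta: "n \<in> N' \<Longrightarrow> f (\<beta>' n) = \<beta> n"
begin

lemma f_closed [simp]: "x \<in> carrier S' \<Longrightarrow> f x \<in> carrier S"
  using f by (rule ring_hom_closed)

lemma f_zero [simp]: "f \<zero>\<^bsub>S'\<^esub> = \<zero>\<^bsub>S\<^esub>"
  using ring_hom_zero[OF f S'.S.ring_axioms S.S.ring_axioms] .

definition f_coeffs :: "('g \<Rightarrow> 't) \<Rightarrow> 'g \<Rightarrow> 's"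
  where "f_coeffs a = (\<lambda>g. if g \<in> carrier G then f (a g) else \<zero>\<^bsub>S\<^esub>)"

lemma f_coeffs_closed [simp]: "a \<in> carrier S'.SG \<Longrightarrow> f_coeffs a \<in> carrier S.SG"
proof -
  assume a: "a \<in> carrier S'.SG"
  have "finite (S.supp (f_coeffs a))"
    by (rule finite_subset[OF _ S'.finite_supp[OF a]]) (auto simp: f_coeffs_def)
  then show ?thesis
    using S'.coeff_closed[OF a] by (auto simp: S.in_carrier_iff f_coeffs_def)
qed

lemma f_coeffs_delta: "\<lbrakk>x \<in> carrier S'; g \<in> carrier G\<rbrakk> \<Longrightarrow>
    f_coeffs (S'.delta x g) = S.delta (f x) g"
  by (auto simp: f_coeffs_def skew_elem_def)

lemma f_coeffs_add: "\<lbrakk>a \<in> carrier S'.SG; b \<in> carrier S'.SG\<rbrakk> \<Longrightarrow>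
    f_coeffs (a \<oplus>\<^bsub>S'.SG\<^esub> b) = f_coeffs a \<oplus>\<^bsub>S.SG\<^esub> f_coeffs b"
  by (auto simp: f_coeffs_def S.add_apply S'.add_apply fun_eq_iff ring_hom_add[OF f] S'.coeff_closed)

lemma f_coeffs_zero: "f_coeffs \<zero>\<^bsub>S'.SG\<^esub> = \<zero>\<^bsub>S.SG\<^esub>"
  by (auto simp: f_coeffs_def S.zero_apply S'.zero_apply)

lemma f_coeffs_mult:
  assumes "a \<in> carrier S'.SG" "b \<in> carrier S'.SG"
  shows "f_coeffs (a \<otimes>\<^bsub>S'.SG\<^esub> b) = f_coeffs a \<otimes>\<^bsub>S.SG\<^esub> f_coeffs b"
  using assms
proof (induction rule: S'.skew_induct)
  case a: (delta s g)
  from a(3) show ?case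
  proof (induction rule: S'.skew_induct)
    case (delta t h)
    with a(1,2) show ?case
      by (simp add: S'.delta_mult_delta S.delta_mult_delta f_coeffs_delta f_act ring_hom_mult[OF f])
  qed (use a(1,2) in \<open>simp_all add: f_coeffs_zero S'.SG.r_distr S.SG.r_distr f_coeffs_add\<close>)
qed (simp_all add: f_coeffs_zero S'.SG.l_distr S.SG.l_distr f_coeffs_add)

lemma f_coeffs_hom: "f_coeffs \<in> ring_hom S'.SG S.SG"
  by (rule ring_hom_memI)
    (simp_all add: f_coeffs_add f_coeffs_mult S.one_eq_delta S'.one_eq_delta f_coeffs_delta ring_hom_one[OF f])

sublocale fc: ring_hom_ring S'.SG S.SG f_coeffs
  by (rule ring_hom_ringI2[OF S'.ring_SG S.ring_SG f_coeffs_hom])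

lemma f_inv_beta:
  assumes "n \<in> N'" shows "f (inv\<^bsub>S'\<^esub> (\<beta>' n)) = inv\<^bsub>S\<^esub> (\<beta> n)"
proof (rule S.inv_unique_beta)
  have "f (inv\<^bsub>S'\<^esub> (\<beta>' n)) \<otimes>\<^bsub>S\<^esub> f (\<beta>' n) = f (inv\<^bsub>S'\<^esub> (\<beta>' n) \<otimes>\<^bsub>S'\<^esub> \<beta>' n)"
    using assms by (simp add: ring_hom_mult[OF f])
  with assms show "f (inv\<^bsub>S'\<^esub> (\<beta>' n)) \<otimes>\<^bsub>S\<^esub> \<beta> n = \<one>\<^bsub>S\<^esub>"
    by (simp add: f_beta S'.beta_Units ring_hom_one[OF f])
qed (use assms N'_N in auto)

lemma f_coeffs_rel: "n \<in> N' \<Longrightarrow> f_coeffs (S'.rel n) = S.rel n"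
  using N'_N by (auto simp: S'.rel_def S.rel_def a_minus_def S'.one_eq_delta S.one_eq_delta
      f_coeffs_delta f_inv_beta ring_hom_one[OF f])

text \<open>Since \<open>f\<close> takes the inverse of \<open>\<beta>'\<close> to the inverse of
  \<open>\<beta>\<close>, generators of one ideal go to generators of the other. So applying
  \<open>f\<close> to the coefficients respects cosets.\<close>

lemma f_coeffs_J: "a \<in> S'.J \<Longrightarrow> f_coeffs a \<in> S.J"
proof -
  have "subgroup {a \<in> carrier S'.SG. f_coeffs a \<in> S.J} (add_monoid S'.SG)"
    by (rule S'.SG.add.subgroupI) (auto simp: a_inv_def[symmetric] intro: exI[of _ "\<zero>\<^bsub>S'.SG\<^esub>"])
  then have "S'.J \<subseteq> {a \<in> carrier S'.SG. f_coeffs a \<in> S.J}"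
    by (rule S'.J_minimal) (use N'_N in \<open>auto simp: f_coeffs_rel S.mult_rel_in_J\<close>)
  then show "a \<in> S'.J \<Longrightarrow> f_coeffs a \<in> S.J" by auto
qed

text \<open>Representatives of one coset differ by an element of the source ideal, and
  \<open>f_coeffs_J\<close> sends this element into the target ideal.\<close>

lemma skew_map_cls:
  assumes "a \<in> carrier S'.SG"
  shows "skew_map G S act N \<beta> f (S'.cls a) = S.cls (f_coeffs a)"
  unfolding skew_map_def f_coeffs_def[symmetric]
proof (rule on_cosets_const)
  have a: "a \<in> S'.cls a"
    unfolding skew_class_def using assms S'.J.a_rcos_self by blast
  then show "S'.cls a \<noteq> {}" by blast
  fix b assume "b \<in> S'.cls a"
  then obtain j where j: "j \<in> S'.J" "b = j \<oplus>\<^bsub>S'.SG\<^esub> a"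
    by (auto simp: skew_class_def a_r_coset_def')
  have jc: "j \<in> carrier S'.SG" using j by (simp add: S'.J.Icarr)
  then have "f_coeffs b \<ominus>\<^bsub>S.SG\<^esub> f_coeffs a = f_coeffs j"
    using j assms by (simp add: a_minus_def S.SG.a_assoc S.SG.r_neg)
  with j jc assms f_coeffs_J show "S.cls (f_coeffs b) = S.cls (f_coeffs a)"
    by (intro S.cls_eq) auto
qed

lemma skew_map_coef: "x \<in> carrier S' \<Longrightarrow> skew_map G S act N \<beta> f (S'.coef x) = S.coef (f x)"
  by (simp add: skew_coeff_def skew_map_cls f_coeffs_delta)

lemma skew_map_grp: "g \<in> carrier G \<Longrightarrow> skew_map G S act N \<beta> f (S'.grp g) = S.grp g"
  by (simp add: skew_grp_def skew_map_cls f_coeffs_delta ring_hom_one[OF f])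

end


section \<open>Modules\<close>

lemma left_moduleI:
  assumes "ring R" "abelian_group M"
    and "\<And>a x. \<lbrakk>a \<in> carrier R; x \<in> carrier M\<rbrakk> \<Longrightarrow> a \<odot>\<^bsub>M\<^esub> x \<in> carrier M"
    and "\<And>a b x. \<lbrakk>a \<in> carrier R; b \<in> carrier R; x \<in> carrier M\<rbrakk> \<Longrightarrow>
        (a \<oplus>\<^bsub>R\<^esub> b) \<odot>\<^bsub>M\<^esub> x = a \<odot>\<^bsub>M\<^esub> x \<oplus>\<^bsub>M\<^esub> b \<odot>\<^bsub>M\<^esub> x"
    and "\<And>a x y. \<lbrakk>a \<in> carrier R; x \<in> carrier M; y \<in> carrier M\<rbrakk> \<Longrightarrow>
        a \<odot>\<^bsub>M\<^esub> (x \<oplus>\<^bsub>M\<^esub> y) = a \<odot>\<^bsub>M\<^esub> x \<oplus>\<^bsub>M\<^esub> a \<odot>\<^bsub>M\<^esub> y"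
    and "\<And>a b x. \<lbrakk>a \<in> carrier R; b \<in> carrier R; x \<in> carrier M\<rbrakk> \<Longrightarrow>
        (a \<otimes>\<^bsub>R\<^esub> b) \<odot>\<^bsub>M\<^esub> x = a \<odot>\<^bsub>M\<^esub> (b \<odot>\<^bsub>M\<^esub> x)"
    and "\<And>x. x \<in> carrier M \<Longrightarrow> \<one>\<^bsub>R\<^esub> \<odot>\<^bsub>M\<^esub> x = x"
  shows "left_module R M"
  using assms by (simp add: left_module_def left_module_axioms_def)

lemma (in abelian_group) idem_zero: "\<lbrakk>x \<in> carrier G; x \<oplus> x = x\<rbrakk> \<Longrightarrow> x = \<zero>"
  using add.l_cancel_one by blast

lemma (in abelian_group) diff_eq_zero_iff:
  assumes "x \<in> carrier G" "y \<in> carrier G" shows "x \<ominus> y = \<zero> \<longleftrightarrow> x = y"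
proof
  assume *: "x \<ominus> y = \<zero>"
  have "x = x \<ominus> y \<oplus> y" using assms by (simp add: a_minus_def a_assoc l_neg)
  with * assms show "x = y" by simp
qed (use assms in \<open>simp add: a_minus_def r_neg\<close>)

lemma abelian_group_cong:
  assumes "abelian_group M" "carrier N = carrier M" "\<zero>\<^bsub>N\<^esub> = \<zero>\<^bsub>M\<^esub>"
    and add: "\<And>x y. \<lbrakk>x \<in> carrier M; y \<in> carrier M\<rbrakk> \<Longrightarrow> x \<oplus>\<^bsub>N\<^esub> y = x \<oplus>\<^bsub>M\<^esub> y"
  shows "abelian_group N"
proof -
  interpret M: abelian_group M by fact
  show ?thesis
  proof (rule abelian_groupI)
    fix x assume "x \<in> carrier N"
    then show "\<exists>y\<in>carrier N. y \<oplus>\<^bsub>N\<^esub> x = \<zero>\<^bsub>N\<^esub>"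
      using assms M.l_neg[of x] M.a_inv_closed[of x] by metis
  qed (use assms in \<open>auto simp: M.a_assoc intro: M.a_comm\<close>)
qed

lemma restrict_scalars_simps [simp]:
  "carrier (restrict_scalars \<phi> M) = carrier M" "add (restrict_scalars \<phi> M) = add M"
  "ring.zero (restrict_scalars \<phi> M) = ring.zero M"
  "smult (restrict_scalars \<phi> M) = (\<lambda>a. smult M (\<phi> a))"
  by (simp_all add: restrict_scalars_def)

lemma abelian_group_restrict_scalars:
  "abelian_group M \<Longrightarrow> abelian_group (restrict_scalars \<phi> M)"
  by (rule abelian_group_cong) simp_all

context left_module
begin

lemma smult_zero_l [simp]:
  assumes "x \<in> carrier M" shows "\<zero> \<odot>\<^bsub>M\<^esub> x = \<zero>\<^bsub>M\<^esub>"
proof (rule M.idem_zero)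
  show "\<zero> \<odot>\<^bsub>M\<^esub> x \<in> carrier M" using assms by (simp add: smult_closed)
  show "\<zero> \<odot>\<^bsub>M\<^esub> x \<oplus>\<^bsub>M\<^esub> \<zero> \<odot>\<^bsub>M\<^esub> x = \<zero> \<odot>\<^bsub>M\<^esub> x"
    using assms by (subst smult_l_distr[symmetric]) auto
qed

lemma smult_zero_r [simp]:
  assumes "a \<in> carrier R" shows "a \<odot>\<^bsub>M\<^esub> \<zero>\<^bsub>M\<^esub> = \<zero>\<^bsub>M\<^esub>"
proof (rule M.idem_zero)
  show "a \<odot>\<^bsub>M\<^esub> \<zero>\<^bsub>M\<^esub> \<in> carrier M" using assms by (simp add: smult_closed)
  show "a \<odot>\<^bsub>M\<^esub> \<zero>\<^bsub>M\<^esub> \<oplus>\<^bsub>M\<^esub> a \<odot>\<^bsub>M\<^esub> \<zero>\<^bsub>M\<^esub> = a \<odot>\<^bsub>M\<^esub> \<zero>\<^bsub>M\<^esub>"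
    using assms by (subst smult_r_distr[symmetric]) auto
qed

lemma smult_minus_r: "\<lbrakk>a \<in> carrier R; x \<in> carrier M\<rbrakk> \<Longrightarrow>
    a \<odot>\<^bsub>M\<^esub> (\<ominus>\<^bsub>M\<^esub> x) = \<ominus>\<^bsub>M\<^esub> (a \<odot>\<^bsub>M\<^esub> x)"
  by (rule M.minus_equality[symmetric])
    (simp_all add: smult_r_distr[symmetric] M.l_neg smult_closed)

lemma smult_minus_l: "\<lbrakk>a \<in> carrier R; x \<in> carrier M\<rbrakk> \<Longrightarrow>
    (\<ominus> a) \<odot>\<^bsub>M\<^esub> x = \<ominus>\<^bsub>M\<^esub> (a \<odot>\<^bsub>M\<^esub> x)"
  by (rule M.minus_equality[symmetric])
    (simp_all add: smult_l_distr[symmetric] R.l_neg smult_closed)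

lemma restrict_scalars_left_module:
  assumes "ring Q" "\<phi> \<in> ring_hom Q R"
  shows "left_module Q (restrict_scalars \<phi> M)"
  by (rule left_moduleI)
    (use assms abelian_group_restrict_scalars[OF M.abelian_group_axioms] in \<open>simp_all add: ring_hom_closed ring_hom_add ring_hom_mult ring_hom_one
      smult_closed smult_l_distr smult_r_distr smult_assoc1 smult_one\<close>)

lemma submodule_iff:
  "submodule K R M \<longleftrightarrow> subgroup K (add_monoid M) \<and> (\<forall>a\<in>carrier R. \<forall>x\<in>K. a \<odot>\<^bsub>M\<^esub> x \<in> K)"
  by (auto simp: submodule_def submodule_axioms_def)

text \<open>Closure under negatives follows from closure under scalars, as minus one acts by
  negation.\<close>

lemma submodule_leftI:
  assumes "K \<subseteq> carrier M" "\<zero>\<^bsub>M\<^esub> \<in> K"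
    and "\<And>x y. \<lbrakk>x \<in> K; y \<in> K\<rbrakk> \<Longrightarrow> x \<oplus>\<^bsub>M\<^esub> y \<in> K"
    and "\<And>a x. \<lbrakk>a \<in> carrier R; x \<in> K\<rbrakk> \<Longrightarrow> a \<odot>\<^bsub>M\<^esub> x \<in> K"
  shows "submodule K R M"
proof -
  have "\<ominus>\<^bsub>M\<^esub> x \<in> K" if "x \<in> K" for x
  proof -
    have "(\<ominus> \<one>) \<odot>\<^bsub>M\<^esub> x \<in> K" using assms(4) that by simp
    then show ?thesis using assms(1) that by (simp add: smult_minus_l smult_one subset_iff)
  qed
  then show ?thesis
    unfolding submodule_iff
    by (intro conjI M.add.subgroupI) (use assms in \<open>auto simp: a_inv_def[symmetric]\<close>)
qed

lemma submodule_subset: "submodule K R M \<Longrightarrow> K \<subseteq> carrier M"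
  unfolding submodule_iff using subgroup.subset by fastforce

lemma submodule_zero: "submodule K R M \<Longrightarrow> \<zero>\<^bsub>M\<^esub> \<in> K"
  unfolding submodule_iff using subgroup.one_closed by fastforce

lemma submodule_add: "\<lbrakk>submodule K R M; x \<in> K; y \<in> K\<rbrakk> \<Longrightarrow> x \<oplus>\<^bsub>M\<^esub> y \<in> K"
  unfolding submodule_iff using subgroup.m_closed by fastforce

lemma submodule_minus: "\<lbrakk>submodule K R M; x \<in> K\<rbrakk> \<Longrightarrow> \<ominus>\<^bsub>M\<^esub> x \<in> K"
  unfolding submodule_iff a_inv_def using subgroup.m_inv_closed by fastforce

lemma submodule_smult: "\<lbrakk>submodule K R M; a \<in> carrier R; x \<in> K\<rbrakk> \<Longrightarrow> a \<odot>\<^bsub>M\<^esub> x \<in> K"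
  unfolding submodule_iff by blast

lemma submodule_left_module:
  assumes "submodule K R M"
  shows "left_module R (M\<lparr>carrier := K\<rparr>)"
proof (rule left_moduleI)
  show "abelian_group (M\<lparr>carrier := K\<rparr>)"
  proof (rule abelian_groupI)
    fix x assume "x \<in> carrier (M\<lparr>carrier := K\<rparr>)"
    then show "\<exists>y\<in>carrier (M\<lparr>carrier := K\<rparr>). y \<oplus>\<^bsub>M\<lparr>carrier := K\<rparr>\<^esub> x = \<zero>\<^bsub>M\<lparr>carrier := K\<rparr>\<^esub>"
      using submodule_minus[OF assms] submodule_subset[OF assms] M.l_neg by auto
  qed (use submodule_subset[OF assms] in \<open>auto simp: submodule_add[OF assms] submodule_zero[OF assms] subset_iff M.a_assoc intro: M.a_comm\<close>)
qed (use submodule_subset[OF assms] R.ring_axioms in \<open>auto simp: submodule_smult[OF assms]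
  subset_iff smult_l_distr smult_r_distr smult_assoc1 smult_one\<close>)

end

lemma lin_homD:
  assumes "\<phi> \<in> lin_hom R M N"
  shows "x \<in> carrier M \<Longrightarrow> \<phi> x \<in> carrier N"
    and "\<lbrakk>x \<in> carrier M; y \<in> carrier M\<rbrakk> \<Longrightarrow> \<phi> (x \<oplus>\<^bsub>M\<^esub> y) = \<phi> x \<oplus>\<^bsub>N\<^esub> \<phi> y"
    and "\<lbrakk>a \<in> carrier R; x \<in> carrier M\<rbrakk> \<Longrightarrow> \<phi> (a \<odot>\<^bsub>M\<^esub> x) = a \<odot>\<^bsub>N\<^esub> \<phi> x"
  using assms by (auto simp: lin_hom_def hom_def)

lemma lin_homI:
  assumes "\<And>x. x \<in> carrier M \<Longrightarrow> \<phi> x \<in> carrier N"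
    and "\<And>x y. \<lbrakk>x \<in> carrier M; y \<in> carrier M\<rbrakk> \<Longrightarrow> \<phi> (x \<oplus>\<^bsub>M\<^esub> y) = \<phi> x \<oplus>\<^bsub>N\<^esub> \<phi> y"
    and "\<And>a x. \<lbrakk>a \<in> carrier R; x \<in> carrier M\<rbrakk> \<Longrightarrow> \<phi> (a \<odot>\<^bsub>M\<^esub> x) = a \<odot>\<^bsub>N\<^esub> \<phi> x"
  shows "\<phi> \<in> lin_hom R M N"
  using assms by (auto simp: lin_hom_def hom_def)


section \<open>Extension of scalars\<close>

locale scalar_extension = S: ring S + S': ring S' + N: left_module S' N
  for S :: "('s, 'p) ring_scheme" and S' :: "('t, 'q) ring_scheme" and N :: "('t, 'm) module" +
  fixes f :: "'t \<Rightarrow> 's"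
  assumes f: "f \<in> ring_hom S' S"
begin

abbreviation "FA \<equiv> tensor_free S N"
abbreviation "Rel \<equiv> tensor_rels S S' f N"
abbreviation "T \<equiv> base_change S S' f N"

definition tcls :: "('s \<times> 'm \<Rightarrow>\<^sub>0 int) \<Rightarrow> ('s \<times> 'm \<Rightarrow>\<^sub>0 int) set"
  where "tcls c = Rel #>\<^bsub>FA\<^esub> c"

definition tensor :: "'s \<Rightarrow> 'm \<Rightarrow> ('s \<times> 'm \<Rightarrow>\<^sub>0 int) set"
  where "tensor s m = tcls (frag_of (s, m))"

lemma f_closed [simp]: "x \<in> carrier S' \<Longrightarrow> f x \<in> carrier S"
  using f by (rule ring_hom_closed)

sublocale FA: comm_group FA
  unfolding tensor_free_def by (rule abelian_free_Abelian_group)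

lemma carrier_FA: "c \<in> carrier FA \<longleftrightarrow> Poly_Mapping.keys c \<subseteq> carrier S \<times> carrier N"
  by (simp add: tensor_free_def)

lemma frag_of_FA: "\<lbrakk>s \<in> carrier S; m \<in> carrier N\<rbrakk> \<Longrightarrow> frag_of (s, m) \<in> carrier FA"
  by (simp add: carrier_FA keys_frag_of)

lemma FA_simps [simp]: "x \<otimes>\<^bsub>FA\<^esub> y = x + y" "\<one>\<^bsub>FA\<^esub> = 0"
  by (simp_all add: tensor_free_def)

lemma FA_inv: "x \<in> carrier FA \<Longrightarrow> inv\<^bsub>FA\<^esub> x = - x"
  by (simp add: tensor_free_def)

lemma FA_add: "\<lbrakk>x \<in> carrier FA; y \<in> carrier FA\<rbrakk> \<Longrightarrow> x + y \<in> carrier FA"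
  using FA.m_closed[of x y] by simp

lemma FA_diff: "\<lbrakk>x \<in> carrier FA; y \<in> carrier FA\<rbrakk> \<Longrightarrow> x - y \<in> carrier FA"
  using FA_add[of x "- y"] FA.inv_closed[of y] by (simp add: FA_inv)

definition gens :: "('s \<times> 'm \<Rightarrow>\<^sub>0 int) set"
  where "gens = {frag_of (s \<oplus>\<^bsub>S\<^esub> t, m) - (frag_of (s, m) + frag_of (t, m)) | s t m.
        s \<in> carrier S \<and> t \<in> carrier S \<and> m \<in> carrier N} \<union>
     {frag_of (s, m \<oplus>\<^bsub>N\<^esub> n) - (frag_of (s, m) + frag_of (s, n)) | s m n.
        s \<in> carrier S \<and> m \<in> carrier N \<and> n \<in> carrier N} \<union>
     {frag_of (s \<otimes>\<^bsub>S\<^esub> f r, m) - frag_of (s, r \<odot>\<^bsub>N\<^esub> m) | s r m.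
        s \<in> carrier S \<and> r \<in> carrier S' \<and> m \<in> carrier N}"

lemma Rel_gens: "Rel = generate FA gens"
  by (simp add: tensor_rels_def gens_def)

lemma gens_FA: "gens \<subseteq> carrier FA"
  unfolding gens_def by (auto intro!: FA_diff FA_add frag_of_FA N.smult_closed)

lemma Rel_subgroup: "subgroup Rel FA"
  unfolding Rel_gens by (rule FA.generate_is_subgroup[OF gens_FA])

lemma Rel_normal: "Rel \<lhd> FA"
  by (rule FA.subgroup_imp_normal[OF Rel_subgroup])

lemma T_simps:
  "carrier T = carrier (FA Mod Rel)" "add T = monoid.mult (FA Mod Rel)" "\<zero>\<^bsub>T\<^esub> = \<one>\<^bsub>FA Mod Rel\<^esub>"
  by (simp_all add: base_change_def Let_def)

sublocale T: abelian_group T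
proof -
  interpret Q: comm_group "FA Mod Rel"
    by (rule FA.abelian_FactGroup[OF Rel_subgroup])
  show "abelian_group T"
    by (rule abelian_groupI; unfold T_simps)
      (rule Q.m_closed Q.one_closed Q.m_assoc Q.m_comm Q.l_one Q.l_inv_ex | assumption)+
qed

lemma carrier_T: "carrier T = tcls ` carrier FA"
  by (simp add: base_change_def Let_def carrier_FactGroup tcls_def[abs_def])

lemma tcls_hom: "tcls \<in> hom FA (add_monoid T)"
  using normal.r_coset_hom_Mod[OF Rel_normal] by (simp add: hom_def T_simps tcls_def[abs_def])

lemma tcls_closed: "c \<in> carrier FA \<Longrightarrow> tcls c \<in> carrier T"
  by (simp add: carrier_T)

lemma tcls_add: "\<lbrakk>c \<in> carrier FA; d \<in> carrier FA\<rbrakk> \<Longrightarrow> tcls (c + d) = tcls c \<oplus>\<^bsub>T\<^esub> tcls d"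
  using hom_mult[OF tcls_hom] by simp

lemma tcls_zero: "tcls 0 = \<zero>\<^bsub>T\<^esub>"
  using hom_one[OF tcls_hom FA.is_group T.add.is_group] by simp

lemma tcls_diff: "\<lbrakk>c \<in> carrier FA; d \<in> carrier FA\<rbrakk> \<Longrightarrow> tcls (c - d) = tcls c \<ominus>\<^bsub>T\<^esub> tcls d"
  using tcls_add[of "c - d" d] by (simp add: FA_diff tcls_closed a_minus_def T.a_assoc T.r_neg)

lemma tcls_eq_zero_iff: "c \<in> carrier FA \<Longrightarrow> tcls c = \<zero>\<^bsub>T\<^esub> \<longleftrightarrow> c \<in> Rel"
  using FA.coset_join1[of Rel c] FA.coset_join2[of c Rel] Rel_subgroup subgroup.subset[OF Rel_subgroup]
  by (auto simp: tcls_def base_change_def Let_def)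

lemma tensor_closed [simp]: "\<lbrakk>s \<in> carrier S; m \<in> carrier N\<rbrakk> \<Longrightarrow> tensor s m \<in> carrier T"
  by (simp add: tensor_def tcls_closed frag_of_FA)

lemma gens_tcls: "c \<in> gens \<Longrightarrow> tcls c = \<zero>\<^bsub>T\<^esub>"
  using tcls_eq_zero_iff gens_FA generate.incl[of c gens FA] by (auto simp: Rel_gens)

lemma tensor_add_l:
  assumes "s \<in> carrier S" "t \<in> carrier S" "m \<in> carrier N"
  shows "tensor (s \<oplus>\<^bsub>S\<^esub> t) m = tensor s m \<oplus>\<^bsub>T\<^esub> tensor t m"
proof -
  have "frag_of (s \<oplus>\<^bsub>S\<^esub> t, m) - (frag_of (s, m) + frag_of (t, m)) \<in> gens"
    using assms unfolding gens_def by blast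
  from gens_tcls[OF this] show ?thesis
    using assms by (simp add: tensor_def tcls_diff tcls_add frag_of_FA FA_add tcls_closed T.diff_eq_zero_iff)
qed

lemma tensor_add_r:
  assumes "s \<in> carrier S" "m \<in> carrier N" "n \<in> carrier N"
  shows "tensor s (m \<oplus>\<^bsub>N\<^esub> n) = tensor s m \<oplus>\<^bsub>T\<^esub> tensor s n"
proof -
  have "frag_of (s, m \<oplus>\<^bsub>N\<^esub> n) - (frag_of (s, m) + frag_of (s, n)) \<in> gens"
    using assms unfolding gens_def by blast
  from gens_tcls[OF this] show ?thesis
    using assms by (simp add: tensor_def tcls_diff tcls_add frag_of_FA FA_add tcls_closed T.diff_eq_zero_iff)
qed

lemma tensor_balanced:
  assumes "s \<in> carrier S" "r \<in> carrier S'" "m \<in> carrier N"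
  shows "tensor (s \<otimes>\<^bsub>S\<^esub> f r) m = tensor s (r \<odot>\<^bsub>N\<^esub> m)"
proof -
  have "frag_of (s \<otimes>\<^bsub>S\<^esub> f r, m) - frag_of (s, r \<odot>\<^bsub>N\<^esub> m) \<in> gens"
    using assms unfolding gens_def by blast
  from gens_tcls[OF this] show ?thesis
    using assms by (simp add: tensor_def tcls_diff tcls_add frag_of_FA FA_add tcls_closed N.smult_closed T.diff_eq_zero_iff)
qed

text \<open>Inherited from the induction principle for free abelian groups, which is why the last
  case is about differences.\<close>

lemma tensor_induct [consumes 1, case_names tensor zero diff]:
  assumes x: "x \<in> carrier T"
    and tensor: "\<And>s m. \<lbrakk>s \<in> carrier S; m \<in> carrier N\<rbrakk> \<Longrightarrow> P (tensor s m)"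
    and zero: "P \<zero>\<^bsub>T\<^esub>"
    and diff: "\<And>x y. \<lbrakk>x \<in> carrier T; y \<in> carrier T; P x; P y\<rbrakk> \<Longrightarrow> P (x \<ominus>\<^bsub>T\<^esub> y)"
  shows "P x"
proof -
  obtain c where c: "x = tcls c" "Poly_Mapping.keys c \<subseteq> carrier S \<times> carrier N"
    using x by (auto simp: carrier_T carrier_FA)
  have "P (tcls c)"
  proof (rule free_Abelian_group_induct[OF c(2)])
    show "P (tcls 0)" by (simp add: tcls_zero zero)
    show "P (tcls (c - d))" if "Poly_Mapping.keys c \<subseteq> carrier S \<times> carrier N"
      "Poly_Mapping.keys d \<subseteq> carrier S \<times> carrier N" "P (tcls c)" "P (tcls d)" for c d
      using that diff by (simp add: tcls_diff tcls_closed carrier_FA)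
    show "P (tcls (frag_of a))" if "a \<in> carrier S \<times> carrier N" for a
      using that tensor by (auto simp: tensor_def)
  qed
  with c show ?thesis by simp
qed

lemma T_hom_diff:
  assumes "abelian_group A" "F \<in> hom (add_monoid T) (add_monoid A)" "x \<in> carrier T" "y \<in> carrier T"
  shows "F (x \<ominus>\<^bsub>T\<^esub> y) = F x \<ominus>\<^bsub>A\<^esub> F y"
proof -
  interpret A: abelian_group A by fact
  interpret F: abelian_group_hom T A F
    using assms by unfold_locales (auto simp: hom_def)
  show ?thesis using assms by (simp add: a_minus_def)
qed

text \<open>Pure tensors generate \<open>T\<close> as an abelian group. The algebraic laws of the
  operators on \<open>T\<close> are reduced to pure tensors in this way.\<close>

lemma tensor_ext:
  assumes "abelian_group A" "F \<in> hom (add_monoid T) (add_monoid A)" "F' \<in> hom (add_monoid T) (add_monoid A)"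
    and eq: "\<And>s m. \<lbrakk>s \<in> carrier S; m \<in> carrier N\<rbrakk> \<Longrightarrow> F (tensor s m) = F' (tensor s m)"
    and x: "x \<in> carrier T"
  shows "F x = F' x"
  using x
proof (induction rule: tensor_induct)
  case zero
  interpret A: abelian_group A by fact
  have "F \<zero>\<^bsub>T\<^esub> = \<zero>\<^bsub>A\<^esub>" "F' \<zero>\<^bsub>T\<^esub> = \<zero>\<^bsub>A\<^esub>"
    using hom_one[OF assms(2) T.add.is_group A.add.is_group] 
      hom_one[OF assms(3) T.add.is_group A.add.is_group] by simp_all
  then show ?case by simp
qed (simp_all add: eq T_hom_diff[OF assms(1,2)] T_hom_diff[OF assms(1,3)])

text \<open>The universal property of the tensor product. The kernel of \<open>F\<close> is a
  subgroup, so it contains all of \<open>Rel\<close> as soon as it contains the three kinds of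
  generators; then \<open>F\<close> is constant on cosets.\<close>

lemma on_cosets_tcls:
  assumes A: "abelian_group A" and F: "F \<in> hom FA (add_monoid A)"
    and "\<And>s t m. \<lbrakk>s \<in> carrier S; t \<in> carrier S; m \<in> carrier N\<rbrakk> \<Longrightarrow>
        F (frag_of (s \<oplus>\<^bsub>S\<^esub> t, m)) = F (frag_of (s, m)) \<oplus>\<^bsub>A\<^esub> F (frag_of (t, m))"
    and "\<And>s m n. \<lbrakk>s \<in> carrier S; m \<in> carrier N; n \<in> carrier N\<rbrakk> \<Longrightarrow>
        F (frag_of (s, m \<oplus>\<^bsub>N\<^esub> n)) = F (frag_of (s, m)) \<oplus>\<^bsub>A\<^esub> F (frag_of (s, n))"
    and "\<And>s r m. \<lbrakk>s \<in> carrier S; r \<in> carrier S'; m \<in> carrier N\<rbrakk> \<Longrightarrow>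
        F (frag_of (s \<otimes>\<^bsub>S\<^esub> f r, m)) = F (frag_of (s, r \<odot>\<^bsub>N\<^esub> m))"
  shows "c \<in> carrier FA \<Longrightarrow> on_cosets F (tcls c) = F c"
    and "on_cosets F \<in> hom (add_monoid T) (add_monoid A)"
proof -
  interpret A: abelian_group A by fact
  interpret F: group_hom FA "add_monoid A" F
    using F A.add.is_group FA.is_group by (simp add: group_hom_def group_hom_axioms_def)
  have cl [simp]: "\<lbrakk>s \<in> carrier S; m \<in> carrier N\<rbrakk> \<Longrightarrow> F (frag_of (s, m)) \<in> carrier A" for s m
    using F.hom_closed frag_of_FA by simp
  have Fadd: "\<lbrakk>x \<in> carrier FA; y \<in> carrier FA\<rbrakk> \<Longrightarrow> F (x + y) = F x \<oplus>\<^bsub>A\<^esub> F y" for x y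
    using F.hom_mult[of x y] by simp
  have Fcl: "x \<in> carrier FA \<Longrightarrow> F x \<in> carrier A" for x
    using F.hom_closed by simp
  have Fdiff: "\<lbrakk>x \<in> carrier FA; y \<in> carrier FA\<rbrakk> \<Longrightarrow> F (x - y) = F x \<ominus>\<^bsub>A\<^esub> F y" for x y
    using Fadd[of "x - y" y] Fcl by (simp add: FA_diff a_minus_def A.a_assoc A.r_neg)
  have "Rel \<subseteq> kernel FA (add_monoid A) F"
    unfolding Rel_gens
  proof (rule FA.generate_subgroup_incl[OF _ F.subgroup_kernel])
    show "gens \<subseteq> kernel FA (add_monoid A) F"
      using gens_FA assms(3-5)
      by (auto simp: kernel_def gens_def Fdiff Fadd frag_of_FA FA_add N.smult_closed a_minus_def A.r_neg subset_iff)
  qed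
  then have Rel0: "r \<in> Rel \<Longrightarrow> r \<in> carrier FA \<and> F r = \<zero>\<^bsub>A\<^esub>" for r
    by (auto simp: kernel_def)
  show *: "on_cosets F (tcls c) = F c" if c: "c \<in> carrier FA" for c
  proof (rule on_cosets_const)
    show "tcls c \<noteq> {}"
      using FA.rcos_self[OF c Rel_subgroup] by (auto simp: tcls_def)
    fix x assume "x \<in> tcls c"
    then obtain r where "r \<in> Rel" "x = r + c" by (auto simp: tcls_def r_coset_def)
    then show "F x = F c" using c Rel0 by (simp add: Fadd Fcl)
  qed
  show "on_cosets F \<in> hom (add_monoid T) (add_monoid A)"
  proof (rule homI)
    fix x assume "x \<in> carrier (add_monoid T)"
    then show "on_cosets F x \<in> carrier (add_monoid A)"
      using * Fcl by (auto simp: carrier_T)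
  next
    fix x y assume "x \<in> carrier (add_monoid T)" "y \<in> carrier (add_monoid T)"
    then obtain c d where "c \<in> carrier FA" "d \<in> carrier FA" "x = tcls c" "y = tcls d"
      by (auto simp: carrier_T)
    then show "on_cosets F (x \<otimes>\<^bsub>add_monoid T\<^esub> y) = on_cosets F x \<otimes>\<^bsub>add_monoid A\<^esub> on_cosets F y"
      using * by (simp add: tcls_add[symmetric] FA_add Fadd)
  qed
qed

text \<open>The conditions compare tensors and not pairs: as a map of pairs \<open>u\<close> need
  not be additive; what must be biadditive and balanced is its composite with
  \<open>tensor\<close>.\<close>

definition balanced_map :: "('s \<times> 'm \<Rightarrow> 's \<times> 'm) \<Rightarrow> bool"
  where "balanced_map u \<longleftrightarrow> u ` (carrier S \<times> carrier N) \<subseteq> carrier S \<times> carrier N \<and>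
    (\<forall>s\<in>carrier S. \<forall>t\<in>carrier S. \<forall>m\<in>carrier N.
      case_prod tensor (u (s \<oplus>\<^bsub>S\<^esub> t, m)) = case_prod tensor (u (s, m)) \<oplus>\<^bsub>T\<^esub> case_prod tensor (u (t, m))) \<and>
    (\<forall>s\<in>carrier S. \<forall>m\<in>carrier N. \<forall>n\<in>carrier N.
      case_prod tensor (u (s, m \<oplus>\<^bsub>N\<^esub> n)) = case_prod tensor (u (s, m)) \<oplus>\<^bsub>T\<^esub> case_prod tensor (u (s, n))) \<and>
    (\<forall>s\<in>carrier S. \<forall>r\<in>carrier S'. \<forall>m\<in>carrier N.
      case_prod tensor (u (s \<otimes>\<^bsub>S\<^esub> f r, m)) = case_prod tensor (u (s, r \<odot>\<^bsub>N\<^esub> m)))"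

lemma tensor_endo:
  assumes "balanced_map u"
  shows tensor_endo_hom: "tensor_endo S S' f N u \<in> hom (add_monoid T) (add_monoid T)"
    and tensor_endo_tensor: "\<lbrakk>s \<in> carrier S; m \<in> carrier N\<rbrakk> \<Longrightarrow>
      tensor_endo S S' f N u (tensor s m) = case_prod tensor (u (s, m))"
proof -
  define F where "F = (\<lambda>c. tcls (frag_extend (\<lambda>p. frag_of (u p)) c))"
  have E: "tensor_endo S S' f N u = on_cosets F"
    by (simp add: tensor_endo_def F_def tcls_def)
  have u: "u ` (carrier S \<times> carrier N) \<subseteq> carrier S \<times> carrier N"
    using assms by (simp add: balanced_map_def)
  have ext: "c \<in> carrier FA \<Longrightarrow> frag_extend (\<lambda>p. frag_of (u p)) c \<in> carrier FA" for c
    unfolding carrier_FA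
    by (rule order_trans[OF keys_frag_extend]) (use u in \<open>unfold keys_frag_of, blast\<close>)
  have F: "F \<in> hom FA (add_monoid T)"
    by (rule homI) (simp_all add: F_def ext tcls_closed frag_extend_add tcls_add)
  have Ff: "F (frag_of p) = case_prod tensor (u p)" for p
    by (simp add: F_def tensor_def split: prod.split)
  note on = on_cosets_tcls[OF T.abelian_group_axioms F, unfolded Ff]
  show "tensor_endo S S' f N u \<in> hom (add_monoid T) (add_monoid T)"
    unfolding E by (rule on(2)) (use assms in \<open>simp_all add: balanced_map_def\<close>)
  show "tensor_endo S S' f N u (tensor s m) = case_prod tensor (u (s, m))"
    if "s \<in> carrier S" "m \<in> carrier N"
    unfolding E tensor_def[of s m] Ff[symmetric]
    by (rule on(1)) (use assms that in \<open>simp_all add: balanced_map_def frag_of_FA\<close>)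
qed

lemma balanced_mult: "r \<in> carrier S \<Longrightarrow> balanced_map (\<lambda>(s, m). (r \<otimes>\<^bsub>S\<^esub> s, m))"
  by (auto simp: balanced_map_def tensor_add_l tensor_add_r tensor_balanced S.r_distr S.m_assoc[symmetric])

lemma smult_T: "r \<odot>\<^bsub>T\<^esub> x = tensor_endo S S' f N (\<lambda>(s, m). (r \<otimes>\<^bsub>S\<^esub> s, m)) x"
  by (simp add: base_change_def Let_def)

lemma smult_hom: "r \<in> carrier S \<Longrightarrow> (\<lambda>x. r \<odot>\<^bsub>T\<^esub> x) \<in> hom (add_monoid T) (add_monoid T)"
  unfolding smult_T by (rule tensor_endo_hom[OF balanced_mult])

lemma smult_tensor: "\<lbrakk>r \<in> carrier S; s \<in> carrier S; m \<in> carrier N\<rbrakk> \<Longrightarrow>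
    r \<odot>\<^bsub>T\<^esub> tensor s m = tensor (r \<otimes>\<^bsub>S\<^esub> s) m"
  unfolding smult_T by (simp add: tensor_endo_tensor[OF balanced_mult])

lemma hom_T_comp: "\<lbrakk>F \<in> hom (add_monoid T) (add_monoid T); F' \<in> hom (add_monoid T) A\<rbrakk> \<Longrightarrow>
    (\<lambda>x. F' (F x)) \<in> hom (add_monoid T) A"
  by (auto simp: hom_def Pi_iff)

lemma hom_T_add: "\<lbrakk>F \<in> hom (add_monoid T) (add_monoid T); F' \<in> hom (add_monoid T) (add_monoid T)\<rbrakk> \<Longrightarrow>
    (\<lambda>x. F x \<oplus>\<^bsub>T\<^esub> F' x) \<in> hom (add_monoid T) (add_monoid T)"
  by (rule homI) (auto simp: hom_def T.a_ac Pi_iff)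

lemma id_hom_T: "(\<lambda>x. x) \<in> hom (add_monoid T) (add_monoid T)"
  by (auto simp: hom_def)

sublocale T: left_module S T
proof (rule left_moduleI)
  note ext = tensor_ext[OF T.abelian_group_axioms]
  show "a \<odot>\<^bsub>T\<^esub> x \<in> carrier T" if "a \<in> carrier S" "x \<in> carrier T" for a x
    using smult_hom that by (auto simp: hom_def)
  show "a \<odot>\<^bsub>T\<^esub> (x \<oplus>\<^bsub>T\<^esub> y) = a \<odot>\<^bsub>T\<^esub> x \<oplus>\<^bsub>T\<^esub> a \<odot>\<^bsub>T\<^esub> y"
    if "a \<in> carrier S" "x \<in> carrier T" "y \<in> carrier T" for a x y
    using smult_hom that by (auto simp: hom_def)
  show "(a \<oplus>\<^bsub>S\<^esub> b) \<odot>\<^bsub>T\<^esub> x = a \<odot>\<^bsub>T\<^esub> x \<oplus>\<^bsub>T\<^esub> b \<odot>\<^bsub>T\<^esub> x"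
    if "a \<in> carrier S" "b \<in> carrier S" "x \<in> carrier T" for a b x
    by (rule ext[OF smult_hom hom_T_add[OF smult_hom smult_hom] _ that(3)])
      (use that in \<open>auto simp: smult_tensor S.l_distr tensor_add_l\<close>)
  show "(a \<otimes>\<^bsub>S\<^esub> b) \<odot>\<^bsub>T\<^esub> x = a \<odot>\<^bsub>T\<^esub> (b \<odot>\<^bsub>T\<^esub> x)"
    if "a \<in> carrier S" "b \<in> carrier S" "x \<in> carrier T" for a b x
    by (rule ext[OF smult_hom hom_T_comp[OF smult_hom smult_hom] _ that(3)])
      (use that in \<open>auto simp: smult_tensor S.m_assoc\<close>)
  show "\<one>\<^bsub>S\<^esub> \<odot>\<^bsub>T\<^esub> x = x" if "x \<in> carrier T" for x
    by (rule ext[OF smult_hom id_hom_T _ that]) (use that in \<open>auto simp: smult_tensor\<close>)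
qed (rule S.ring_axioms T.abelian_group_axioms)+

end

text \<open>The extension of \<open>b\<close> by additivity to formal integer combinations of
  elements of \<open>B\<close>. To add two combinations, both sums are first taken over the union of
  the key sets, where the extra coefficients are zero.\<close>

lemma (in abelian_group) frag_finsum_hom:
  fixes b :: "'c \<Rightarrow> 'a" and F :: "('c \<Rightarrow>\<^sub>0 int) \<Rightarrow> 'a"
  assumes b: "\<And>p. p \<in> B \<Longrightarrow> b p \<in> carrier G"
  defines "F \<equiv> \<lambda>c. \<Oplus>p\<in>Poly_Mapping.keys c. [Poly_Mapping.lookup c p] \<cdot> b p"
  shows "F \<in> hom (free_Abelian_group B) (add_monoid G)"
    and "p \<in> B \<Longrightarrow> F (frag_of p) = b p"
proof -
  have cl: "p \<in> B \<Longrightarrow> [(k::int)] \<cdot> b p \<in> carrier G" for k p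
    using b add.int_pow_closed by (simp add: add_pow_def)
  have pow_add: "[(i + j :: int)] \<cdot> b p = [i] \<cdot> b p \<oplus> [j] \<cdot> b p" if "p \<in> B" for i j p
    using b[OF that] unfolding add_pow_def using group.int_pow_mult[OF a_group, of "b p" i j] by simp
  have F: "F c = (\<Oplus>p\<in>A. [Poly_Mapping.lookup c p] \<cdot> b p)"
    if "finite A" "Poly_Mapping.keys c \<subseteq> A" "A \<subseteq> B" for c A
    unfolding F_def
    by (rule add.finprod_mono_neutral_cong_left)
      (use that cl in \<open>auto simp: in_keys_iff add_pow_def\<close>)
  show "F \<in> hom (free_Abelian_group B) (add_monoid G)"
  proof (rule homI)
    fix c assume "c \<in> carrier (free_Abelian_group B)"
    then show "F c \<in> carrier (add_monoid G)"
      using cl by (auto simp: F_def intro!: finsum_closed)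
  next
    fix c d assume c: "c \<in> carrier (free_Abelian_group B)" and d: "d \<in> carrier (free_Abelian_group B)"
    let ?A = "Poly_Mapping.keys c \<union> Poly_Mapping.keys d"
    have A: "finite ?A" "?A \<subseteq> B" using c d by auto
    have "F (c + d) = (\<Oplus>p\<in>?A. [Poly_Mapping.lookup (c + d) p] \<cdot> b p)"
      by (rule F) (use A keys_add[of c d] in auto)
    also have "\<dots> = (\<Oplus>p\<in>?A. [Poly_Mapping.lookup c p] \<cdot> b p \<oplus> [Poly_Mapping.lookup d p] \<cdot> b p)"
      by (rule finsum_cong') (use A b cl in \<open>auto simp: lookup_add pow_add subset_iff\<close>)
    also have "\<dots> = (\<Oplus>p\<in>?A. [Poly_Mapping.lookup c p] \<cdot> b p) \<oplus> (\<Oplus>p\<in>?A. [Poly_Mapping.lookup d p] \<cdot> b p)"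
      by (rule finsum_addf) (use A cl in auto)
    also have "\<dots> = F c \<oplus> F d"
      using A by (simp add: F[of ?A])
    finally show "F (c \<otimes>\<^bsub>free_Abelian_group B\<^esub> d) = F c \<otimes>\<^bsub>add_monoid G\<^esub> F d" by simp
  qed
  show "F (frag_of p) = b p" if "p \<in> B"
    using b[OF that] cl[OF that] group.int_pow_1[OF a_group, of "b p"]
    by (simp add: F_def keys_frag_of add_pow_def)
qed

context scalar_extension
begin

text \<open>The map (s, m) to s \<tau>(m) is balanced because \<open>\<tau>\<close> is
  \<open>S'\<close>-linear when \<open>M\<close> is viewed over \<open>S'\<close> through
  \<open>f\<close>.\<close>

lemma base_change_lift:
  assumes M: "left_module S M"
    and tau: "\<tau> \<in> lin_hom S' N (restrict_scalars f M)"
  shows base_change_lift_hom: "base_change_lift M \<tau> \<in> hom (add_monoid T) (add_monoid M)"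
    and base_change_lift_tensor: "\<lbrakk>s \<in> carrier S; m \<in> carrier N\<rbrakk> \<Longrightarrow>
      base_change_lift M \<tau> (tensor s m) = s \<odot>\<^bsub>M\<^esub> \<tau> m"
    and base_change_lift_smult: "\<lbrakk>s \<in> carrier S; x \<in> carrier T\<rbrakk> \<Longrightarrow>
      base_change_lift M \<tau> (s \<odot>\<^bsub>T\<^esub> x) = s \<odot>\<^bsub>M\<^esub> base_change_lift M \<tau> x"
proof -
  interpret M: left_module S M by fact
  note [simp] = lin_homD[OF tau, simplified]
  define F :: "('s \<times> 'm \<Rightarrow>\<^sub>0 int) \<Rightarrow> _" where "F = (\<lambda>c. \<Oplus>\<^bsub>M\<^esub>p\<in>Poly_Mapping.keys c.
      [Poly_Mapping.lookup c p] \<cdot>\<^bsub>M\<^esub> (fst p \<odot>\<^bsub>M\<^esub> \<tau> (snd p)))"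
  have E: "base_change_lift M \<tau> = on_cosets F"
    by (simp add: base_change_lift_def F_def)
  have b: "p \<in> carrier S \<times> carrier N \<Longrightarrow> fst p \<odot>\<^bsub>M\<^esub> \<tau> (snd p) \<in> carrier M" for p
    by (auto intro: M.smult_closed)
  have F: "F \<in> hom FA (add_monoid M)"
    unfolding F_def tensor_free_def using M.frag_finsum_hom(1)[where b="\<lambda>p. fst p \<odot>\<^bsub>M\<^esub> \<tau> (snd p)", OF b] .
  have Ff: "\<lbrakk>s \<in> carrier S; m \<in> carrier N\<rbrakk> \<Longrightarrow> F (frag_of (s, m)) = s \<odot>\<^bsub>M\<^esub> \<tau> m" for s m
    unfolding F_def
    using M.frag_finsum_hom(2)[where b="\<lambda>p. fst p \<odot>\<^bsub>M\<^esub> \<tau> (snd p)" and p="(s, m)", OF b] by auto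
  note on = on_cosets_tcls[OF M.M.abelian_group_axioms F]
  show hom: "base_change_lift M \<tau> \<in> hom (add_monoid T) (add_monoid M)"
    unfolding E
    by (rule on(2)) (simp_all add: Ff M.smult_l_distr M.smult_r_distr M.smult_assoc1 N.smult_closed)
  show ten: "base_change_lift M \<tau> (tensor s m) = s \<odot>\<^bsub>M\<^esub> \<tau> m"
    if "s \<in> carrier S" "m \<in> carrier N" for s m
    unfolding E tensor_def[of s m] using that
    by (subst on(1)) (simp_all add: Ff M.smult_l_distr M.smult_r_distr M.smult_assoc1 N.smult_closed frag_of_FA)
  show "base_change_lift M \<tau> (s \<odot>\<^bsub>T\<^esub> x) = s \<odot>\<^bsub>M\<^esub> base_change_lift M \<tau> x"
    if "s \<in> carrier S" "x \<in> carrier T"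
  proof (rule tensor_ext[OF M.M.abelian_group_axioms hom_T_comp[OF smult_hom hom] _ _ that(2)])
    show "(\<lambda>x. s \<odot>\<^bsub>M\<^esub> base_change_lift M \<tau> x) \<in> hom (add_monoid T) (add_monoid M)"
      using hom that by (auto simp: hom_def M.smult_closed M.smult_r_distr Pi_iff)
  qed (use that in \<open>simp_all add: smult_tensor ten M.smult_assoc1\<close>)
qed

end


section \<open>Simple modules\<close>

definition module_iso :: "('r, 'p) ring_scheme \<Rightarrow> ('r, 'a) module \<Rightarrow> ('r, 'b) module \<Rightarrow> bool"
  where "module_iso R V W \<longleftrightarrow> (\<exists>\<phi>\<in>lin_hom R V W. bij_betw \<phi> (carrier V) (carrier W))"

lemma lin_hom_comp:
  "\<lbrakk>\<phi> \<in> lin_hom R U V; \<psi> \<in> lin_hom R V W\<rbrakk> \<Longrightarrow> (\<lambda>x. \<psi> (\<phi> x)) \<in> lin_hom R U W"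
  by (rule lin_homI) (simp_all add: lin_homD)

lemma module_iso_refl: "module_iso R V V"
  unfolding module_iso_def
  by (rule bexI[of _ "\<lambda>x. x"]) (auto intro: lin_homI simp: bij_betw_def)

lemma module_iso_trans:
  assumes "module_iso R U V" "module_iso R V W"
  shows "module_iso R U W"
proof -
  obtain \<phi> \<psi> where *: "\<phi> \<in> lin_hom R U V" "bij_betw \<phi> (carrier U) (carrier V)"
    "\<psi> \<in> lin_hom R V W" "bij_betw \<psi> (carrier V) (carrier W)"
    using assms by (auto simp: module_iso_def)
  then have "bij_betw (\<lambda>x. \<psi> (\<phi> x)) (carrier U) (carrier W)"
    using bij_betw_trans[OF *(2,4)] by (simp add: comp_def)
  with * show ?thesis unfolding module_iso_def by (blast intro: lin_hom_comp)
qed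

lemma lin_hom_inv:
  assumes V: "left_module R V" and \<phi>: "\<phi> \<in> lin_hom R V W" and bij: "bij_betw \<phi> (carrier V) (carrier W)"
  shows "inv_into (carrier V) \<phi> \<in> lin_hom R W V"
proof (rule lin_homI)
  interpret V: left_module R V by fact
  let ?i = "inv_into (carrier V) \<phi>"
  have W: "carrier W = \<phi> ` carrier V" and inj: "inj_on \<phi> (carrier V)"
    using bij by (auto simp: bij_betw_def)
  note [simp] = lin_homD(2,3)[OF \<phi>, symmetric] inv_into_f_f[OF inj] V.smult_closed
  show "?i x \<in> carrier V" if "x \<in> carrier W" for x
    using that W by auto
  show "?i (x \<oplus>\<^bsub>W\<^esub> y) = ?i x \<oplus>\<^bsub>V\<^esub> ?i y" if "x \<in> carrier W" "y \<in> carrier W" for x y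
    using that W by auto
  show "?i (a \<odot>\<^bsub>W\<^esub> x) = a \<odot>\<^bsub>V\<^esub> ?i x" if "a \<in> carrier R" "x \<in> carrier W" for a x
    using that W by auto
qed

lemma module_iso_sym: "\<lbrakk>left_module R V; module_iso R V W\<rbrakk> \<Longrightarrow> module_iso R W V"
  unfolding module_iso_def by (meson lin_hom_inv bij_betw_inv_into)

lemma simple_moduleD:
  assumes "simple_module R V"
  shows "left_module R V" and "carrier V \<noteq> {\<zero>\<^bsub>V\<^esub>}"
    and "submodule N R V \<Longrightarrow> N = {\<zero>\<^bsub>V\<^esub>} \<or> N = carrier V"
  using assms by (auto simp: simple_module_def)

lemma simple_module_nonzero:
  assumes "simple_module R V"
  obtains v where "v \<in> carrier V" "v \<noteq> \<zero>\<^bsub>V\<^esub>"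
proof -
  interpret V: left_module R V using simple_moduleD(1)[OF assms] .
  show ?thesis using simple_moduleD(2)[OF assms] V.M.zero_closed that by blast
qed

lemma left_module_transport:
  assumes "left_module R V" and onto: "carrier W = \<phi> ` carrier V"
    and zero: "\<zero>\<^bsub>W\<^esub> = \<phi> \<zero>\<^bsub>V\<^esub>"
    and add: "\<And>x y. \<lbrakk>x \<in> carrier V; y \<in> carrier V\<rbrakk> \<Longrightarrow> \<phi> x \<oplus>\<^bsub>W\<^esub> \<phi> y = \<phi> (x \<oplus>\<^bsub>V\<^esub> y)"
    and smult: "\<And>a x. \<lbrakk>a \<in> carrier R; x \<in> carrier V\<rbrakk> \<Longrightarrow> a \<odot>\<^bsub>W\<^esub> \<phi> x = \<phi> (a \<odot>\<^bsub>V\<^esub> x)"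
  shows "left_module R W"
proof -
  interpret V: left_module R V by fact
  show ?thesis
  proof (rule left_moduleI)
    show "abelian_group W"
    proof (rule abelian_groupI)
      fix x assume "x \<in> carrier W"
      then obtain v where v: "v \<in> carrier V" "x = \<phi> v" using onto by auto
      then have "\<phi> (\<ominus>\<^bsub>V\<^esub> v) \<oplus>\<^bsub>W\<^esub> x = \<zero>\<^bsub>W\<^esub>" by (simp add: add zero V.M.l_neg)
      with v show "\<exists>y\<in>carrier W. y \<oplus>\<^bsub>W\<^esub> x = \<zero>\<^bsub>W\<^esub>" using onto by blast
    qed (auto simp: onto zero add V.M.a_assoc intro!: arg_cong[of _ _ \<phi>] intro: V.M.a_comm)
  qed (auto simp: onto add smult V.R.ring_axioms V.smult_closed V.smult_l_distr
      V.smult_r_distr V.smult_assoc1 V.smult_one)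
qed

text \<open>Only formulas for the operations of \<open>W\<close> on values of \<open>\<phi>\<close>
  are assumed, so \<open>W\<close> may be a record assembled for the purpose: a copy on cosets, or a
  twist.\<close>

lemma simple_module_transport:
  assumes V: "simple_module R V" and bij: "bij_betw \<phi> (carrier V) (carrier W)"
    and zero: "\<zero>\<^bsub>W\<^esub> = \<phi> \<zero>\<^bsub>V\<^esub>"
    and add: "\<And>x y. \<lbrakk>x \<in> carrier V; y \<in> carrier V\<rbrakk> \<Longrightarrow> \<phi> x \<oplus>\<^bsub>W\<^esub> \<phi> y = \<phi> (x \<oplus>\<^bsub>V\<^esub> y)"
    and smult: "\<And>a x. \<lbrakk>a \<in> carrier R; x \<in> carrier V\<rbrakk> \<Longrightarrow> a \<odot>\<^bsub>W\<^esub> \<phi> x = \<phi> (a \<odot>\<^bsub>V\<^esub> x)"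
  shows "simple_module R W" and "module_iso R V W"
proof -
  interpret V: left_module R V using simple_moduleD(1)[OF V] .
  have onto: "carrier W = \<phi> ` carrier V" and inj: "inj_on \<phi> (carrier V)"
    using bij by (auto simp: bij_betw_def)
  interpret W: left_module R W
    by (rule left_module_transport[OF V.left_module_axioms onto zero add smult])
  obtain v where v: "v \<in> carrier V" "v \<noteq> \<zero>\<^bsub>V\<^esub>" using simple_module_nonzero[OF V] .
  have "\<phi> v \<noteq> \<zero>\<^bsub>W\<^esub>" using v inj by (auto simp: zero inj_on_def)
  with v have "carrier W \<noteq> {\<zero>\<^bsub>W\<^esub>}" using onto by blast
  moreover have "N = {\<zero>\<^bsub>W\<^esub>} \<or> N = carrier W" if N: "submodule N R W" for N
  proof -
    let ?P = "{x \<in> carrier V. \<phi> x \<in> N}"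
    have "submodule ?P R V"
      by (rule V.submodule_leftI)
        (use W.submodule_zero[OF N] W.submodule_add[OF N] W.submodule_smult[OF N]
         in \<open>auto simp: V.smult_closed add[symmetric] smult[symmetric] zero\<close>)
    then have "?P = {\<zero>\<^bsub>V\<^esub>} \<or> ?P = carrier V" using simple_moduleD(3)[OF V] by blast
    moreover have "N = \<phi> ` ?P" using W.submodule_subset[OF N] onto by auto
    ultimately show ?thesis using onto zero by auto
  qed
  ultimately show "simple_module R W"
    using W.left_module_axioms by (auto simp: simple_module_def)
  show "module_iso R V W"
    unfolding module_iso_def using bij onto
    by (intro bexI[of _ \<phi>]) (auto intro!: lin_homI simp: add smult)
qed

lemma lin_hom_zero:
  assumes "left_module R V" "left_module R W" "\<phi> \<in> lin_hom R V W"
  shows "\<phi> \<zero>\<^bsub>V\<^esub> = \<zero>\<^bsub>W\<^esub>"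
proof -
  interpret V: left_module R V by fact
  interpret W: left_module R W by fact
  show ?thesis
    using lin_homD(2)[OF assms(3), of "\<zero>\<^bsub>V\<^esub>" "\<zero>\<^bsub>V\<^esub>"] lin_homD(1)[OF assms(3), of "\<zero>\<^bsub>V\<^esub>"]
    by (intro W.M.idem_zero) auto
qed

lemma (in abelian_group) add_eq_diffI:
  "\<lbrakk>x \<oplus> y = z; x \<in> carrier G; y \<in> carrier G\<rbrakk> \<Longrightarrow> x = z \<ominus> y"
  by (auto simp: a_minus_def a_assoc r_neg)

lemma lin_hom_diff:
  assumes "left_module R V" "left_module R W" "\<phi> \<in> lin_hom R V W" "x \<in> carrier V" "y \<in> carrier V"
  shows "\<phi> (x \<ominus>\<^bsub>V\<^esub> y) = \<phi> x \<ominus>\<^bsub>W\<^esub> \<phi> y"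
proof -
  interpret V: left_module R V by fact
  interpret W: left_module R W by fact
  have "\<phi> (x \<ominus>\<^bsub>V\<^esub> y) \<oplus>\<^bsub>W\<^esub> \<phi> y = \<phi> x"
    using assms(4,5) lin_homD(2)[OF assms(3), of "x \<ominus>\<^bsub>V\<^esub> y" y]
    by (simp add: a_minus_def V.M.a_assoc V.M.l_neg)
  then show ?thesis
    by (rule W.M.add_eq_diffI) (use assms(4,5) lin_homD(1)[OF assms(3)] in auto)
qed

lemma submodule_vimage:
  assumes "left_module R V" "left_module R W" "\<phi> \<in> lin_hom R V W" "submodule N R W"
  shows "submodule {x \<in> carrier V. \<phi> x \<in> N} R V"
proof -
  interpret V: left_module R V by fact
  interpret W: left_module R W by fact
  show ?thesis
    by (rule V.submodule_leftI)
      (use W.submodule_zero[OF assms(4)] W.submodule_add[OF assms(4)] W.submodule_smult[OF assms(4)]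
       lin_homD[OF assms(3)] lin_hom_zero[OF assms(1-3)] V.smult_closed in auto)
qed

lemma submodule_image:
  assumes "left_module R V" "left_module R W" "\<phi> \<in> lin_hom R V W"
  shows "submodule (\<phi> ` carrier V) R W"
proof -
  interpret V: left_module R V by fact
  interpret W: left_module R W by fact
  have "\<zero>\<^bsub>W\<^esub> \<in> \<phi> ` carrier V"
    by (rule image_eqI[where x="\<zero>\<^bsub>V\<^esub>"]) (simp_all add: lin_hom_zero[OF assms])
  then show ?thesis
    by (intro W.submodule_leftI)
      (auto simp: lin_homD(1)[OF assms(3)] lin_homD(2,3)[OF assms(3), symmetric] V.smult_closed)
qed

lemma (in left_module) submodule_singleton_zero: "submodule {\<zero>\<^bsub>M\<^esub>} R M"
  by (rule submodule_leftI) auto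

text \<open>A submodule of a simple module is zero or everything; apply this to the kernel in
  \<open>V\<close> and to the image in \<open>W\<close>.\<close>

lemma Schur:
  assumes V: "simple_module R V" and W: "simple_module R W" and \<phi>: "\<phi> \<in> lin_hom R V W"
    and v: "v \<in> carrier V" "\<phi> v \<noteq> \<zero>\<^bsub>W\<^esub>"
  shows "module_iso R V W"
proof -
  interpret V: left_module R V using simple_moduleD(1)[OF V] .
  interpret W: left_module R W using simple_moduleD(1)[OF W] .
  note ax = V.left_module_axioms W.left_module_axioms
  have "{x \<in> carrier V. \<phi> x \<in> {\<zero>\<^bsub>W\<^esub>}} = {\<zero>\<^bsub>V\<^esub>}"
    using simple_moduleD(3)[OF V submodule_vimage[OF ax \<phi> W.submodule_singleton_zero]] v by auto
  then have ker: "\<lbrakk>x \<in> carrier V; \<phi> x = \<zero>\<^bsub>W\<^esub>\<rbrakk> \<Longrightarrow> x = \<zero>\<^bsub>V\<^esub>" for x by auto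
  have "inj_on \<phi> (carrier V)"
  proof (rule inj_onI)
    fix x y assume "x \<in> carrier V" "y \<in> carrier V" "\<phi> x = \<phi> y"
    then show "x = y"
      using ker[of "x \<ominus>\<^bsub>V\<^esub> y"] lin_homD(1)[OF \<phi>]
      by (simp add: lin_hom_diff[OF ax \<phi>] V.M.diff_eq_zero_iff W.M.diff_eq_zero_iff)
  qed
  moreover have "\<phi> ` carrier V = carrier W"
    using simple_moduleD(3)[OF W submodule_image[OF ax \<phi>]] v by auto
  ultimately show ?thesis
    using \<phi> unfolding module_iso_def bij_betw_def by blast
qed

section \<open>Two commuting module structures and a lower bound for the length\<close>

locale commuting_modules = K: left_module R K + KS: left_module S KS
  for R :: "('r, 'p) ring_scheme" and K :: "('r, 'x) module" (structure)
    and S :: "('s, 'q) ring_scheme" and KS :: "('s, 'x) module" +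
  assumes KS: "carrier KS = carrier K" "add KS = add K" "\<zero>\<^bsub>KS\<^esub> = \<zero>"
    and commute: "\<lbrakk>s \<in> carrier S; a \<in> carrier R; x \<in> carrier K\<rbrakk> \<Longrightarrow>
      s \<odot>\<^bsub>KS\<^esub> (a \<odot> x) = a \<odot> (s \<odot>\<^bsub>KS\<^esub> x)"
begin

text \<open>Finite sums of images are encoded by lists, so that statements about them can be proved
  by removing one summand at a time.\<close>

fun sum_of_images :: "(('r, 'v) module \<times> ('v \<Rightarrow> 'x)) list \<Rightarrow> 'x set"
  where "sum_of_images [] = {\<zero>}"
  | "sum_of_images ((W, \<psi>) # l) = {\<psi> w \<oplus> d | w d. w \<in> carrier W \<and> d \<in> sum_of_images l}"

definition hom_list :: "('r, 'v) module set \<Rightarrow> (('r, 'v) module \<times> ('v \<Rightarrow> 'x)) list \<Rightarrow> bool"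
  where "hom_list \<W> l \<longleftrightarrow> (\<forall>(W, \<psi>) \<in> set l. W \<in> \<W> \<and> \<psi> \<in> lin_hom R W K)"

text \<open>The sum of the images of all homomorphisms from members of \<open>\<W>\<close>. A single
  image need not be stable under \<open>S\<close>; the totality is, since a homomorphism followed by
  multiplication by \<open>s\<close> is again a homomorphism from the same module.\<close>

definition isotypic_sum :: "('r, 'v) module set \<Rightarrow> 'x set"
  where "isotypic_sum \<W> = (\<Union>l\<in>Collect (hom_list \<W>). sum_of_images l)"

lemma submodule_sum_of_images:
  assumes "\<And>W. W \<in> \<W> \<Longrightarrow> left_module R W" "hom_list \<W> l"
  shows "submodule (sum_of_images l) R K"
  using assms(2)
proof (induction l)
  case Nil
  show ?case using K.submodule_singleton_zero by simp
next
  case (Cons p l)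
  obtain W \<psi> where p: "p = (W, \<psi>)" by fastforce
  with Cons have \<psi>: "\<psi> \<in> lin_hom R W K" and W: "left_module R W" and l: "submodule (sum_of_images l) R K"
    using assms(1) by (auto simp: hom_list_def)
  interpret W: left_module R W by fact
  note [simp] = lin_homD(1)[OF \<psi>] K.submodule_subset[OF l, THEN subsetD]
  show ?case
    unfolding p
  proof (rule K.submodule_leftI)
    show "sum_of_images ((W, \<psi>) # l) \<subseteq> carrier K" by auto
    have "\<zero> = \<psi> \<zero>\<^bsub>W\<^esub> \<oplus> \<zero>"
      by (simp add: lin_hom_zero[OF W K.left_module_axioms \<psi>])
    then show "\<zero> \<in> sum_of_images ((W, \<psi>) # l)"
      using K.submodule_zero[OF l] W.M.zero_closed unfolding sum_of_images.simps by blast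
  next
    fix x y assume "x \<in> sum_of_images ((W, \<psi>) # l)" "y \<in> sum_of_images ((W, \<psi>) # l)"
    then obtain v d w e where xy: "v \<in> carrier W" "d \<in> sum_of_images l" "x = \<psi> v \<oplus> d"
      "w \<in> carrier W" "e \<in> sum_of_images l" "y = \<psi> w \<oplus> e" by auto
    then have "x \<oplus> y = \<psi> (v \<oplus>\<^bsub>W\<^esub> w) \<oplus> (d \<oplus> e)"
      by (simp add: lin_homD(2)[OF \<psi>] K.M.a_ac)
    with xy K.submodule_add[OF l] show "x \<oplus> y \<in> sum_of_images ((W, \<psi>) # l)"
      by auto
  next
    fix a x assume a: "a \<in> carrier R" and "x \<in> sum_of_images ((W, \<psi>) # l)"
    then obtain v d where x: "v \<in> carrier W" "d \<in> sum_of_images l" "x = \<psi> v \<oplus> d" by auto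
    then have "a \<odot> x = \<psi> (a \<odot>\<^bsub>W\<^esub> v) \<oplus> a \<odot> d"
      using a by (simp add: lin_homD(3)[OF \<psi>] K.smult_r_distr)
    with a x K.submodule_smult[OF l] show "a \<odot> x \<in> sum_of_images ((W, \<psi>) # l)"
      by (auto intro: W.smult_closed)
  qed
qed

lemma sum_of_images_subset:
  assumes "hom_list \<W> l"
  shows "sum_of_images l \<subseteq> carrier K"
  using assms
proof (induction l)
  case (Cons p l)
  obtain W \<psi> where p: "p = (W, \<psi>)" by fastforce
  with Cons.prems have "\<psi> \<in> lin_hom R W K" by (auto simp: hom_list_def)
  from lin_homD(1)[OF this] show ?case using Cons p by (auto simp: hom_list_def subset_iff)
qed simp

lemma hom_list_append: "hom_list \<W> (l @ l') \<longleftrightarrow> hom_list \<W> l \<and> hom_list \<W> l'"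
  by (auto simp: hom_list_def)

lemma sum_of_images_append:
  assumes "hom_list \<W> l" "hom_list \<W> l'" "x \<in> sum_of_images l" "y \<in> sum_of_images l'"
  shows "x \<oplus> y \<in> sum_of_images (l @ l')"
  using assms(1,3)
proof (induction l arbitrary: x)
  case Nil
  then show ?case using sum_of_images_subset[OF assms(2)] assms(4) by auto
next
  case (Cons p l)
  obtain W \<psi> where p: "p = (W, \<psi>)" by fastforce
  with Cons.prems obtain w d where x: "w \<in> carrier W" "d \<in> sum_of_images l" "x = \<psi> w \<oplus> d" by auto
  have l: "hom_list \<W> l" and \<psi>: "\<psi> \<in> lin_hom R W K" using Cons.prems p by (auto simp: hom_list_def)
  have "d \<oplus> y \<in> sum_of_images (l @ l')" using Cons.IH l x by blast
  moreover have "x \<oplus> y = \<psi> w \<oplus> (d \<oplus> y)"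
    using x lin_homD(1)[OF \<psi>] sum_of_images_subset[OF l] sum_of_images_subset[OF assms(2)] assms(4)
    by (simp add: K.M.a_assoc subset_iff)
  ultimately show ?case using p x by auto
qed

lemma sum_of_images_smult:
  assumes s: "s \<in> carrier S" and "hom_list \<W> l" and "x \<in> sum_of_images l"
  shows "\<exists>l'. hom_list \<W> l' \<and> s \<odot>\<^bsub>KS\<^esub> x \<in> sum_of_images l'"
  using assms(2,3)
proof (induction l arbitrary: x)
  case Nil
  then show ?case using s KS.smult_zero_r[OF s] by (intro exI[of _ "[]"]) (auto simp: KS hom_list_def)
next
  case (Cons p l)
  obtain W \<psi> where p: "p = (W, \<psi>)" by fastforce
  with Cons.prems obtain w d where x: "w \<in> carrier W" "d \<in> sum_of_images l" "x = \<psi> w \<oplus> d" by auto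
  have l: "hom_list \<W> l" and \<psi>: "\<psi> \<in> lin_hom R W K" and W: "W \<in> \<W>"
    using Cons.prems p by (auto simp: hom_list_def)
  obtain l' where l': "hom_list \<W> l'" "s \<odot>\<^bsub>KS\<^esub> d \<in> sum_of_images l'" using Cons.IH[OF l x(2)] by blast
  have "(\<lambda>w. s \<odot>\<^bsub>KS\<^esub> \<psi> w) \<in> lin_hom R W K"
    using lin_homD[OF \<psi>] s KS.smult_closed KS.smult_r_distr
    by (intro lin_homI) (auto simp: KS commute)
  with l' W have "hom_list \<W> ((W, \<lambda>w. s \<odot>\<^bsub>KS\<^esub> \<psi> w) # l')" by (simp add: hom_list_def)
  moreover have "s \<odot>\<^bsub>KS\<^esub> x = s \<odot>\<^bsub>KS\<^esub> \<psi> w \<oplus> s \<odot>\<^bsub>KS\<^esub> d"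
    using x lin_homD(1)[OF \<psi>] sum_of_images_subset[OF l] s KS.smult_r_distr by (auto simp: KS)
  moreover have "s \<odot>\<^bsub>KS\<^esub> \<psi> w \<oplus> s \<odot>\<^bsub>KS\<^esub> d \<in> sum_of_images ((W, \<lambda>w. s \<odot>\<^bsub>KS\<^esub> \<psi> w) # l')"
    using l' x(1) by auto
  ultimately show ?case by metis
qed

lemma submodule_isotypic_sum: "submodule (isotypic_sum \<W>) S KS"
proof (rule KS.submodule_leftI)
  show "isotypic_sum \<W> \<subseteq> carrier KS"
    using sum_of_images_subset by (auto simp: isotypic_sum_def KS)
  have "\<zero>\<^bsub>KS\<^esub> \<in> sum_of_images []" by (simp add: KS)
  moreover have "hom_list \<W> []" by (simp add: hom_list_def)
  ultimately show "\<zero>\<^bsub>KS\<^esub> \<in> isotypic_sum \<W>" unfolding isotypic_sum_def by blast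
next
  fix x y assume "x \<in> isotypic_sum \<W>" "y \<in> isotypic_sum \<W>"
  then obtain l l' where l: "hom_list \<W> l" "x \<in> sum_of_images l" "hom_list \<W> l'" "y \<in> sum_of_images l'"
    by (auto simp: isotypic_sum_def)
  have "x \<oplus> y \<in> sum_of_images (l @ l')"
    by (rule sum_of_images_append[OF l(1,3,2,4)])
  with l(1,3) show "x \<oplus>\<^bsub>KS\<^esub> y \<in> isotypic_sum \<W>"
    unfolding isotypic_sum_def by (intro UN_I[of "l @ l'"]) (auto simp: hom_list_append KS)
next
  fix s x assume "s \<in> carrier S" "x \<in> isotypic_sum \<W>"
  then show "s \<odot>\<^bsub>KS\<^esub> x \<in> isotypic_sum \<W>"
    using sum_of_images_smult[of s \<W>] by (force simp: isotypic_sum_def)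
qed

lemma image_in_isotypic_sum:
  assumes "W \<in> \<W>" "\<psi> \<in> lin_hom R W K" "w \<in> carrier W"
  shows "\<psi> w \<in> isotypic_sum \<W>"
proof -
  have "\<psi> w \<in> sum_of_images [(W, \<psi>)]"
    using assms lin_homD(1)[OF assms(2,3)] by force
  then show ?thesis using assms unfolding isotypic_sum_def
    by (intro UN_I[of "[(W, \<psi>)]"]) (auto simp: hom_list_def)
qed

lemma isotypic_sum_mono: "\<V> \<subseteq> \<W> \<Longrightarrow> isotypic_sum \<V> \<subseteq> isotypic_sum \<W>"
  unfolding isotypic_sum_def hom_list_def by blast

text \<open>Let \<open>?D\<close> be the sum of the images without the first one. If
  \<open>\<phi> v\<close> is outside \<open>?D\<close>, then modulo \<open>?D\<close> the image of
  \<open>\<psi>\<close> is a copy of the simple module \<open>W\<close>, and \<open>\<phi>\<close>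
  becomes a non-zero map into this copy, so Schur's lemma applies. Quotient modules are avoided by
  choosing elements of \<open>W\<close>.\<close>

lemma simple_submodule_of_sum:
  assumes \<W>: "\<And>W. W \<in> \<W> \<Longrightarrow> simple_module R W" and V: "simple_module R V"
    and \<phi>: "\<phi> \<in> lin_hom R V K" and v: "v \<in> carrier V" "\<phi> v \<noteq> \<zero>"
    and "hom_list \<W> l" "\<phi> v \<in> sum_of_images l"
  shows "\<exists>W\<in>\<W>. module_iso R V W"
  using assms(6,7)
proof (induction l)
  case Nil
  with v show ?case by simp
next
  case (Cons p l)
  obtain W \<psi> where p: "p = (W, \<psi>)" by fastforce
  have l: "hom_list \<W> l" and \<psi>: "\<psi> \<in> lin_hom R W K" and W: "W \<in> \<W>"
    using Cons.prems p by (auto simp: hom_list_def)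
  interpret V: left_module R V using simple_moduleD(1)[OF V] .
  interpret W: left_module R W using simple_moduleD(1)[OF \<W>[OF W]] .
  let ?D = "sum_of_images l"
  have D: "submodule ?D R K" and pl: "submodule (sum_of_images (p # l)) R K"
    using submodule_sum_of_images[OF simple_moduleD(1)[OF \<W>]] l Cons.prems by blast+
  note Dadd = K.submodule_add[OF D] and Dsub = K.submodule_subset[OF D, THEN subsetD]
    and Dminus = K.submodule_minus[OF D]
  have Ddiff: "\<lbrakk>x \<in> ?D; y \<in> ?D\<rbrakk> \<Longrightarrow> x \<ominus> y \<in> ?D" for x y
    by (simp add: a_minus_def Dadd Dminus)
  note pre = submodule_vimage[OF _ K.left_module_axioms]
  note [simp] = lin_homD(1)[OF \<phi>] lin_homD(1)[OF \<psi>]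
  show ?case
  proof (cases "\<phi> v \<in> ?D")
    case True
    then show ?thesis using Cons.IH l by blast
  next
    case False
    then have kerV: "{x \<in> carrier V. \<phi> x \<in> ?D} = {\<zero>\<^bsub>V\<^esub>}"
      using simple_moduleD(3)[OF V pre[OF V.left_module_axioms \<phi> D]] v by auto
    have "v \<noteq> \<zero>\<^bsub>V\<^esub>"
      using v lin_hom_zero[OF V.left_module_axioms K.left_module_axioms \<phi>] by auto
    \<comment> \<open>The non-zero vector \<open>v\<close> lies in this preimage, so simplicity of
      \<open>V\<close> makes it everything: all of \<open>V\<close> is mapped into the image of
      \<open>\<psi>\<close> plus \<open>?D\<close>.\<close>
    then have all: "{x \<in> carrier V. \<phi> x \<in> sum_of_images (p # l)} = carrier V"
      using simple_moduleD(3)[OF V pre[OF V.left_module_axioms \<phi> pl]] v Cons.prems by auto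
    have ex: "\<exists>w d. w \<in> carrier W \<and> d \<in> ?D \<and> \<phi> x = \<psi> w \<oplus> d" if "x \<in> carrier V" for x
    proof -
      have "\<phi> x \<in> sum_of_images (p # l)" using that all by blast
      then show ?thesis unfolding p by auto
    qed
    \<comment> \<open>If \<open>\<psi>\<close> mapped all of \<open>W\<close> into
      \<open>?D\<close>, then \<open>\<phi> v\<close> would lie there as well.\<close>
    have "{x \<in> carrier W. \<psi> x \<in> ?D} \<noteq> carrier W"
    proof
      assume all: "{x \<in> carrier W. \<psi> x \<in> ?D} = carrier W"
      obtain w d where w: "w \<in> carrier W" "d \<in> ?D" "\<phi> v = \<psi> w \<oplus> d" using ex[OF v(1)] by blast
      then have "\<psi> w \<in> ?D" using all by blast
      with w Dadd False show False by simp
    qed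
    then have kerW: "{x \<in> carrier W. \<psi> x \<in> ?D} = {\<zero>\<^bsub>W\<^esub>}"
      using simple_moduleD(3)[OF \<W>[OF W] pre[OF W.left_module_axioms \<psi> D]] by auto
    have ex1: "\<exists>w. w \<in> carrier W \<and> \<phi> x \<ominus> \<psi> w \<in> ?D" if x: "x \<in> carrier V" for x
    proof -
      obtain w d where "w \<in> carrier W" "d \<in> ?D" "\<phi> x = \<psi> w \<oplus> d" using ex[OF x] by blast
      moreover from this have "\<phi> x \<ominus> \<psi> w = d"
        using Dsub[of d] by (simp add: a_minus_def K.M.a_ac K.M.r_neg K.M.a_comm[of "\<psi> w" d] K.M.a_assoc)
      ultimately show ?thesis by auto
    qed
    \<comment> \<open>By \<open>kerW\<close> the map \<open>\<psi>\<close> is injective modulo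
      \<open>?D\<close>.\<close>
    have uniq: "w = w'" if "w \<in> carrier W" "w' \<in> carrier W" "x \<in> carrier K"
      "x \<ominus> \<psi> w \<in> ?D" "x \<ominus> \<psi> w' \<in> ?D" for w w' x
    proof -
      have "(x \<ominus> \<psi> w') \<ominus> (x \<ominus> \<psi> w) = \<psi> w \<ominus> \<psi> w'"
        using that by (simp add: a_minus_def K.M.minus_add K.M.a_ac K.M.r_neg2)
      then have "\<psi> (w \<ominus>\<^bsub>W\<^esub> w') \<in> ?D"
        using Ddiff[OF that(5,4)] that lin_hom_diff[OF W.left_module_axioms K.left_module_axioms \<psi>] by simp
      then have "w \<ominus>\<^bsub>W\<^esub> w' \<in> {x \<in> carrier W. \<psi> x \<in> ?D}" using that by simp
      then show ?thesis using that unfolding kerW by (simp add: W.M.diff_eq_zero_iff)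
    qed
    \<comment> \<open>\<open>\<theta>\<close> is \<open>\<phi>\<close> modulo \<open>?D\<close>,
      read in \<open>W\<close> through \<open>\<psi>\<close>. It is linear because the choice is
      unique, and \<open>\<theta> v\<close> is non-zero because \<open>\<phi> v\<close> is outside
      \<open>?D\<close>.\<close>
    define \<theta> where "\<theta> x = (SOME w. w \<in> carrier W \<and> \<phi> x \<ominus> \<psi> w \<in> ?D)" for x
    have \<theta>: "\<theta> x \<in> carrier W \<and> \<phi> x \<ominus> \<psi> (\<theta> x) \<in> ?D" if "x \<in> carrier V" for x
      unfolding \<theta>_def using someI_ex[OF ex1[OF that]] .
    have "\<theta> \<in> lin_hom R V W"
    proof (rule lin_homI)
      fix x y assume xy: "x \<in> carrier V" "y \<in> carrier V"
      have "\<phi> (x \<oplus>\<^bsub>V\<^esub> y) \<ominus> \<psi> (\<theta> x \<oplus>\<^bsub>W\<^esub> \<theta> y)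
          = (\<phi> x \<ominus> \<psi> (\<theta> x)) \<oplus> (\<phi> y \<ominus> \<psi> (\<theta> y))"
        using xy \<theta>[OF xy(1)] \<theta>[OF xy(2)]
        by (simp add: lin_homD(2)[OF \<phi>] lin_homD(2)[OF \<psi>] a_minus_def K.M.minus_add K.M.a_ac)
      then have "\<phi> (x \<oplus>\<^bsub>V\<^esub> y) \<ominus> \<psi> (\<theta> x \<oplus>\<^bsub>W\<^esub> \<theta> y) \<in> ?D"
        using \<theta> xy Dadd by simp
      then show "\<theta> (x \<oplus>\<^bsub>V\<^esub> y) = \<theta> x \<oplus>\<^bsub>W\<^esub> \<theta> y"
        using \<theta> xy by (intro uniq[of _ _ "\<phi> (x \<oplus>\<^bsub>V\<^esub> y)"]) auto
    next
      fix a x assume ax: "a \<in> carrier R" "x \<in> carrier V"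
      have "\<phi> (a \<odot>\<^bsub>V\<^esub> x) \<ominus> \<psi> (a \<odot>\<^bsub>W\<^esub> \<theta> x) = a \<odot> (\<phi> x \<ominus> \<psi> (\<theta> x))"
        using ax \<theta>[OF ax(2)]
        by (simp add: lin_homD(3)[OF \<phi>] lin_homD(3)[OF \<psi>] a_minus_def K.smult_r_distr K.smult_minus_r)
      then have "\<phi> (a \<odot>\<^bsub>V\<^esub> x) \<ominus> \<psi> (a \<odot>\<^bsub>W\<^esub> \<theta> x) \<in> ?D"
        using \<theta>[OF ax(2)] K.submodule_smult[OF D] ax by simp
      then show "\<theta> (a \<odot>\<^bsub>V\<^esub> x) = a \<odot>\<^bsub>W\<^esub> \<theta> x"
        using \<theta> ax V.smult_closed W.smult_closed by (intro uniq[of _ _ "\<phi> (a \<odot>\<^bsub>V\<^esub> x)"]) auto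
    qed (use \<theta> in blast)
    moreover have "\<theta> v \<noteq> \<zero>\<^bsub>W\<^esub>"
    proof
      assume "\<theta> v = \<zero>\<^bsub>W\<^esub>"
      then have "\<phi> v \<ominus> \<zero> \<in> ?D"
        using \<theta>[OF v(1)] lin_hom_zero[OF W.left_module_axioms K.left_module_axioms \<psi>] by simp
      moreover have "\<phi> v = \<phi> v \<ominus> \<zero>"
        by (rule K.M.add_eq_diffI) (use v in simp_all)
      ultimately show False using False by simp
    qed
    ultimately have "module_iso R V W" using Schur[OF V \<W>[OF W]] v by blast
    with W show ?thesis by blast
  qed
qed

lemma module_length_ge:
  fixes V :: "nat \<Rightarrow> ('r, 'v) module"
  assumes V: "\<And>i. i < n \<Longrightarrow> simple_module R (V i)"
    and noniso: "\<And>i j. \<lbrakk>j < i; i < n\<rbrakk> \<Longrightarrow> \<not> module_iso R (V i) (V j)"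
    and occurs: "\<And>i. i < n \<Longrightarrow> \<exists>\<phi>\<in>lin_hom R (V i) K. \<exists>v\<in>carrier (V i). \<phi> v \<noteq> \<zero>"
  shows "enat n \<le> module_length S KS"
proof -
  \<comment> \<open>\<open>N 0\<close> is zero. A non-zero image of \<open>V i\<close> lies in
    \<open>N (Suc i)\<close>; in \<open>N i\<close> it would make \<open>V i\<close> isomorphic to
    an earlier module. The \<open>Suc n\<close> terms give \<open>n\<close> strict inclusions, and
    it is inclusions that \<open>module_length\<close> counts.\<close>
  define N where "N i = isotypic_sum (V ` {..<i})" for i
  have "N i \<subset> N (Suc i)" if i: "i < n" for i
  proof -
    obtain \<phi> v where \<phi>: "\<phi> \<in> lin_hom R (V i) K" "v \<in> carrier (V i)" "\<phi> v \<noteq> \<zero>"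
      using occurs[OF i] by blast
    have "\<phi> v \<in> N (Suc i)"
      unfolding N_def by (rule image_in_isotypic_sum[OF _ \<phi>(1,2)]) simp
    moreover have "\<phi> v \<notin> N i"
    proof
      assume "\<phi> v \<in> N i"
      then obtain l where "hom_list (V ` {..<i}) l" "\<phi> v \<in> sum_of_images l"
        by (auto simp: N_def isotypic_sum_def)
      then have "\<exists>W\<in>V ` {..<i}. module_iso R (V i) W"
        using V i by (intro simple_submodule_of_sum[OF _ V[OF i] \<phi>]) auto
      with noniso i show False by auto
    qed
    moreover have "N i \<subseteq> N (Suc i)" unfolding N_def by (rule isotypic_sum_mono) auto
    ultimately show ?thesis by blast
  qed
  moreover have "submodule (N i) S KS" for i unfolding N_def by (rule submodule_isotypic_sum)
  ultimately show ?thesis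
    unfolding module_length_def by (intro Sup_upper) blast
qed

end


lemma (in abelian_monoid) finsum_add_eq:
  assumes eq: "\<And>i. i \<in> A \<Longrightarrow> h i = u i \<oplus> v i" and u: "u \<in> A \<rightarrow> carrier G" and v: "v \<in> A \<rightarrow> carrier G"
  shows "finsum G h A = finsum G u A \<oplus> finsum G v A"
proof -
  have "finsum G h A = (\<Oplus>i\<in>A. u i \<oplus> v i)"
    by (rule finsum_cong') (use u v eq in auto)
  also have "\<dots> = finsum G u A \<oplus> finsum G v A"
    by (rule finsum_addf[OF u v])
  finally show ?thesis .
qed

lemma (in left_module) submodule_of_submodule:
  assumes "submodule U R M" "submodule N R (M\<lparr>carrier := U\<rparr>)"
  shows "submodule N R M"
proof -
  interpret U: left_module R "M\<lparr>carrier := U\<rparr>" by (rule submodule_left_module[OF assms(1)])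
  show ?thesis
    by (rule submodule_leftI)
      (use U.submodule_subset[OF assms(2)] U.submodule_zero[OF assms(2)] U.submodule_add[OF assms(2)]
         U.submodule_smult[OF assms(2)] submodule_subset[OF assms(1)] in auto)
qed

lemma (in left_module) submodule_cyclic:
  assumes "x \<in> carrier M"
  shows "submodule ((\<lambda>a. a \<odot>\<^bsub>M\<^esub> x) ` carrier R) R M"
proof (rule submodule_leftI)
  show "\<zero>\<^bsub>M\<^esub> \<in> (\<lambda>a. a \<odot>\<^bsub>M\<^esub> x) ` carrier R"
    by (rule image_eqI[of _ _ \<zero>]) (use assms in simp_all)
qed (use assms in \<open>auto simp: smult_closed smult_l_distr[symmetric] smult_assoc1[symmetric]\<close>)

text \<open>The coset \<open>{a. a u = x}\<close> of the annihilator of \<open>u\<close> stands for the element \<open>x\<close> of \<open>R u\<close>.\<close>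

lemma simple_module_on_cosets:
  fixes W :: "('r, 'x) module"
  assumes W: "simple_module R W"
  obtains V :: "('r, 'r set) module" where "simple_module R V" "module_iso R W V"
proof -
  interpret W: left_module R W using simple_moduleD(1)[OF W] .
  obtain u where u: "u \<in> carrier W" "u \<noteq> \<zero>\<^bsub>W\<^esub>" using simple_module_nonzero[OF W] .
  have "\<one>\<^bsub>R\<^esub> \<odot>\<^bsub>W\<^esub> u \<in> (\<lambda>a. a \<odot>\<^bsub>W\<^esub> u) ` carrier R" by blast
  with u have gen: "(\<lambda>a. a \<odot>\<^bsub>W\<^esub> u) ` carrier R = carrier W"
    using simple_moduleD(3)[OF W W.submodule_cyclic[OF u(1)]] by (auto simp: W.smult_one)
  define j where "j x = {a \<in> carrier R. a \<odot>\<^bsub>W\<^esub> u = x}" for x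
  have inj: "inj_on j (carrier W)"
  proof (rule inj_onI)
    fix x y assume x: "x \<in> carrier W" and eq: "j x = j y"
    obtain a where "a \<in> carrier R" "a \<odot>\<^bsub>W\<^esub> u = x" using x gen by (metis imageE)
    then have "a \<in> j x" by (simp add: j_def)
    then have "a \<in> j y" using eq by simp
    with \<open>a \<in> j x\<close> show "x = y" by (simp add: j_def)
  qed
  let ?i = "inv_into (carrier W) j"
  define V :: "('r, 'r set) module" where "V = \<lparr>carrier = j ` carrier W, monoid.mult = undefined, one = undefined,
    ring.zero = j \<zero>\<^bsub>W\<^esub>, add = (\<lambda>A B. j (?i A \<oplus>\<^bsub>W\<^esub> ?i B)), smult = (\<lambda>a A. j (a \<odot>\<^bsub>W\<^esub> ?i A))\<rparr>"
  have bij: "bij_betw j (carrier W) (carrier V)"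
    using inj by (simp add: bij_betw_def V_def)
  show ?thesis
    by (rule that[of V]; rule simple_module_transport[OF W bij]) (simp_all add: V_def inj)
qed

section \<open>Modules over the group ring of a finite group\<close>

locale group_rep = Q: group Q + L: field L + X: left_module L X
  for Q :: "('q, 'w) monoid_scheme" and L :: "('l, 'p) ring_scheme" and X :: "('l, 'x) module" (structure) +
  fixes \<rho> :: "'q \<Rightarrow> 'x \<Rightarrow> 'x"
  assumes finite_Q: "finite (carrier Q)"
    and rho_closed: "\<lbrakk>q \<in> carrier Q; x \<in> carrier X\<rbrakk> \<Longrightarrow> \<rho> q x \<in> carrier X"
    and rho_add: "\<lbrakk>q \<in> carrier Q; x \<in> carrier X; y \<in> carrier X\<rbrakk> \<Longrightarrow>
      \<rho> q (x \<oplus> y) = \<rho> q x \<oplus> \<rho> q y"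
    and rho_smult: "\<lbrakk>q \<in> carrier Q; a \<in> carrier L; x \<in> carrier X\<rbrakk> \<Longrightarrow>
      \<rho> q (a \<odot> x) = a \<odot> \<rho> q x"
    and rho_one: "x \<in> carrier X \<Longrightarrow> \<rho> \<one>\<^bsub>Q\<^esub> x = x"
    and rho_mult: "\<lbrakk>q \<in> carrier Q; r \<in> carrier Q; x \<in> carrier X\<rbrakk> \<Longrightarrow>
      \<rho> (q \<otimes>\<^bsub>Q\<^esub> r) x = \<rho> q (\<rho> r x)"
    and char_0: "n > 0 \<Longrightarrow> [(n::nat)] \<cdot>\<^bsub>L\<^esub> \<one>\<^bsub>L\<^esub> \<noteq> \<zero>\<^bsub>L\<^esub>"
begin

text \<open>The group algebra is the skew group ring of the trivial action, so its ring structure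
  and the induction over monomials are taken from there.\<close>

sublocale GR: skew_action Q L "\<lambda>_ a. a"
  by unfold_locales (auto simp: ring_hom_def)

declare GR.act_closed [simp del] GR.act_one [simp del] GR.act_zero [simp del]

abbreviation "LQ \<equiv> skew_group_ring Q L (\<lambda>_ a. a)"
abbreviation delta :: "'l \<Rightarrow> 'q \<Rightarrow> 'q \<Rightarrow> 'l" where "delta \<equiv> skew_elem L"

text \<open>The sum in \<open>smult\<close> runs over the whole finite group and not over the
  support of \<open>a\<close>, so additivity in \<open>a\<close> can be checked term by
  term.\<close>

definition XR :: "('q \<Rightarrow> 'l, 'x) module"
  where "XR = \<lparr>carrier = carrier X, monoid.mult = undefined, one = undefined, ring.zero = ring.zero X, add = add X,
    smult = (\<lambda>a x. \<Oplus>q\<in>carrier Q. a q \<odot> \<rho> q x)\<rparr>"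

lemma XR_simps [simp]: "carrier XR = carrier X" "add XR = add X" "ring.zero XR = ring.zero X"
  by (simp_all add: XR_def)

lemma smult_XR: "a \<odot>\<^bsub>XR\<^esub> x = (\<Oplus>q\<in>carrier Q. a q \<odot> \<rho> q x)"
  by (simp add: XR_def)

lemma summand_closed: "\<lbrakk>a \<in> carrier LQ; x \<in> carrier X; q \<in> carrier Q\<rbrakk> \<Longrightarrow>
    a q \<odot> \<rho> q x \<in> carrier X"
  by (intro X.smult_closed rho_closed GR.coeff_closed)

lemma smult_XR_closed: "\<lbrakk>a \<in> carrier LQ; x \<in> carrier X\<rbrakk> \<Longrightarrow> a \<odot>\<^bsub>XR\<^esub> x \<in> carrier X"
  unfolding smult_XR using summand_closed by (intro X.M.finsum_closed) auto

lemma smult_delta: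
  assumes "l \<in> carrier L" "q \<in> carrier Q" "x \<in> carrier X"
  shows "delta l q \<odot>\<^bsub>XR\<^esub> x = l \<odot> \<rho> q x"
proof -
  have "delta l q \<odot>\<^bsub>XR\<^esub> x = (\<Oplus>r\<in>carrier Q. if q = r then l \<odot> \<rho> r x else \<zero>)"
    unfolding smult_XR
    by (rule X.M.finsum_cong') (use assms in \<open>auto simp: skew_elem_def X.smult_closed rho_closed\<close>)
  also have "\<dots> = l \<odot> \<rho> q x"
    by (rule X.M.finsum_singleton) (use assms finite_Q in \<open>auto simp: X.smult_closed rho_closed\<close>)
  finally show ?thesis .
qed

lemma smult_XR_l_distr:
  assumes "a \<in> carrier LQ" "b \<in> carrier LQ" "x \<in> carrier X"
  shows "(a \<oplus>\<^bsub>LQ\<^esub> b) \<odot>\<^bsub>XR\<^esub> x = a \<odot>\<^bsub>XR\<^esub> x \<oplus> b \<odot>\<^bsub>XR\<^esub> x"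
  unfolding smult_XR using summand_closed assms
  by (intro X.M.finsum_add_eq) (auto simp: GR.add_apply X.smult_l_distr GR.coeff_closed rho_closed)

lemma smult_XR_r_distr:
  assumes "a \<in> carrier LQ" "x \<in> carrier X" "y \<in> carrier X"
  shows "a \<odot>\<^bsub>XR\<^esub> (x \<oplus> y) = a \<odot>\<^bsub>XR\<^esub> x \<oplus> a \<odot>\<^bsub>XR\<^esub> y"
  unfolding smult_XR using summand_closed assms
  by (intro X.M.finsum_add_eq) (auto simp: X.smult_r_distr GR.coeff_closed rho_closed rho_add)

lemma smult_XR_zero:
  assumes "x \<in> carrier X" shows "\<zero>\<^bsub>LQ\<^esub> \<odot>\<^bsub>XR\<^esub> x = \<zero>"
  unfolding smult_XR using assms by (intro X.M.add.finprod_one_eqI) (simp add: GR.zero_apply rho_closed)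

lemma smult_XR_zero_r:
  assumes "a \<in> carrier LQ" shows "a \<odot>\<^bsub>XR\<^esub> \<zero> = \<zero>"
  by (rule X.M.idem_zero) (use assms smult_XR_closed smult_XR_r_distr[OF assms, of "\<zero>" "\<zero>"] in auto)

lemma smult_XR_assoc:
  assumes "a \<in> carrier LQ" "b \<in> carrier LQ" "x \<in> carrier X"
  shows "(a \<otimes>\<^bsub>LQ\<^esub> b) \<odot>\<^bsub>XR\<^esub> x = a \<odot>\<^bsub>XR\<^esub> (b \<odot>\<^bsub>XR\<^esub> x)"
  using assms(1,2)
proof (induction rule: GR.skew_induct)
  case a: (delta l q)
  from a(3) show ?case
  proof (induction rule: GR.skew_induct)
    case (delta m r)
    with a(1,2) assms(3) show ?case
      by (simp add: GR.delta_mult_delta smult_delta X.smult_closed rho_closed rho_mult rho_smult X.smult_assoc1)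
  qed (use a(1,2) assms(3) in \<open>simp_all add: GR.SG.r_distr smult_XR_l_distr smult_XR_zero smult_XR_zero_r
        smult_XR_closed smult_XR_r_distr\<close>)
qed (use assms(3) in \<open>simp_all add: GR.SG.l_distr smult_XR_l_distr smult_XR_zero smult_XR_closed\<close>)

sublocale XR: left_module LQ XR
proof (rule left_moduleI)
  show "abelian_group XR"
    by (rule abelian_group_cong[OF X.M.abelian_group_axioms]) simp_all
  show "\<one>\<^bsub>LQ\<^esub> \<odot>\<^bsub>XR\<^esub> x = x" if "x \<in> carrier XR" for x
    using that by (simp add: GR.one_eq_delta smult_delta rho_one X.smult_one)
qed (simp_all add: GR.ring_SG smult_XR_closed smult_XR_l_distr smult_XR_r_distr smult_XR_assoc)

lemma submodule_XR_I:
  assumes K: "submodule K L X" and rho: "\<And>q x. \<lbrakk>q \<in> carrier Q; x \<in> K\<rbrakk> \<Longrightarrow> \<rho> q x \<in> K"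
  shows "submodule K LQ XR"
proof (rule XR.submodule_leftI)
  note KX = X.submodule_subset[OF K, THEN subsetD]
  show "a \<odot>\<^bsub>XR\<^esub> x \<in> K" if a: "a \<in> carrier LQ" and x: "x \<in> K" for a x
    using a
  proof (induction rule: GR.skew_induct)
    case zero
    then show ?case using x X.submodule_zero[OF K] by (simp add: smult_XR_zero KX)
  next
    case (delta s g)
    then show ?case using x rho X.submodule_smult[OF K] by (simp add: smult_delta KX)
  next
    case (add a b)
    then show ?case using x X.submodule_add[OF K] by (simp add: smult_XR_l_distr KX)
  qed
qed (use X.submodule_subset[OF K] X.submodule_zero[OF K] X.submodule_add[OF K] in auto)

text \<open>Scalars and group elements are recovered as the monomials at the identity and those with
  coefficient one.\<close>

lemma submodule_XR_D:
  assumes K: "submodule K LQ XR"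
  shows "submodule K L X" and "\<lbrakk>q \<in> carrier Q; x \<in> K\<rbrakk> \<Longrightarrow> \<rho> q x \<in> K"
proof -
  have KX: "K \<subseteq> carrier X" using XR.submodule_subset[OF K] by simp
  note sm = XR.submodule_smult[OF K GR.delta_closed]
  show "submodule K L X"
  proof (rule X.submodule_leftI)
    show "a \<odot> x \<in> K" if "a \<in> carrier L" "x \<in> K" for a x
      using sm[of a "\<one>\<^bsub>Q\<^esub>" x] that KX by (auto simp: smult_delta rho_one subset_iff)
  qed (use KX XR.submodule_zero[OF K] XR.submodule_add[OF K] in auto)
  show "\<lbrakk>q \<in> carrier Q; x \<in> K\<rbrakk> \<Longrightarrow> \<rho> q x \<in> K"
    using sm[of "\<one>\<^bsub>L\<^esub>" q x] KX by (auto simp: smult_delta rho_closed X.smult_one subset_iff)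
qed

section \<open>Finite-dimensional spaces and the existence of simple submodules\<close>

fun span :: "'x list \<Rightarrow> 'x set"
  where "span [] = {\<zero>}"
  | "span (b # bs) = {a \<odot> b \<oplus> d | a d. a \<in> carrier L \<and> d \<in> span bs}"

lemma submodule_span: "set bs \<subseteq> carrier X \<Longrightarrow> submodule (span bs) L X"
proof (induction bs)
  case Nil
  show ?case using X.submodule_singleton_zero by simp
next
  case (Cons b bs)
  then have l: "submodule (span bs) L X" and b: "b \<in> carrier X" by auto
  note [simp] = X.submodule_subset[OF l, THEN subsetD] X.smult_closed b
  show ?case
  proof (rule X.submodule_leftI)
    show "span (b # bs) \<subseteq> carrier X" by auto
    have "\<zero> = \<zero>\<^bsub>L\<^esub> \<odot> b \<oplus> \<zero>" by simp
    then show "\<zero> \<in> span (b # bs)"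
      using X.submodule_zero[OF l] L.zero_closed unfolding span.simps by blast
  next
    fix x y assume "x \<in> span (b # bs)" "y \<in> span (b # bs)"
    then obtain v d w e where xy: "v \<in> carrier L" "d \<in> span bs" "x = v \<odot> b \<oplus> d"
      "w \<in> carrier L" "e \<in> span bs" "y = w \<odot> b \<oplus> e" by auto
    then have "x \<oplus> y = (v \<oplus>\<^bsub>L\<^esub> w) \<odot> b \<oplus> (d \<oplus> e)"
      by (simp add: X.smult_l_distr X.M.a_ac)
    moreover have "v \<oplus>\<^bsub>L\<^esub> w \<in> carrier L" "d \<oplus> e \<in> span bs"
      using xy X.submodule_add[OF l] by simp_all
    ultimately show "x \<oplus> y \<in> span (b # bs)"
      unfolding span.simps by blast
  next
    fix a x assume a: "a \<in> carrier L" and "x \<in> span (b # bs)"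
    then obtain v d where x: "v \<in> carrier L" "d \<in> span bs" "x = v \<odot> b \<oplus> d" by auto
    then have "a \<odot> x = (a \<otimes>\<^bsub>L\<^esub> v) \<odot> b \<oplus> a \<odot> d"
      using a by (simp add: X.smult_r_distr X.smult_assoc1)
    moreover have "a \<otimes>\<^bsub>L\<^esub> v \<in> carrier L" "a \<odot> d \<in> span bs"
      using x a X.submodule_smult[OF l] by simp_all
    ultimately show "a \<odot> x \<in> span (b # bs)"
      unfolding span.simps by blast
  qed
qed

lemma in_span: "\<lbrakk>set bs \<subseteq> carrier X; b \<in> set bs\<rbrakk> \<Longrightarrow> b \<in> span bs"
proof (induction bs)
  case (Cons c bs)
  then have l: "submodule (span bs) L X" and c: "c \<in> carrier X" and b: "b \<in> carrier X"
    using submodule_span by auto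
  show ?case
  proof (cases "b = c")
    case True
    have "b = \<one>\<^bsub>L\<^esub> \<odot> b \<oplus> \<zero>" using b by (simp add: X.smult_one)
    with True show ?thesis using X.submodule_zero[OF l] L.one_closed unfolding span.simps by blast
  next
    case False
    have "b = \<zero>\<^bsub>L\<^esub> \<odot> c \<oplus> b" using b c by simp
    moreover have "b \<in> span bs" using Cons False by auto
    ultimately show ?thesis using L.zero_closed unfolding span.simps by blast
  qed
qed simp

text \<open>Finite-dimensional spaces satisfy the minimal condition: a chain \<open>W\<^sub>2 \<subset> W\<^sub>1 \<subset> W\<^sub>0\<close> with equal
  intersections with a hyperplane is impossible.\<close>

lemma exists_minimal_subspace:
  assumes "set bs \<subseteq> carrier X" "\<W> \<noteq> {}" "\<And>W. W \<in> \<W> \<Longrightarrow> submodule W L X \<and> W \<subseteq> span bs"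
  shows "\<exists>W\<in>\<W>. \<forall>W'\<in>\<W>. W' \<subseteq> W \<longrightarrow> W' = W"
  using assms
proof (induction bs arbitrary: \<W>)
  case Nil
  have "W = {\<zero>}" if "W \<in> \<W>" for W
    using X.submodule_zero Nil(3)[OF that] by auto
  then show ?case using Nil(2) by blast
next
  case (Cons b bs)
  let ?D = "span bs"
  have b: "b \<in> carrier X" and D: "submodule ?D L X" using Cons.prems(1) submodule_span by auto
  have int: "submodule (W \<inter> ?D) L X" if "submodule W L X" for W
    by (rule X.submodule_leftI)
      (use X.submodule_subset[OF that] X.submodule_zero[OF that] X.submodule_add[OF that] X.submodule_smult[OF that]
        X.submodule_zero[OF D] X.submodule_add[OF D] X.submodule_smult[OF D] in auto)
  \<comment> \<open>The induction hypothesis is applied to the traces on \<open>?D\<close>. A member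
    \<open>W0\<close> with minimal trace is either minimal itself, or any member strictly below it
    is.\<close>
  have "\<exists>U\<in>(\<lambda>W. W \<inter> ?D) ` \<W>. \<forall>U'\<in>(\<lambda>W. W \<inter> ?D) ` \<W>. U' \<subseteq> U \<longrightarrow> U' = U"
    by (rule Cons.IH) (use Cons.prems int in auto)
  then obtain W0 where W0: "W0 \<in> \<W>" and min: "\<And>W. \<lbrakk>W \<in> \<W>; W \<inter> ?D \<subseteq> W0 \<inter> ?D\<rbrakk> \<Longrightarrow> W \<inter> ?D = W0 \<inter> ?D"
    by auto
  show ?case
  proof (cases "\<forall>W'\<in>\<W>. W' \<subseteq> W0 \<longrightarrow> W' = W0")
    case True
    with W0 show ?thesis by blast
  next
    case False
    then obtain W1 where W1: "W1 \<in> \<W>" "W1 \<subset> W0" by blast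
    then have eq1: "W1 \<inter> ?D = W0 \<inter> ?D" by (intro min) auto
    have sub: "submodule W0 L X" "submodule W1 L X" using Cons.prems(3) W0 W1 by auto
    \<comment> \<open>Otherwise \<open>W1\<close> has an element with non-zero coefficient at
      \<open>b\<close>. Every \<open>w\<close> in \<open>W0\<close> can then be reduced by a
      multiple of it into \<open>?D\<close>, where \<open>W0\<close> and \<open>W1\<close> agree, so
      \<open>W0\<close> would be contained in \<open>W1\<close>.\<close>
    have "W1 \<subseteq> ?D"
    proof (rule ccontr)
      assume "\<not> W1 \<subseteq> ?D"
      then obtain w1 where w1: "w1 \<in> W1" "w1 \<notin> ?D" by blast
      then have "w1 \<in> span (b # bs)" using Cons.prems(3) W1 by blast
      then obtain a d where ad: "a \<in> carrier L" "d \<in> ?D" "w1 = a \<odot> b \<oplus> d" by auto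
      have dX: "d \<in> carrier X" using ad X.submodule_subset[OF D] by blast
      have a: "a \<in> Units L"
        using ad w1 b dX by (cases "a = \<zero>\<^bsub>L\<^esub>") (auto simp: L.field_Units)
      have "w \<in> W1" if w: "w \<in> W0" for w
      proof -
        have "w \<in> span (b # bs)" using Cons.prems(3) W0 w by blast
        then obtain a' d' where ad': "a' \<in> carrier L" "d' \<in> ?D" "w = a' \<odot> b \<oplus> d'" by auto
        have d'X: "d' \<in> carrier X" using ad' X.submodule_subset[OF D] by blast
        \<comment> \<open>The multiple of \<open>w1\<close> by \<open>c\<close> has the same
          coefficient at \<open>b\<close> as \<open>w\<close>, so subtracting it leads into
          \<open>?D\<close>.\<close>
        define c where "c = a' \<otimes>\<^bsub>L\<^esub> inv\<^bsub>L\<^esub> a"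
        have c: "c \<in> carrier L" "c \<otimes>\<^bsub>L\<^esub> a = a'"
          using a ad' by (simp_all add: c_def L.m_assoc L.Units_closed)
        have "c \<odot> w1 = a' \<odot> b \<oplus> c \<odot> d"
          using c ad b dX by (simp add: X.smult_r_distr X.smult_assoc1[symmetric] X.smult_closed)
        then have "w \<ominus> c \<odot> w1 = d' \<ominus> c \<odot> d"
          using ad' b d'X dX c
          by (simp add: a_minus_def X.M.minus_add X.smult_closed X.M.a_ac X.M.r_neg2)
        moreover have "d' \<ominus> c \<odot> d \<in> ?D"
          using ad ad' c by (simp add: a_minus_def X.submodule_add[OF D] X.submodule_minus[OF D] X.submodule_smult[OF D])
        moreover have "w \<ominus> c \<odot> w1 \<in> W0"
          using w w1 W1 c by (auto simp: a_minus_def intro!: X.submodule_add[OF sub(1)] X.submodule_minus[OF sub(1)]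
              X.submodule_smult[OF sub(1)])
        ultimately have "w \<ominus> c \<odot> w1 \<in> W1" using eq1 by auto
        moreover have cw: "c \<odot> w1 \<in> W1" using X.submodule_smult[OF sub(2)] c w1 by simp
        ultimately have "(w \<ominus> c \<odot> w1) \<oplus> c \<odot> w1 \<in> W1"
          by (rule X.submodule_add[OF sub(2)])
        moreover have "w \<in> carrier X" "c \<odot> w1 \<in> carrier X"
          using w cw X.submodule_subset[OF sub(1)] X.submodule_subset[OF sub(2)] by auto
        ultimately show ?thesis by (simp add: a_minus_def X.M.a_assoc X.M.l_neg)
      qed
      with W1 show False by blast
    qed
    \<comment> \<open>\<open>W1\<close> lies in \<open>?D\<close>, so it and everything below it
      coincide with their traces, and these cannot shrink any further.\<close>
    have "W' = W1" if W': "W' \<in> \<W>" "W' \<subseteq> W1" for W'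
    proof -
      have "W' \<inter> ?D \<subseteq> W0 \<inter> ?D" using W'(2) W1(2) by blast
      then have "W' \<inter> ?D = W0 \<inter> ?D" by (rule min[OF W'(1)])
      with eq1 \<open>W1 \<subseteq> ?D\<close> W'(2) show ?thesis by blast
    qed
    with W1 show ?thesis by blast
  qed
qed

text \<open>The submodule generated by \<open>x\<close> is spanned over \<open>L\<close> by the
  finitely many \<open>\<rho> q x\<close>, so the minimal condition applies to its non-zero
  submodules; a minimal one is simple.\<close>

lemma exists_simple_submodule:
  assumes x: "x \<in> carrier X" "x \<noteq> \<zero>"
  obtains U where "submodule U LQ XR" "U \<subseteq> (\<lambda>a. a \<odot>\<^bsub>XR\<^esub> x) ` carrier LQ" "simple_module LQ (XR\<lparr>carrier := U\<rparr>)"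
proof -
  let ?C = "(\<lambda>a. a \<odot>\<^bsub>XR\<^esub> x) ` carrier LQ"
  obtain qs where qs: "set qs = carrier Q" using finite_list[OF finite_Q] by blast
  let ?bs = "map (\<lambda>q. \<rho> q x) qs"
  have bs: "set ?bs \<subseteq> carrier X" using qs rho_closed x by auto
  have span: "?C \<subseteq> span ?bs"
  proof (rule image_subsetI)
    fix a assume "a \<in> carrier LQ"
    then show "a \<odot>\<^bsub>XR\<^esub> x \<in> span ?bs"
    proof (induction rule: GR.skew_induct)
      case zero
      then show ?case using x X.submodule_zero[OF submodule_span[OF bs]] by (simp add: smult_XR_zero)
    next
      case (delta s g)
      then have "\<rho> g x \<in> span ?bs" using qs by (intro in_span[OF bs]) auto
      with delta show ?case using x X.submodule_smult[OF submodule_span[OF bs]] by (simp add: smult_delta)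
    next
      case (add a b)
      then show ?case using x X.submodule_add[OF submodule_span[OF bs]] by (simp add: smult_XR_l_distr)
    qed
  qed
  define \<W> where "\<W> = {W. submodule W LQ XR \<and> W \<noteq> {\<zero>} \<and> W \<subseteq> ?C}"
  have C: "submodule ?C LQ XR" using XR.submodule_cyclic x by simp
  have "\<one>\<^bsub>LQ\<^esub> \<odot>\<^bsub>XR\<^esub> x \<in> ?C" by blast
  then have "x \<in> ?C" using x by (simp add: XR.smult_one)
  with x C have "?C \<in> \<W>" unfolding \<W>_def by (intro CollectI conjI) auto
  then have ne: "\<W> \<noteq> {}" by blast
  have sub: "submodule W L X \<and> W \<subseteq> span ?bs" if "W \<in> \<W>" for W
    using that submodule_XR_D(1) order_trans[OF _ span] by (simp add: \<W>_def)
  obtain U where U_in: "U \<in> \<W>" and U_min: "\<And>W. \<lbrakk>W \<in> \<W>; W \<subseteq> U\<rbrakk> \<Longrightarrow> W = U"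
    using exists_minimal_subspace[OF bs ne sub] by blast
  then have U: "submodule U LQ XR" "U \<noteq> {\<zero>}" "U \<subseteq> ?C" by (simp_all add: \<W>_def)
  have min: "W = U" if "submodule W LQ XR" "W \<noteq> {\<zero>}" "W \<subseteq> U" for W
    using that order_trans[OF that(3) U(3)] by (intro U_min) (simp_all add: \<W>_def)
  have "simple_module LQ (XR\<lparr>carrier := U\<rparr>)"
    unfolding simple_module_def
  proof (intro conjI allI impI)
    interpret U: left_module LQ "XR\<lparr>carrier := U\<rparr>" by (rule XR.submodule_left_module[OF U(1)])
    show "left_module LQ (XR\<lparr>carrier := U\<rparr>)" by (rule U.left_module_axioms)
    show "carrier (XR\<lparr>carrier := U\<rparr>) \<noteq> {\<zero>\<^bsub>XR\<lparr>carrier := U\<rparr>\<^esub>}" using U(2) by simp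
    fix N assume N: "submodule N LQ (XR\<lparr>carrier := U\<rparr>)"
    then show "N = {\<zero>\<^bsub>XR\<lparr>carrier := U\<rparr>\<^esub>} \<or> N = carrier (XR\<lparr>carrier := U\<rparr>)"
      using min[OF XR.submodule_of_submodule[OF U(1) N]] U.submodule_subset[OF N] by auto
  qed
  with U that show ?thesis by blast
qed

text \<open>The image is required to lie in \<open>K\<close>, instead of \<open>K\<close> being made
  a module, so that occurrence passes at once to larger sets. For simple \<open>V\<close> the
  non-zero map is an embedding.\<close>

definition occurs :: "'x set \<Rightarrow> ('q \<Rightarrow> 'l, 'v) module \<Rightarrow> bool"
  where "occurs K V \<longleftrightarrow> (\<exists>\<phi>\<in>lin_hom LQ V XR. \<phi> ` carrier V \<subseteq> K \<and> (\<exists>v\<in>carrier V. \<phi> v \<noteq> \<zero>))"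

text \<open>This property is preserved by isomorphisms and by twisting, and so distinguishes the two
  orbits.\<close>

definition trivial_module :: "('q \<Rightarrow> 'l, 'v) module \<Rightarrow> bool"
  where "trivial_module V \<longleftrightarrow> (\<forall>q\<in>carrier Q. \<forall>v\<in>carrier V. delta \<one>\<^bsub>L\<^esub> q \<odot>\<^bsub>V\<^esub> v = v)"

lemma trivial_module_iso:
  assumes "module_iso LQ V W" "trivial_module V"
  shows "trivial_module W"
proof -
  obtain \<phi> where \<phi>: "\<phi> \<in> lin_hom LQ V W" "bij_betw \<phi> (carrier V) (carrier W)"
    using assms(1) by (auto simp: module_iso_def)
  then have "carrier W = \<phi> ` carrier V" by (simp add: bij_betw_def)
  with assms(2) show ?thesis
    unfolding trivial_module_def by (auto simp: lin_homD(3)[OF \<phi>(1), symmetric])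
qed

lemma occurs_iso:
  assumes "left_module LQ V" "module_iso LQ V W" "occurs K V"
  shows "occurs K W"
proof -
  obtain \<phi> where \<phi>: "\<phi> \<in> lin_hom LQ V W" "bij_betw \<phi> (carrier V) (carrier W)"
    using assms(2) by (auto simp: module_iso_def)
  obtain \<psi> v where \<psi>: "\<psi> \<in> lin_hom LQ V XR" "\<psi> ` carrier V \<subseteq> K" "v \<in> carrier V" "\<psi> v \<noteq> \<zero>"
    using assms(3) by (auto simp: occurs_def)
  let ?i = "inv_into (carrier V) \<phi>"
  have "?i (\<phi> v) = v" using \<phi> \<psi> by (simp add: bij_betw_def)
  moreover have i: "?i \<in> lin_hom LQ W V" by (rule lin_hom_inv[OF assms(1) \<phi>])
  moreover have "\<phi> v \<in> carrier W" by (rule lin_homD(1)[OF \<phi>(1) \<psi>(3)])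
  moreover have "\<psi> (?i w) \<in> K" if "w \<in> carrier W" for w
    using lin_homD(1)[OF i that] \<psi>(2) by blast
  ultimately show ?thesis
    unfolding occurs_def using \<psi>(4) lin_hom_comp[OF i \<psi>(1)]
    by (intro bexI[of _ "\<lambda>w. \<psi> (?i w)"] conjI bexI[of _ "\<phi> v"]) auto
qed

text \<open>The sum is not divided by the order of \<open>Q\<close>; the inverse of the order
  appears only in \<open>card_smult_zero\<close>.\<close>

definition avg :: "'x \<Rightarrow> 'x" where "avg x = (\<Oplus>q\<in>carrier Q. \<rho> q x)"

lemma avg_closed [simp]: "x \<in> carrier X \<Longrightarrow> avg x \<in> carrier X"
  unfolding avg_def using rho_closed by (intro X.M.finsum_closed) auto

lemma avg_add: "\<lbrakk>x \<in> carrier X; y \<in> carrier X\<rbrakk> \<Longrightarrow> avg (x \<oplus> y) = avg x \<oplus> avg y"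
  unfolding avg_def using rho_closed
  by (intro X.M.finsum_add_eq) (auto simp: rho_add)

lemma rho_zero: "q \<in> carrier Q \<Longrightarrow> \<rho> q \<zero> = \<zero>"
  by (rule X.M.idem_zero) (use rho_closed rho_add[of q "\<zero>" "\<zero>"] in auto)

lemma rho_finsum:
  assumes q: "q \<in> carrier Q" and "finite A" "g \<in> A \<rightarrow> carrier X"
  shows "\<rho> q (\<Oplus>i\<in>A. g i) = (\<Oplus>i\<in>A. \<rho> q (g i))"
  using assms(2,3)
proof (induction rule: finite_induct)
  case empty
  then show ?case using rho_zero[OF q] by simp
next
  case (insert i A)
  then have "g i \<in> carrier X" "g \<in> A \<rightarrow> carrier X" by auto
  with insert show ?case
    using q rho_closed by (simp add: X.M.finsum_insert rho_add Pi_iff)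
qed

lemma rho_avg:
  assumes "q \<in> carrier Q" "x \<in> carrier X"
  shows "\<rho> q (avg x) = avg x"
proof -
  have inj: "inj_on (\<lambda>r. q \<otimes>\<^bsub>Q\<^esub> r) (carrier Q)" using assms by (intro inj_onI) simp
  have im: "(\<lambda>r. q \<otimes>\<^bsub>Q\<^esub> r) ` carrier Q = carrier Q"
    using assms by (intro Q.surj_const_mult)
  have "\<rho> q (avg x) = (\<Oplus>r\<in>carrier Q. \<rho> q (\<rho> r x))"
    unfolding avg_def by (rule rho_finsum) (use assms finite_Q rho_closed in auto)
  also have "\<dots> = (\<Oplus>r\<in>carrier Q. \<rho> (q \<otimes>\<^bsub>Q\<^esub> r) x)"
    by (rule X.M.finsum_cong') (use assms rho_closed in \<open>auto simp: rho_mult\<close>)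
  also have "\<dots> = (\<Oplus>r\<in>(\<lambda>r. q \<otimes>\<^bsub>Q\<^esub> r) ` carrier Q. \<rho> r x)"
    by (rule X.M.finsum_reindex[symmetric]) (use assms inj rho_closed in auto)
  finally show ?thesis unfolding im avg_def .
qed

lemma add_pow_smult: "x \<in> carrier X \<Longrightarrow> [(n::nat)] \<cdot> x = ([n] \<cdot>\<^bsub>L\<^esub> \<one>\<^bsub>L\<^esub>) \<odot> x"
  by (induction n) (simp_all add: X.smult_l_distr X.smult_one)

text \<open>Here characteristic zero enters: the order of \<open>Q\<close> is a unit of
  \<open>L\<close>. With \<open>K\<close> zero, this shows that the order kills no non-zero vector;
  with \<open>K\<close> the span of the differences, it recovers a vector of \<open>K\<close> from
  its multiple.\<close>

lemma card_smult_zero: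
  assumes "x \<in> carrier X" "[card (carrier Q)] \<cdot> x \<in> K" "submodule K L X"
  shows "x \<in> K"
proof -
  let ?n = "[card (carrier Q)] \<cdot>\<^bsub>L\<^esub> \<one>\<^bsub>L\<^esub>"
  have "carrier Q \<noteq> {}" using Q.one_closed by blast
  then have n: "?n \<in> Units L"
    using char_0[of "card (carrier Q)"] finite_Q by (simp add: L.field_Units card_gt_0_iff)
  then have "x = inv\<^bsub>L\<^esub> ?n \<odot> ([card (carrier Q)] \<cdot> x)"
    using assms(1) by (simp add: add_pow_smult X.smult_assoc1[symmetric] X.smult_one)
  also have "\<dots> \<in> K" using n assms(2) by (intro X.submodule_smult[OF assms(3)]) auto
  finally show ?thesis .
qed

lemma avg_invariant:
  assumes "x \<in> carrier X" "\<And>q. q \<in> carrier Q \<Longrightarrow> \<rho> q x = x"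
  shows "avg x = [card (carrier Q)] \<cdot> x"
proof -
  have "avg x = (\<Oplus>q\<in>carrier Q. x)"
    unfolding avg_def by (rule X.M.finsum_cong') (use assms in auto)
  then show ?thesis using assms(1) by (simp add: X.M.add.finprod_const add_pow_def)
qed

text \<open>A simple submodule of the module generated by \<open>x\<close> is moved to the type over
  which \<open>Irr\<close> is formed, so that it represents a class there.\<close>

lemma occurs_simple:
  assumes K: "submodule K LQ XR" and x: "x \<in> K" "x \<noteq> \<zero>"
  obtains V :: "('q \<Rightarrow> 'l, ('q \<Rightarrow> 'l) set) module" and \<phi> v where "simple_module LQ V" "\<phi> \<in> lin_hom LQ V XR"
    "\<phi> ` carrier V \<subseteq> K" "inj_on \<phi> (carrier V)" "v \<in> carrier V" "\<phi> v \<noteq> \<zero>"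
proof -
  have xX: "x \<in> carrier X" using x XR.submodule_subset[OF K] by auto
  obtain U where U: "submodule U LQ XR" "U \<subseteq> (\<lambda>a. a \<odot>\<^bsub>XR\<^esub> x) ` carrier LQ"
    and simple: "simple_module LQ (XR\<lparr>carrier := U\<rparr>)" using exists_simple_submodule[OF xX x(2)] .
  obtain V :: "('q \<Rightarrow> 'l, ('q \<Rightarrow> 'l) set) module" where V: "simple_module LQ V" "module_iso LQ (XR\<lparr>carrier := U\<rparr>) V"
    using simple_module_on_cosets[OF simple] .
  have "module_iso LQ V (XR\<lparr>carrier := U\<rparr>)"
    using module_iso_sym[OF simple_moduleD(1)[OF simple] V(2)] .
  then obtain \<phi> where \<phi>: "\<phi> \<in> lin_hom LQ V (XR\<lparr>carrier := U\<rparr>)" "bij_betw \<phi> (carrier V) U"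
    by (auto simp: module_iso_def)
  then have im: "\<phi> ` carrier V = U" "inj_on \<phi> (carrier V)" by (auto simp: bij_betw_def)
  have UK: "U \<subseteq> K" using U(2) XR.submodule_smult[OF K _ x(1)] by blast
  have "\<phi> \<in> lin_hom LQ V XR"
    by (rule lin_homI) (use lin_homD[OF \<phi>(1)] XR.submodule_subset[OF U(1)] in auto)
  moreover obtain u where "u \<in> U" "u \<noteq> \<zero>" using simple_module_nonzero[OF simple] by auto
  moreover from this im obtain v where "v \<in> carrier V" "\<phi> v = u" by auto
  ultimately show ?thesis using that[OF V(1)] im UK by auto
qed

text \<open>The vectors of \<open>K\<close> fixed by \<open>Q\<close> form a submodule containing
  \<open>y\<close>, and every module embedded in it is trivial. So it suffices to find a simple one
  inside.\<close>

lemma trivial_occurs: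
  assumes K: "submodule K LQ XR" and y: "y \<in> K" "y \<noteq> \<zero>" "\<And>q. q \<in> carrier Q \<Longrightarrow> \<rho> q y = y"
  obtains V :: "('q \<Rightarrow> 'l, ('q \<Rightarrow> 'l) set) module" where "simple_module LQ V" "trivial_module V" "occurs K V"
proof -
  note KX = XR.submodule_subset[OF K, THEN subsetD]
  let ?K = "{x \<in> K. \<forall>q\<in>carrier Q. \<rho> q x = x}"
  have KL: "submodule K L X" using submodule_XR_D[OF K] by blast
  have "submodule ?K L X"
    by (rule X.submodule_leftI)
      (use KX X.submodule_zero[OF KL] X.submodule_add[OF KL] X.submodule_smult[OF KL]
        in \<open>auto simp: rho_zero rho_add rho_smult\<close>)
  then have K': "submodule ?K LQ XR"
    by (rule submodule_XR_I) auto
  obtain V :: "('q \<Rightarrow> 'l, ('q \<Rightarrow> 'l) set) module" and \<phi> v where V: "simple_module LQ V" "\<phi> \<in> lin_hom LQ V XR"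
    "\<phi> ` carrier V \<subseteq> ?K" "inj_on \<phi> (carrier V)" "v \<in> carrier V" "\<phi> v \<noteq> \<zero>"
    using occurs_simple[OF K', of y] y by auto
  interpret V: left_module LQ V using simple_moduleD(1)[OF V(1)] .
  have "trivial_module V"
    unfolding trivial_module_def
  proof (intro ballI)
    fix q v assume q: "q \<in> carrier Q" and v: "v \<in> carrier V"
    have "\<phi> v \<in> ?K" using V(3) v by blast
    then have "\<phi> v \<in> carrier X" "\<rho> q (\<phi> v) = \<phi> v" using KX q by auto
    then have "\<phi> (delta \<one>\<^bsub>L\<^esub> q \<odot>\<^bsub>V\<^esub> v) = \<phi> v"
      using q v lin_homD(3)[OF V(2)] by (simp add: smult_delta X.smult_one)
    then show "delta \<one>\<^bsub>L\<^esub> q \<odot>\<^bsub>V\<^esub> v = v"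
      using V(4) q v V.smult_closed by (auto simp: inj_on_def)
  qed
  moreover have "occurs K V" using V by (auto simp: occurs_def)
  ultimately show ?thesis using that V by blast
qed

text \<open>On the image of a trivial module \<open>avg\<close> is multiplication by the order of
  \<open>Q\<close>, which kills no non-zero vector, while \<open>avg\<close> vanishes on
  \<open>K\<close>.\<close>

lemma nontrivial_occurs:
  assumes K: "submodule K LQ XR" and y: "y \<in> K" "y \<noteq> \<zero>" and avg0: "\<And>x. x \<in> K \<Longrightarrow> avg x = \<zero>"
  obtains V :: "('q \<Rightarrow> 'l, ('q \<Rightarrow> 'l) set) module" where "simple_module LQ V" "\<not> trivial_module V" "occurs K V"
proof -
  note KX = XR.submodule_subset[OF K, THEN subsetD]
  obtain V :: "('q \<Rightarrow> 'l, ('q \<Rightarrow> 'l) set) module" and \<phi> v where V: "simple_module LQ V" "\<phi> \<in> lin_hom LQ V XR"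
    "\<phi> ` carrier V \<subseteq> K" "inj_on \<phi> (carrier V)" "v \<in> carrier V" "\<phi> v \<noteq> \<zero>"
    using occurs_simple[OF K y] .
  have v: "\<phi> v \<in> K" "\<phi> v \<in> carrier X" using V(3,5) KX by auto
  have "\<not> trivial_module V"
  proof
    assume t: "trivial_module V"
    have "\<rho> q (\<phi> v) = \<phi> v" if "q \<in> carrier Q" for q
    proof -
      have "\<rho> q (\<phi> v) = \<phi> (delta \<one>\<^bsub>L\<^esub> q \<odot>\<^bsub>V\<^esub> v)"
        using that V(5) v lin_homD(3)[OF V(2)] by (simp add: smult_delta X.smult_one rho_closed)
      then show ?thesis using t that V(5) by (simp add: trivial_module_def)
    qed
    then have "[card (carrier Q)] \<cdot> \<phi> v = \<zero>"
      using avg_invariant[OF v(2)] avg0[OF v(1)] by simp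
    then have "\<phi> v \<in> {\<zero>}"
      by (intro card_smult_zero[OF v(2) _ X.submodule_singleton_zero]) simp
    with V(6) show False by simp
  qed
  moreover have "occurs K V" using V by (auto simp: occurs_def)
  ultimately show ?thesis using that V by blast
qed

end


section \<open>Isotypic components permuted by a group\<close>

text \<open>What the argument takes from the tensor product: \<open>st\<close> is the secret action,
  \<open>\<gamma>\<close> the diagonal action of \<open>G\<close>, and \<open>\<iota>\<close> the
  structure map of the algebra. As \<open>\<gamma>\<close> is linear only over \<open>L\<close>, the
  representation theory takes place on the restriction \<open>X\<close> of \<open>T\<close> to
  \<open>L\<close>, and \<open>S\<close> returns only when length is measured.\<close>

locale semilinear_rep = L: field L + G: group G + T: left_module S T
  for L :: "('l, 'p) ring_scheme" and G :: "('g, 'r) monoid_scheme" (structure)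
    and S :: "('s, 'q) ring_scheme" and T :: "('s, 'x) module" +
  fixes \<iota> :: "'l \<Rightarrow> 's" and H H' :: "'g set" and st :: "'g \<Rightarrow> 'x \<Rightarrow> 'x" and \<gamma> :: "'g \<Rightarrow> 'x \<Rightarrow> 'x"
  assumes char_0: "n > 0 \<Longrightarrow> [(n::nat)] \<cdot>\<^bsub>L\<^esub> \<one>\<^bsub>L\<^esub> \<noteq> \<zero>\<^bsub>L\<^esub>"
    and H: "H \<lhd> G" "H' \<lhd> G" "H' \<subseteq> H" and finite_index: "finite (carrier (subquot G H H'))"
    and iota: "\<iota> \<in> ring_hom L S"
    and iota_central: "\<lbrakk>a \<in> carrier L; s \<in> carrier S\<rbrakk> \<Longrightarrow> \<iota> a \<otimes>\<^bsub>S\<^esub> s = s \<otimes>\<^bsub>S\<^esub> \<iota> a"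
    and st_closed: "\<lbrakk>h \<in> H; x \<in> carrier T\<rbrakk> \<Longrightarrow> st h x \<in> carrier T"
    and st_add: "\<lbrakk>h \<in> H; x \<in> carrier T; y \<in> carrier T\<rbrakk> \<Longrightarrow> st h (x \<oplus>\<^bsub>T\<^esub> y) = st h x \<oplus>\<^bsub>T\<^esub> st h y"
    and st_smult: "\<lbrakk>h \<in> H; s \<in> carrier S; x \<in> carrier T\<rbrakk> \<Longrightarrow> st h (s \<odot>\<^bsub>T\<^esub> x) = s \<odot>\<^bsub>T\<^esub> st h x"
    and st_mult: "\<lbrakk>h \<in> H; k \<in> H; x \<in> carrier T\<rbrakk> \<Longrightarrow> st (h \<otimes> k) x = st h (st k x)"
    and st_trivial: "\<lbrakk>h \<in> H'; x \<in> carrier T\<rbrakk> \<Longrightarrow> st h x = x"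
    and gamma_closed: "\<lbrakk>g \<in> carrier G; x \<in> carrier T\<rbrakk> \<Longrightarrow> \<gamma> g x \<in> carrier T"
    and gamma_add: "\<lbrakk>g \<in> carrier G; x \<in> carrier T; y \<in> carrier T\<rbrakk> \<Longrightarrow>
      \<gamma> g (x \<oplus>\<^bsub>T\<^esub> y) = \<gamma> g x \<oplus>\<^bsub>T\<^esub> \<gamma> g y"
    and gamma_smult: "\<lbrakk>g \<in> carrier G; a \<in> carrier L; x \<in> carrier T\<rbrakk> \<Longrightarrow>
      \<gamma> g (\<iota> a \<odot>\<^bsub>T\<^esub> x) = \<iota> a \<odot>\<^bsub>T\<^esub> \<gamma> g x"
    and gamma_zeroD: "\<lbrakk>g \<in> carrier G; x \<in> carrier T; \<gamma> g x = \<zero>\<^bsub>T\<^esub>\<rbrakk> \<Longrightarrow> x = \<zero>\<^bsub>T\<^esub>"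
    and gamma_st: "\<lbrakk>g \<in> carrier G; h \<in> H; x \<in> carrier T\<rbrakk> \<Longrightarrow>
      \<gamma> g (st h x) = st (g \<otimes> h \<otimes> inv g) (\<gamma> g x)"
begin

abbreviation "Q \<equiv> subquot G H H'"
abbreviation "X \<equiv> restrict_scalars \<iota> T"

definition rho :: "'g set \<Rightarrow> 'x \<Rightarrow> 'x"
  where "rho q = st (SOME h. h \<in> q)"

lemma H_carrier: "h \<in> H \<Longrightarrow> h \<in> carrier G"
  using normal_imp_subgroup[OF H(1)] by (rule subgroup.mem_carrier)

lemma H'_carrier: "h \<in> H' \<Longrightarrow> h \<in> carrier G"
  using H H_carrier by auto

lemma H_mult: "\<lbrakk>h \<in> H; k \<in> H\<rbrakk> \<Longrightarrow> h \<otimes> k \<in> H"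
  using normal_imp_subgroup[OF H(1)] by (rule subgroup.m_closed)

lemma H_one: "\<one> \<in> H'" "\<one> \<in> H"
  using subgroup.one_closed[OF normal_imp_subgroup] H by blast+

lemma group_Q: "group Q"
proof -
  interpret GH: group "G\<lparr>carrier := H\<rparr>"
    by (rule G.subgroup_imp_group[OF normal_imp_subgroup[OF H(1)]])
  have "H' \<lhd> G\<lparr>carrier := H\<rparr>"
    by (rule G.normal_restrict_supergroup[OF normal_imp_subgroup[OF H(1)] H(2,3)])
  then show ?thesis unfolding subquot_def by (rule normal.factorgroup_is_group)
qed

lemma carrier_Q: "carrier Q = (\<lambda>h. H' #> h) ` H"
  by (simp add: subquot_def carrier_FactGroup)

lemma mult_Q: "\<lbrakk>h \<in> H; k \<in> H\<rbrakk> \<Longrightarrow> (H' #> h) \<otimes>\<^bsub>Q\<^esub> (H' #> k) = H' #> (h \<otimes> k)"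
  using normal.rcos_sum[OF H(2)] by (simp add: subquot_def H_carrier)

lemma one_Q: "\<one>\<^bsub>Q\<^esub> = H' #> \<one>"
  using H'_carrier by (subst G.coset_mult_one) (auto simp: subquot_def)

text \<open>\<open>rho\<close> uses an arbitrary representative of the coset; any other differs from
  it by an element of \<open>H'\<close>, which acts trivially.\<close>

lemma rho_coset:
  assumes h: "h \<in> H" and x: "x \<in> carrier T"
  shows "rho (H' #> h) x = st h x"
proof -
  have "h \<in> H' #> h"
    using h H H_carrier by (intro G.rcos_self normal_imp_subgroup) auto
  then have "(SOME k. k \<in> H' #> h) \<in> H' #> h" by (rule someI)
  then obtain n where "n \<in> H'" "(SOME k. k \<in> H' #> h) = n \<otimes> h"
    by (auto simp: r_coset_def)
  then show ?thesis
    using h x H by (auto simp: rho_def st_mult st_trivial st_closed)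
qed

lemma iota_closed [simp]: "a \<in> carrier L \<Longrightarrow> \<iota> a \<in> carrier S"
  using iota by (rule ring_hom_closed)

sublocale Q: group Q by (rule group_Q)

sublocale X: left_module L X
  by (rule T.restrict_scalars_left_module[OF L.ring_axioms iota])

sublocale rep: group_rep Q L X rho
proof unfold_locales
  show "finite (carrier Q)" by (rule finite_index)
  show "rho \<one>\<^bsub>Q\<^esub> x = x" if "x \<in> carrier X" for x
    unfolding one_Q using that H_one by (simp add: rho_coset st_trivial)
  show "rho (q \<otimes>\<^bsub>Q\<^esub> r) x = rho q (rho r x)" if "q \<in> carrier Q" "r \<in> carrier Q" "x \<in> carrier X" for q r x
    using that by (auto simp: carrier_Q mult_Q rho_coset st_mult st_closed H_mult)
qed (auto simp: carrier_Q rho_coset st_closed st_add st_smult char_0 T.smult_closed simp del: Q.one_closed)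

abbreviation "LQ \<equiv> group_ring L Q"

lemma LQ: "skew_group_ring Q L (\<lambda>_ a. a) = LQ"
  by (simp add: group_ring_def)

section \<open>Conjugation on the quotient group and on its group algebra\<close>

definition conj_coset :: "'g \<Rightarrow> 'g set \<Rightarrow> 'g set"
  where "conj_coset g p = (\<lambda>x. g \<otimes> x \<otimes> inv g) ` p"

lemma conj_coset_eq:
  assumes g: "g \<in> carrier G" and h: "h \<in> H"
  shows "conj_coset g (H' #> h) = H' #> (g \<otimes> h \<otimes> inv g)"
proof -
  have eq: "g \<otimes> (n \<otimes> h) \<otimes> inv g
      = (g \<otimes> n \<otimes> inv g) \<otimes> (g \<otimes> h \<otimes> inv g)" if "n \<in> H'" for n
  proof -
    have "inv g \<otimes> (g \<otimes> h \<otimes> inv g) = h \<otimes> inv g"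
      using g H_carrier[OF h] by (simp add: G.m_assoc[symmetric])
    then show ?thesis using g H_carrier[OF h] H'_carrier[OF that] by (simp add: G.m_assoc)
  qed
  show ?thesis
  proof (intro equalityI subsetI)
    fix y assume "y \<in> conj_coset g (H' #> h)"
    then obtain n where n: "n \<in> H'" "y = g \<otimes> (n \<otimes> h) \<otimes> inv g"
      by (auto simp: conj_coset_def r_coset_def)
    moreover have "g \<otimes> n \<otimes> inv g \<in> H'" using normal.inv_op_closed2[OF H(2) g n(1)] .
    ultimately show "y \<in> H' #> (g \<otimes> h \<otimes> inv g)"
      unfolding eq[OF n(1)] by (auto simp: r_coset_def)
  next
    fix y assume "y \<in> H' #> (g \<otimes> h \<otimes> inv g)"
    then obtain n where n: "n \<in> H'" "y = n \<otimes> (g \<otimes> h \<otimes> inv g)"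
      by (auto simp: r_coset_def)
    let ?m = "inv g \<otimes> n \<otimes> g"
    have m: "?m \<in> H'" using normal.inv_op_closed1[OF H(2) g n(1)] .
    have "g \<otimes> ?m \<otimes> inv g = n"
    proof -
      have "g \<otimes> ?m = n \<otimes> g" using g H'_carrier[OF n(1)] by (simp add: G.m_assoc[symmetric])
      then show ?thesis using g H'_carrier[OF n(1)] by (simp add: G.m_assoc)
    qed
    then have "y = g \<otimes> (?m \<otimes> h) \<otimes> inv g" using eq[OF m] n by simp
    with m show "y \<in> conj_coset g (H' #> h)" by (auto simp: conj_coset_def r_coset_def)
  qed
qed

lemma H_conj: "\<lbrakk>g \<in> carrier G; h \<in> H\<rbrakk> \<Longrightarrow> g \<otimes> h \<otimes> inv g \<in> H"
  using normal.inv_op_closed2[OF H(1)] .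

lemma conj_coset_closed: "\<lbrakk>g \<in> carrier G; p \<in> carrier Q\<rbrakk> \<Longrightarrow> conj_coset g p \<in> carrier Q"
  by (auto simp: carrier_Q conj_coset_eq H_conj)

lemma Q_subset: "p \<in> carrier Q \<Longrightarrow> p \<subseteq> carrier G"
  using H_carrier H'_carrier by (auto simp: carrier_Q r_coset_def)

lemma conj_coset_inv:
  assumes g: "g \<in> carrier G" and p: "p \<subseteq> carrier G"
  shows "conj_coset g (conj_coset (inv g) p) = p"
proof -
  have "g \<otimes> (inv g \<otimes> x \<otimes> inv (inv g)) \<otimes> inv g = x" if "x \<in> p" for x
  proof -
    have x: "x \<in> carrier G" using that p by auto
    have "g \<otimes> (inv g \<otimes> x \<otimes> g) = x \<otimes> g" using g x by (simp add: G.m_assoc[symmetric])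
    then show ?thesis using g x by (simp add: G.m_assoc)
  qed
  then show ?thesis by (simp add: conj_coset_def image_image)
qed

lemma conj_coset_eq_iff:
  assumes g: "g \<in> carrier G" and p: "p \<in> carrier Q" and q: "q \<in> carrier Q"
  shows "conj_coset g p = q \<longleftrightarrow> p = conj_coset (inv g) q"
  using conj_coset_inv[OF g Q_subset[OF q]] conj_coset_inv[of "inv g", OF _ Q_subset[OF p]] g by auto

lemma rho_conj:
  assumes "g \<in> carrier G" "q \<in> carrier Q" "x \<in> carrier T"
  shows "\<gamma> g (rho (conj_coset (inv g) q) x) = rho q (\<gamma> g x)"
proof -
  let ?p = "conj_coset (inv g) q"
  have p: "?p \<in> carrier Q" using assms by (simp add: conj_coset_closed)
  then obtain h where h: "h \<in> H" "?p = H' #> h" by (auto simp: carrier_Q)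
  have "q = conj_coset g ?p" using conj_coset_inv[OF assms(1) Q_subset[OF assms(2)]] by simp
  then have "q = H' #> (g \<otimes> h \<otimes> inv g)"
    using conj_coset_eq[OF assms(1) h(1)] h(2) by simp
  then show ?thesis
    using assms h by (simp add: rho_coset H_conj gamma_st gamma_closed)
qed

abbreviation "cgr g \<equiv> conj_group_ring L G H H' g"

lemma cgr: "cgr g a = (\<lambda>p. if p \<in> carrier Q then a (conj_coset g p) else \<zero>\<^bsub>L\<^esub>)"
  unfolding conj_group_ring_def conj_coset_def ..

lemma cgr_closed:
  assumes "a \<in> carrier LQ" shows "cgr g a \<in> carrier LQ"
  unfolding LQ[symmetric] rep.GR.in_carrier_iff
  using rep.GR.coeff_closed[OF assms[folded LQ]] finite_index by (auto simp: cgr)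

text \<open>Precomposing a coefficient function with conjugation by \<open>g\<close> moves its
  support by the inverse conjugation, in agreement with \<open>h\<close> acting on
  \<open>g V\<close> as g^-1 h g acts on \<open>V\<close>.\<close>

lemma cgr_delta: "\<lbrakk>g \<in> carrier G; l \<in> carrier L; q \<in> carrier Q\<rbrakk> \<Longrightarrow>
    cgr g (skew_elem L l q) = skew_elem L l (conj_coset (inv g) q)"
  using conj_coset_closed[of "inv g" q] by (auto simp: cgr skew_elem_def conj_coset_eq_iff)

lemma cgr_add: "cgr g (a \<oplus>\<^bsub>LQ\<^esub> b) = cgr g a \<oplus>\<^bsub>LQ\<^esub> cgr g b"
  unfolding LQ[symmetric] by (auto simp: cgr rep.GR.add_apply fun_eq_iff)

lemma cgr_zero: "cgr g \<zero>\<^bsub>LQ\<^esub> = \<zero>\<^bsub>LQ\<^esub>"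
  unfolding LQ[symmetric] by (auto simp: cgr rep.GR.zero_apply fun_eq_iff)

lemma cgr_one:
  assumes "a \<in> carrier LQ" shows "cgr \<one> a = a"
proof
  fix p
  have "p \<in> carrier Q \<Longrightarrow> conj_coset \<one> p = p"
    using Q_subset by (force simp: conj_coset_def)
  then show "cgr \<one> a p = a p"
    using rep.GR.coeff_outside[OF assms[folded LQ], of p] by (simp add: cgr)
qed

text \<open>What makes the set of occurring modules stable under \<open>G\<close>: a homomorphism
  out of \<open>V\<close> followed by \<open>\<gamma> g\<close> is a homomorphism out of the twist
  \<open>g V\<close>.\<close>

lemma gamma_smult_LQ:
  assumes g: "g \<in> carrier G" and a: "a \<in> carrier LQ" and x: "x \<in> carrier T"
  shows "\<gamma> g (cgr g a \<odot>\<^bsub>rep.XR\<^esub> x) = a \<odot>\<^bsub>rep.XR\<^esub> \<gamma> g x"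
  using a[folded LQ]
proof (induction rule: rep.GR.skew_induct)
  case zero
  have "\<gamma> g \<zero>\<^bsub>T\<^esub> = \<zero>\<^bsub>T\<^esub>"
    by (rule T.M.idem_zero) (use g gamma_closed gamma_add[of g "\<zero>\<^bsub>T\<^esub>" "\<zero>\<^bsub>T\<^esub>"] in auto)
  then show ?case
    using x g rep.smult_XR_zero by (simp add: cgr_zero LQ gamma_closed)
next
  case (delta l q)
  then show ?case
    using g x rep.rho_closed
    by (simp add: cgr_delta rep.smult_delta conj_coset_closed gamma_closed gamma_smult rho_conj)
next
  case (add a b)
  note * = add(1,2)[unfolded LQ]
  show ?case
    using add g x cgr_closed[OF *(1), of g] cgr_closed[OF *(2), of g]
      rep.smult_XR_closed
    by (simp add: LQ cgr_add rep.smult_XR_l_distr[unfolded LQ] gamma_add gamma_closed)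
qed

section \<open>Isomorphism classes, twists and orbits\<close>

lemma simple_iso_iff: "(V, W) \<in> simple_iso L Q \<longleftrightarrow>
    simple_module LQ V \<and> simple_module LQ W \<and> module_iso LQ V W"
  by (auto simp: simple_iso_def module_iso_def)

lemma Irr_memberD:
  assumes "C \<in> Irr L Q" "V \<in> C"
  shows "simple_module LQ V" and "W \<in> C \<longleftrightarrow> (V, W) \<in> simple_iso L Q"
proof -
  obtain U where U: "simple_module LQ U" "C = simple_iso L Q `` {U}"
    using assms(1) by (auto simp: Irr_def elim: quotientE)
  then have UV: "module_iso LQ U V" and V: "simple_module LQ V"
    using assms(2) by (auto simp: simple_iso_iff)
  show "simple_module LQ V" by (rule V)
  have VU: "module_iso LQ V U" using UV U simple_moduleD(1) module_iso_sym by blast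
  show "W \<in> C \<longleftrightarrow> (V, W) \<in> simple_iso L Q"
    using U V UV VU by (auto simp: simple_iso_iff intro: module_iso_trans)
qed

lemma Irr_nonempty:
  assumes "C \<in> Irr L Q" obtains V where "V \<in> C"
proof -
  obtain U where U: "simple_module LQ U" "C = simple_iso L Q `` {U}"
    using assms by (auto simp: Irr_def elim: quotientE)
  then have "U \<in> C" by (auto simp: simple_iso_iff module_iso_refl)
  then show ?thesis using that by blast
qed

lemma Irr_class:
  assumes "simple_module LQ V"
  obtains C where "C \<in> Irr L Q" "V \<in> C"
proof
  show "simple_iso L Q `` {V} \<in> Irr L Q" using assms by (auto simp: Irr_def intro: quotientI)
  show "V \<in> simple_iso L Q `` {V}" using assms by (auto simp: simple_iso_iff module_iso_refl)
qed

lemma twist_simps [simp]: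
  "carrier (twist L G H H' g V) = carrier V" "add (twist L G H H' g V) = add V"
  "ring.zero (twist L G H H' g V) = ring.zero V"
  "smult (twist L G H H' g V) = (\<lambda>a. smult V (cgr g a))"
  by (simp_all add: twist_def)

text \<open>An orbit is by definition the set of all translates of a class. The translate by the
  identity links the class to its orbit, because this twist changes nothing on
  \<open>L[H/H']\<close>.\<close>

lemma in_irr_action_one:
  assumes "C \<in> Irr L Q" "V \<in> C"
  shows "V \<in> irr_action L G H H' \<one> C"
proof -
  have V: "simple_module LQ V" using Irr_memberD(1)[OF assms] .
  have *: "simple_module LQ (twist L G H H' \<one> V)" "module_iso LQ V (twist L G H H' \<one> V)"
    by (rule simple_module_transport[OF V, of "\<lambda>x. x"]; simp add: cgr_one bij_betw_def)+
  then have "(twist L G H H' \<one> V, V) \<in> simple_iso L Q"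
    using V module_iso_sym[OF simple_moduleD(1)[OF V]] by (simp add: simple_iso_iff)
  with assms(2) show ?thesis unfolding irr_action_def by blast
qed

lemma trivial_twist:
  assumes "g \<in> carrier G" "rep.trivial_module V"
  shows "rep.trivial_module (twist L G H H' g V)"
  using assms by (simp add: rep.trivial_module_def cgr_delta conj_coset_closed)

text \<open>Compose the given homomorphism with \<open>\<gamma> g\<close>, which preserves
  \<open>K\<close> and kills no non-zero vector.\<close>

lemma occurs_twist:
  assumes g: "g \<in> carrier G" and occ: "rep.occurs K V"
    and K: "K \<subseteq> carrier T" and gK: "\<And>x. x \<in> K \<Longrightarrow> \<gamma> g x \<in> K"
  shows "rep.occurs K (twist L G H H' g V)"
proof -
  obtain \<phi> v where \<phi>: "\<phi> \<in> lin_hom LQ V rep.XR" "\<phi> ` carrier V \<subseteq> K" "v \<in> carrier V" "\<phi> v \<noteq> \<zero>\<^bsub>T\<^esub>"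
    using occ by (auto simp: rep.occurs_def LQ)
  note D = lin_homD[OF \<phi>(1)]
  have "(\<lambda>x. \<gamma> g (\<phi> x)) \<in> lin_hom LQ (twist L G H H' g V) rep.XR"
    using D g by (intro lin_homI) (simp_all add: gamma_closed gamma_add cgr_closed gamma_smult_LQ)
  moreover have "\<gamma> g (\<phi> v) \<noteq> \<zero>\<^bsub>T\<^esub>" using gamma_zeroD[OF g] \<phi>(2-4) K by blast
  moreover have "\<gamma> g (\<phi> x) \<in> K" if "x \<in> carrier V" for x
    using gK \<phi>(2) that by blast
  ultimately show ?thesis unfolding rep.occurs_def LQ
    using \<phi>(3) by (intro bexI[of _ "\<lambda>x. \<gamma> g (\<phi> x)"] conjI bexI[of _ v]) auto
qed

text \<open>Triviality separates the orbits of \<open>V0\<close> and \<open>V1\<close>. There being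
  two orbits, each class is related by a twist to the class of one of them, and occurrence passes
  along twists and isomorphisms.\<close>

lemma all_occur:
  fixes V0 V1 :: "('g set \<Rightarrow> 'l, ('g set \<Rightarrow> 'l) set) module"
  assumes orbits: "card (orbits G (Irr L Q) (irr_action L G H H')) = 2"
    and K: "K \<subseteq> carrier T" and gK: "\<And>g x. \<lbrakk>g \<in> carrier G; x \<in> K\<rbrakk> \<Longrightarrow> \<gamma> g x \<in> K"
    and V0: "simple_module LQ V0" "rep.trivial_module V0" "rep.occurs K V0"
    and V1: "simple_module LQ V1" "\<not> rep.trivial_module V1" "rep.occurs K V1"
    and C: "C \<in> Irr L Q" "V \<in> C"
  shows "rep.occurs K V"
proof -
  let ?act = "irr_action L G H H'"
  let ?O = "orbits G (Irr L Q) ?act"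
  obtain C0 where C0: "C0 \<in> Irr L Q" "V0 \<in> C0" using Irr_class[OF V0(1)] .
  obtain C1 where C1: "C1 \<in> Irr L Q" "V1 \<in> C1" using Irr_class[OF V1(1)] .
  \<comment> \<open>Equality of the orbits is used at one point only: the identity translate of
    \<open>E\<close> must be some translate of \<open>D\<close>.\<close>
  have from_orbit: "\<exists>g\<in>carrier G. \<exists>W\<in>D. (twist L G H H' g W, U) \<in> simple_iso L Q"
    if "E \<in> Irr L Q" "U \<in> E" "orbit G ?act E = orbit G ?act D" for D E U
  proof -
    have "?act \<one> E \<in> orbit G ?act D"
      unfolding that(3)[symmetric] by (auto simp: orbit_def)
    then obtain g where "g \<in> carrier G" "?act \<one> E = ?act g D" by (auto simp: orbit_def)
    moreover have "U \<in> ?act \<one> E" by (rule in_irr_action_one[OF that(1,2)])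
    ultimately show ?thesis by (auto simp: irr_action_def)
  qed
  have ne: "orbit G ?act C0 \<noteq> orbit G ?act C1"
  proof
    assume "orbit G ?act C0 = orbit G ?act C1"
    then obtain g W where g: "g \<in> carrier G" "W \<in> C0" "(twist L G H H' g W, V1) \<in> simple_iso L Q"
      using from_orbit[OF C1, of C0] by auto
    have "module_iso LQ V0 W" using Irr_memberD(2)[OF C0] g(2) by (simp add: simple_iso_iff)
    then have "rep.trivial_module W" using rep.trivial_module_iso[unfolded LQ] V0 by blast
    then have "rep.trivial_module V1"
      using rep.trivial_module_iso[unfolded LQ] trivial_twist[OF g(1)] g(3) simple_iso_iff by blast
    with V1 show False by simp
  qed
  have "{orbit G ?act C0, orbit G ?act C1} \<subseteq> ?O"
    using C0 C1 by (auto simp: orbits_def)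
  \<comment> \<open>\<open>card\<close> is 0 on infinite sets, so the value 2 forces finiteness, and
    two distinct orbits exhaust the set.\<close>
  moreover have "finite ?O" using orbits by (intro card_ge_0_finite) simp
  ultimately have "{orbit G ?act C0, orbit G ?act C1} = ?O"
    using ne orbits by (intro card_seteq) auto
  moreover have "orbit G ?act C \<in> ?O" using C by (auto simp: orbits_def)
  ultimately have "orbit G ?act C = orbit G ?act C0 \<or> orbit G ?act C = orbit G ?act C1" by auto
  then obtain D U where D: "orbit G ?act C = orbit G ?act D" "D \<in> Irr L Q" "U \<in> D"
    "simple_module LQ U" "rep.occurs K U"
    using C0 C1 V0 V1 by auto
  obtain g W where g: "g \<in> carrier G" "W \<in> D" "(twist L G H H' g W, V) \<in> simple_iso L Q"
    using from_orbit[OF C D(1)] by blast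
  have "module_iso LQ U W" using Irr_memberD(2)[OF D(2,3)] g(2) by (simp add: simple_iso_iff)
  then have "rep.occurs K W"
    using rep.occurs_iso[unfolded LQ] simple_moduleD(1)[OF D(4)] D(5) by blast
  then have "rep.occurs K (twist L G H H' g W)"
    using occurs_twist[OF g(1) _ K] gK g(1) by blast
  then show ?thesis
    using rep.occurs_iso[unfolded LQ] g(3) simple_moduleD(1) simple_iso_iff by blast
qed

text \<open>On monomials the two structures commute because \<open>st\<close> is
  \<open>S\<close>-linear and the image of \<open>\<iota>\<close> is central in
  \<open>S\<close>.\<close>

lemma commuting:
  assumes K: "submodule K S T" and KR: "submodule K LQ rep.XR"
  shows "commuting_modules LQ (rep.XR\<lparr>carrier := K\<rparr>) S (T\<lparr>carrier := K\<rparr>)"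
proof -
  interpret K: left_module LQ "rep.XR\<lparr>carrier := K\<rparr>"
    using rep.XR.submodule_left_module[unfolded LQ, OF KR] .
  interpret KS: left_module S "T\<lparr>carrier := K\<rparr>"
    using T.submodule_left_module[OF K] .
  note KT = T.submodule_subset[OF K, THEN subsetD]
  have comm: "s \<odot>\<^bsub>T\<^esub> (a \<odot>\<^bsub>rep.XR\<^esub> x) = a \<odot>\<^bsub>rep.XR\<^esub> (s \<odot>\<^bsub>T\<^esub> x)"
    if s: "s \<in> carrier S" and a: "a \<in> carrier LQ" and x: "x \<in> carrier T" for s a x
    using a[folded LQ]
  proof (induction rule: rep.GR.skew_induct)
    case zero
    then show ?case using s x rep.smult_XR_zero by (simp add: T.smult_closed)
  next
    case (delta l q)
    then obtain h where "h \<in> H" "q = H' #> h" by (auto simp: carrier_Q)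
    with delta s x show ?case
      by (simp add: rep.smult_delta T.smult_closed rho_coset st_smult st_closed
          T.smult_assoc1[symmetric] iota_central)
  next
    case (add a b)
    then show ?case using s x rep.smult_XR_closed rep.smult_XR_l_distr
      by (simp add: T.smult_r_distr T.smult_closed)
  qed
  show ?thesis
    by unfold_locales (use comm KT in auto)
qed

text \<open>Representatives of different classes are pairwise non-isomorphic simple modules that all
  occur in \<open>K\<close>; \<open>module_length_ge\<close> turns them into a chain.\<close>

lemma length_ge_card_Irr:
  assumes K: "submodule K S T" and KR: "submodule K LQ rep.XR"
    and occ: "\<And>C V. \<lbrakk>C \<in> Irr L Q; V \<in> C\<rbrakk> \<Longrightarrow> rep.occurs K V" and ne: "Irr L Q \<noteq> {}"
  shows "\<not> module_length S (T\<lparr>carrier := K\<rparr>) \<le> enat (card (Irr L Q) - 1)"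
proof -
  interpret commuting_modules LQ "rep.XR\<lparr>carrier := K\<rparr>" S "T\<lparr>carrier := K\<rparr>"
    by (rule commuting[OF K KR])
  \<comment> \<open>\<open>n\<close> classes with \<open>n\<close> above the bound. If
    \<open>Irr\<close> is finite, all of them are taken, and non-emptiness makes the bound smaller
    by one. If it were infinite, \<open>card\<close> would be 0 and truncated subtraction would give
    the bound 0, which a single class exceeds.\<close>
  obtain n :: nat and C where n: "card (Irr L Q) - 1 < n" and C: "inj_on C {..<n}" "C ` {..<n} \<subseteq> Irr L Q"
  proof (cases "finite (Irr L Q)")
    case True
    obtain C where "bij_betw C {0..<card (Irr L Q)} (Irr L Q)"
      using ex_bij_betw_nat_finite[OF True] by blast
    moreover have "card (Irr L Q) - 1 < card (Irr L Q)" using True ne by (simp add: card_gt_0_iff)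
    ultimately show ?thesis
      using that[of "card (Irr L Q)" C] by (auto simp: bij_betw_def atLeast0LessThan)
  next
    case False
    obtain D where "D \<in> Irr L Q" using ne by blast
    moreover have "inj_on (\<lambda>_. D) {..<1::nat}" by (simp add: inj_on_def)
    ultimately show ?thesis using that[of 1 "\<lambda>_. D"] False by auto
  qed
  define V where "V i = (SOME V. V \<in> C i)" for i
  have VC: "V i \<in> C i" "C i \<in> Irr L Q" if "i < n" for i
  proof -
    show "C i \<in> Irr L Q" using C(2) that by blast
    then obtain W where "W \<in> C i" using Irr_nonempty by blast
    then show "V i \<in> C i" unfolding V_def by (rule someI)
  qed
  have "enat n \<le> module_length S (T\<lparr>carrier := K\<rparr>)"
  proof (rule module_length_ge[of n V])
    fix i assume i: "i < n"
    show "simple_module LQ (V i)" using Irr_memberD(1) VC[OF i] by blast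
    show "\<exists>\<phi>\<in>lin_hom LQ (V i) (rep.XR\<lparr>carrier := K\<rparr>). \<exists>v\<in>carrier (V i). \<phi> v \<noteq> \<zero>\<^bsub>rep.XR\<lparr>carrier := K\<rparr>\<^esub>"
    proof -
      obtain \<phi> v where \<phi>: "\<phi> \<in> lin_hom LQ (V i) rep.XR" "\<phi> ` carrier (V i) \<subseteq> K" "v \<in> carrier (V i)" "\<phi> v \<noteq> \<zero>\<^bsub>T\<^esub>"
        using occ[OF VC(2,1)[OF i]] by (auto simp: rep.occurs_def LQ)
      have "\<phi> \<in> lin_hom LQ (V i) (rep.XR\<lparr>carrier := K\<rparr>)"
        using lin_homD[OF \<phi>(1)] \<phi>(2) by (intro lin_homI) auto
      with \<phi> show ?thesis by auto
    qed
  next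
    fix i j :: nat assume ij: "j < i" "i < n"
    show "\<not> module_iso LQ (V i) (V j)"
    proof
      assume iso: "module_iso LQ (V i) (V j)"
      have i: "V i \<in> C i" "C i \<in> Irr L Q" and j: "V j \<in> C j" "C j \<in> Irr L Q" using VC ij by auto
      have "(V i, V j) \<in> simple_iso L Q"
        using iso Irr_memberD(1) i j by (simp add: simple_iso_iff)
      then have "V j \<in> C i" using Irr_memberD(2)[OF i(2,1)] by simp
      then have "C i = C j" using Irr_memberD(2)[OF i(2)] Irr_memberD(2)[OF j(2,1)] by auto
      then have "i = j" using ij by (intro inj_onD[OF C(1)]) auto
      with ij show False by simp
    qed
  qed
  then show ?thesis
    using n order_trans[of "enat n" _ "enat (card (Irr L Q) - 1)"] by fastforce
qed

section \<open>The submodule generated by the differences, and averaging\<close>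

abbreviation "CK \<equiv> coinv_kernel st H T"

lemma CK_subgroup: "subgroup CK (add_monoid T)"
  unfolding coinv_kernel_def by (rule T.M.add.generate_is_subgroup) (auto simp: st_closed)

lemma CK_minimal:
  assumes "subgroup K (add_monoid T)" "\<And>h x. \<lbrakk>h \<in> H; x \<in> carrier T\<rbrakk> \<Longrightarrow> st h x \<ominus>\<^bsub>T\<^esub> x \<in> K"
  shows "CK \<subseteq> K"
  unfolding coinv_kernel_def by (rule T.M.add.generate_subgroup_incl) (use assms in auto)

lemma diff_in_CK: "\<lbrakk>h \<in> H; x \<in> carrier T\<rbrakk> \<Longrightarrow> st h x \<ominus>\<^bsub>T\<^esub> x \<in> CK"
  unfolding coinv_kernel_def by (rule generate.incl) auto

lemma CK_closed:
  shows "CK \<subseteq> carrier T" "\<zero>\<^bsub>T\<^esub> \<in> CK" "\<lbrakk>x \<in> CK; y \<in> CK\<rbrakk> \<Longrightarrow> x \<oplus>\<^bsub>T\<^esub> y \<in> CK" "x \<in> CK \<Longrightarrow> \<ominus>\<^bsub>T\<^esub> x \<in> CK"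
  using subgroup.subset[OF CK_subgroup] subgroup.one_closed[OF CK_subgroup] subgroup.m_closed[OF CK_subgroup]
    subgroup.m_inv_closed[OF CK_subgroup] by (auto simp: a_inv_def)

text \<open>As \<open>st\<close> is \<open>S\<close>-linear, multiplication by \<open>s\<close>
  sends the difference for \<open>x\<close> to the difference for the \<open>s\<close>-multiple of
  \<open>x\<close>, so the generators stay in \<open>CK\<close>.\<close>

lemma CK_submodule: "submodule CK S T"
proof (rule T.submodule_leftI)
  show "s \<odot>\<^bsub>T\<^esub> x \<in> CK" if s: "s \<in> carrier S" and x: "x \<in> CK" for s x
  proof -
    have "subgroup {x \<in> carrier T. s \<odot>\<^bsub>T\<^esub> x \<in> CK} (add_monoid T)"
      by (rule T.M.add.subgroupI) (use s CK_closed in \<open>auto simp: T.smult_r_distr T.smult_minus_r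
          a_inv_def[symmetric] intro: exI[of _ "\<zero>\<^bsub>T\<^esub>"]\<close>)
    then have "CK \<subseteq> {x \<in> carrier T. s \<odot>\<^bsub>T\<^esub> x \<in> CK}"
    proof (rule CK_minimal)
      fix h x assume hx: "h \<in> H" "x \<in> carrier T"
      have "s \<odot>\<^bsub>T\<^esub> (st h x \<ominus>\<^bsub>T\<^esub> x) = st h (s \<odot>\<^bsub>T\<^esub> x) \<ominus>\<^bsub>T\<^esub> s \<odot>\<^bsub>T\<^esub> x"
        using hx s by (simp add: a_minus_def T.smult_r_distr T.smult_minus_r st_closed st_smult)
      then show "st h x \<ominus>\<^bsub>T\<^esub> x \<in> {x \<in> carrier T. s \<odot>\<^bsub>T\<^esub> x \<in> CK}"
        using hx s diff_in_CK[of h "s \<odot>\<^bsub>T\<^esub> x"] by (simp add: st_closed T.smult_closed)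
    qed
    with x show ?thesis by blast
  qed
qed (use CK_closed in auto)

text \<open>A set containing all differences is stable under \<open>st\<close>, since
  \<open>st h x\<close> is \<open>x\<close> plus a difference. Both the kernel of
  \<open>\<Phi>\<close> and \<open>CK\<close> are of this kind.\<close>

lemma submodule_restrict:
  assumes K: "submodule K S T"
    and stable: "\<And>h x. \<lbrakk>h \<in> H; x \<in> carrier T\<rbrakk> \<Longrightarrow> st h x \<ominus>\<^bsub>T\<^esub> x \<in> K"
  shows "submodule K L X" "submodule K LQ rep.XR"
proof -
  note KT = T.submodule_subset[OF K, THEN subsetD]
  show KL: "submodule K L X"
    by (rule X.submodule_leftI)
      (use KT T.submodule_zero[OF K] T.submodule_add[OF K] T.submodule_smult[OF K] in auto)
  have "st h x \<in> K" if h: "h \<in> H" and x: "x \<in> K" for h x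
  proof -
    have "(st h x \<ominus>\<^bsub>T\<^esub> x) \<oplus>\<^bsub>T\<^esub> x \<in> K"
      using stable[OF h KT[OF x]] x by (rule T.submodule_add[OF K])
    then show ?thesis using KT[OF x] h by (simp add: a_minus_def T.M.a_assoc T.M.l_neg st_closed)
  qed
  then have "submodule K (skew_group_ring Q L (\<lambda>_ a. a)) rep.XR"
    by (intro rep.submodule_XR_I[OF KL]) (use KT in \<open>auto simp: carrier_Q rho_coset\<close>)
  then show "submodule K LQ rep.XR" by (simp add: LQ)
qed

text \<open>Acting by \<open>h\<close> beforehand permutes the summands by a right translation of
  the quotient group. Hence \<open>avg\<close> vanishes on differences.\<close>

lemma avg_st:
  assumes h: "h \<in> H" and x: "x \<in> carrier T"
  shows "rep.avg (st h x) = rep.avg x"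
proof -
  let ?q = "H' #> h"
  have q: "?q \<in> carrier Q" using h by (auto simp: carrier_Q)
  have inj: "inj_on (\<lambda>r. r \<otimes>\<^bsub>Q\<^esub> ?q) (carrier Q)" using q by (intro inj_onI) simp
  have im: "(\<lambda>r. r \<otimes>\<^bsub>Q\<^esub> ?q) ` carrier Q = carrier Q"
    using q inj finite_index by (intro endo_inj_surj) auto
  have "rep.avg (st h x) = (\<Oplus>\<^bsub>X\<^esub>r\<in>carrier Q. rho (r \<otimes>\<^bsub>Q\<^esub> ?q) x)"
    unfolding rep.avg_def
    by (rule X.M.finsum_cong')
      (use q x h rep.rho_closed rep.rho_mult in \<open>auto simp: rho_coset st_closed\<close>)
  also have "\<dots> = (\<Oplus>\<^bsub>X\<^esub>r\<in>(\<lambda>r. r \<otimes>\<^bsub>Q\<^esub> ?q) ` carrier Q. rho r x)"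
    by (rule X.M.finsum_reindex[symmetric]) (use x inj im rep.rho_closed in auto)
  finally show ?thesis unfolding im rep.avg_def .
qed

lemma avg_CK: "x \<in> CK \<Longrightarrow> rep.avg x = \<zero>\<^bsub>T\<^esub>"
proof -
  have closed: "rep.avg x \<in> carrier T" if "x \<in> carrier T" for x
    using rep.avg_closed that by simp
  have add: "rep.avg (x \<oplus>\<^bsub>T\<^esub> y) = rep.avg x \<oplus>\<^bsub>T\<^esub> rep.avg y" if "x \<in> carrier T" "y \<in> carrier T" for x y
    using rep.avg_add that by simp
  have zero: "rep.avg \<zero>\<^bsub>T\<^esub> = \<zero>\<^bsub>T\<^esub>"
    by (rule T.M.idem_zero) (use closed add[of "\<zero>\<^bsub>T\<^esub>" "\<zero>\<^bsub>T\<^esub>"] in auto)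
  have minus: "rep.avg (\<ominus>\<^bsub>T\<^esub> x) = \<ominus>\<^bsub>T\<^esub> rep.avg x" if "x \<in> carrier T" for x
    by (rule T.M.minus_equality[symmetric]) (use that closed add[of "\<ominus>\<^bsub>T\<^esub> x" x] zero in \<open>auto simp: T.M.l_neg\<close>)
  have "subgroup {x \<in> carrier T. rep.avg x = \<zero>\<^bsub>T\<^esub>} (add_monoid T)"
    by (rule T.M.add.subgroupI)
      (use zero minus add in \<open>auto simp: a_inv_def[symmetric] intro: exI[of _ "\<zero>\<^bsub>T\<^esub>"]\<close>)
  then have "CK \<subseteq> {x \<in> carrier T. rep.avg x = \<zero>\<^bsub>T\<^esub>}"
    by (rule CK_minimal) (use closed add minus in \<open>auto simp: a_minus_def st_closed avg_st T.M.r_neg\<close>)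
  then show "x \<in> CK \<Longrightarrow> rep.avg x = \<zero>\<^bsub>T\<^esub>" by blast
qed

lemma finsum_submodule:
  assumes K: "submodule K S T" and "finite A" "\<And>i. i \<in> A \<Longrightarrow> u i \<in> K"
  shows "(\<Oplus>\<^bsub>T\<^esub>i\<in>A. u i) \<in> K"
  using assms(2,3)
proof (induction rule: finite_induct)
  case empty
  then show ?case using T.submodule_zero[OF K] by simp
next
  case (insert i A)
  have "u i \<in> K" "(\<Oplus>\<^bsub>T\<^esub>i\<in>A. u i) \<in> K" using insert by auto
  then have "u i \<oplus>\<^bsub>T\<^esub> (\<Oplus>\<^bsub>T\<^esub>i\<in>A. u i) \<in> K" by (rule T.submodule_add[OF K])
  moreover have "u \<in> A \<rightarrow> carrier T" "u i \<in> carrier T"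
    using insert T.submodule_subset[OF K] by auto
  ultimately show ?case using insert by (simp add: T.M.finsum_insert)
qed

lemma kernel_subset_CK:
  assumes K: "submodule K S T" and gK: "\<And>g x. \<lbrakk>g \<in> carrier G; x \<in> K\<rbrakk> \<Longrightarrow> \<gamma> g x \<in> K"
    and stable: "\<And>h x. \<lbrakk>h \<in> H; x \<in> carrier T\<rbrakk> \<Longrightarrow> st h x \<ominus>\<^bsub>T\<^esub> x \<in> K"
    and nontrivial: "\<exists>h\<in>H. \<exists>x\<in>carrier T. st h x \<noteq> x"
    and orbits: "card (orbits G (Irr L Q) (irr_action L G H H')) = 2"
    and length: "module_length S (T\<lparr>carrier := K\<rparr>) \<le> enat (card (Irr L Q) - 1)"
  shows "K \<subseteq> CK"
proof (rule ccontr)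
  assume "\<not> K \<subseteq> CK"
  then obtain x where x: "x \<in> K" "x \<notin> CK" by blast
  note KT = T.submodule_subset[OF K, THEN subsetD]
  have xT: "x \<in> carrier T" using KT x by blast
  then have xX: "x \<in> carrier X" by simp
  note KR = submodule_restrict[OF K stable]
  note CKR = submodule_restrict[OF CK_submodule diff_in_CK]
  have CK_K: "CK \<subseteq> K"
    using K stable by (intro CK_minimal) (auto simp: submodule_def)
  \<comment> \<open>Sums depend only on the additive structure, which restriction of scalars leaves
    unchanged.\<close>
  have fin: "finsum X u A = finsum T u A" for u :: "'g set \<Rightarrow> 'x" and A
    by (simp add: finsum_def finprod_def restrict_scalars_def)
  have "rep.avg x \<in> K"
    unfolding rep.avg_def fin
    by (rule finsum_submodule[OF K finite_index]) (rule rep.submodule_XR_D(2)[unfolded LQ, OF KR(2) _ x(1)])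
  moreover have "rep.avg x \<noteq> \<zero>\<^bsub>T\<^esub>"
  proof
    assume avg0: "rep.avg x = \<zero>\<^bsub>T\<^esub>"
    let ?n = "[card (carrier Q)] \<cdot>\<^bsub>X\<^esub> x"
    \<comment> \<open>\<open>d\<close> is the average minus the order of the group times
      \<open>x\<close>, written as a sum of differences. If the average vanishes, that multiple of
      \<open>x\<close> is minus \<open>d\<close> and lies in \<open>CK\<close>, hence so does
      \<open>x\<close>.\<close>
    define d where "d = (\<Oplus>\<^bsub>T\<^esub>q\<in>carrier Q. rho q x \<ominus>\<^bsub>T\<^esub> x)"
    have d: "d \<in> CK"
      unfolding d_def
      by (rule finsum_submodule[OF CK_submodule finite_index])
        (use xT in \<open>auto simp: carrier_Q rho_coset diff_in_CK\<close>)
    then have dT: "d \<in> carrier T" using CK_closed(1) by blast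
    have nT: "?n \<in> carrier T"
      using X.M.add.nat_pow_closed[of x] xT by (simp add: add_pow_def)
    have "(\<Oplus>\<^bsub>T\<^esub>q\<in>carrier Q. x) = ?n"
      using xT X.M.add.finprod_const[of x "carrier Q"] unfolding fin[symmetric]
      by (simp add: add_pow_def finsum_def)
    moreover have "rep.avg x = d \<oplus>\<^bsub>T\<^esub> (\<Oplus>\<^bsub>T\<^esub>q\<in>carrier Q. x)"
      unfolding rep.avg_def fin d_def
      by (rule T.M.finsum_add_eq)
        (use xT rep.rho_closed in \<open>auto simp: a_minus_def T.M.a_assoc T.M.l_neg\<close>)
    ultimately have "?n \<oplus>\<^bsub>T\<^esub> d = \<zero>\<^bsub>T\<^esub>" using avg0 T.M.a_comm[OF nT dT] by simp
    then have "\<ominus>\<^bsub>T\<^esub> d = ?n" by (rule T.M.minus_equality[OF _ dT nT])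
    then have "?n \<in> CK" using CK_closed(4)[OF d] by simp
    with xX have "x \<in> CK" by (rule rep.card_smult_zero[OF _ _ CKR(1)])
    with x show False by simp
  qed
  ultimately have avg: "rep.avg x \<in> K" "rep.avg x \<noteq> \<zero>\<^bsub>X\<^esub>" by simp_all
  have inv: "rho q (rep.avg x) = rep.avg x" if "q \<in> carrier Q" for q
    using rep.rho_avg[OF that] xT by simp
  obtain V0 :: "('g set \<Rightarrow> 'l, ('g set \<Rightarrow> 'l) set) module" where
    V0: "simple_module LQ V0" "rep.trivial_module V0" "rep.occurs K V0"
    using rep.trivial_occurs[unfolded LQ, OF KR(2) avg inv] .
  obtain h z where hz: "h \<in> H" "z \<in> carrier T" "st h z \<noteq> z" using nontrivial by blast
  then have "st h z \<ominus>\<^bsub>T\<^esub> z \<noteq> \<zero>\<^bsub>T\<^esub>" by (simp add: T.M.diff_eq_zero_iff st_closed)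
  then have z: "st h z \<ominus>\<^bsub>T\<^esub> z \<noteq> \<zero>\<^bsub>X\<^esub>" by simp
  have avg0: "rep.avg y = \<zero>\<^bsub>X\<^esub>" if "y \<in> CK" for y using avg_CK[OF that] by simp
  obtain V1 :: "('g set \<Rightarrow> 'l, ('g set \<Rightarrow> 'l) set) module" where
    V1: "simple_module LQ V1" "\<not> rep.trivial_module V1" "rep.occurs CK V1"
    using rep.nontrivial_occurs[unfolded LQ, OF CKR(2) diff_in_CK[OF hz(1,2)] z avg0] .
  have "rep.occurs K V1" using V1(3) CK_K unfolding rep.occurs_def by blast
  then have "rep.occurs K V" if "C \<in> Irr L Q" "V \<in> C" for C V
    using all_occur[OF orbits _ gK V0 V1(1,2) _ that] KT by blast
  moreover have "Irr L Q \<noteq> {}" using Irr_class[OF V0(1)] by blast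
  ultimately show False
    using length_ge_card_Irr[OF K KR(2)] length by blast
qed

end


section \<open>The secret action\<close>

locale secret_setting = skew_change G S act H \<beta> S' act' H' \<beta>' f +
    SA: assoc_algebra L S + M': left_module "skew_quot G S' act' H' \<beta>'" M' +
    M: left_module "skew_quot G S act H \<beta>" M
  for G :: "'g monoid" and L :: "'l ring" and S :: "('l, 's) module" and act :: "'g \<Rightarrow> 's \<Rightarrow> 's"
    and H :: "'g set" and \<beta> :: "'g \<Rightarrow> 's"
    and S' :: "('l, 't) module" and act' :: "'g \<Rightarrow> 't \<Rightarrow> 't" and H' :: "'g set" and \<beta>' :: "'g \<Rightarrow> 't"
    and f :: "'t \<Rightarrow> 's"
    and M' :: "(('g \<Rightarrow> 't) set, 'm) module" and M :: "(('g \<Rightarrow> 's) set, 'n) module" +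
  fixes \<tau> :: "'m \<Rightarrow> 'n"
  assumes field_L: "field L" and char_0: "n > 0 \<Longrightarrow> [(n::nat)] \<cdot>\<^bsub>L\<^esub> \<one>\<^bsub>L\<^esub> \<noteq> \<zero>\<^bsub>L\<^esub>"
    and act_L: "\<lbrakk>g \<in> carrier G; a \<in> carrier L; s \<in> carrier S\<rbrakk> \<Longrightarrow> act g (a \<odot>\<^bsub>S\<^esub> s) = a \<odot>\<^bsub>S\<^esub> act g s"
    and finite_index: "finite (carrier (subquot G H H'))"
    and tau: "\<tau> \<in> lin_hom (skew_quot G S' act' H' \<beta>') M' (restrict_scalars (skew_map G S act H \<beta> f) M)"
begin

abbreviation "N' \<equiv> restrict_scalars S'.coef M'"
abbreviation "MS \<equiv> restrict_scalars S.coef M"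

sublocale N': left_module S' N'
  by (rule M'.restrict_scalars_left_module[OF S'.S.ring_axioms S'.coef_hom])

sublocale MS: left_module S MS
  by (rule M.restrict_scalars_left_module[OF S.S.ring_axioms S.coef_hom])

sublocale E: scalar_extension S S' N' f
  by unfold_locales (rule f)

abbreviation "star \<equiv> secret_action G S S' f act' H' \<beta> \<beta>' M'"
abbreviation "\<Phi> \<equiv> base_change_lift MS \<tau>"
abbreviation "CK \<equiv> coinv_kernel star H E.T"

text \<open>The diagonal action of \<open>G\<close> on the tensor product. It does not appear in the
  statement; it is the symmetry that moves a simple submodule of the kernel to its twists.\<close>

definition gact :: "'g \<Rightarrow> ('s \<times> 'm \<Rightarrow>\<^sub>0 int) set \<Rightarrow> ('s \<times> 'm \<Rightarrow>\<^sub>0 int) set"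
  where "gact g = tensor_endo S S' f N' (\<lambda>(s, m). (act g s, S'.grp g \<odot>\<^bsub>M'\<^esub> m))"

lemma grp_M'_closed [simp]: "\<lbrakk>g \<in> carrier G; m \<in> carrier M'\<rbrakk> \<Longrightarrow> S'.grp g \<odot>\<^bsub>M'\<^esub> m \<in> carrier M'"
  by (simp add: M'.smult_closed)

lemma grp_coef_M':
  assumes "g \<in> carrier G" "r \<in> carrier S'" "m \<in> carrier M'"
  shows "S'.grp g \<odot>\<^bsub>M'\<^esub> (S'.coef r \<odot>\<^bsub>M'\<^esub> m) = S'.coef (act' g r) \<odot>\<^bsub>M'\<^esub> (S'.grp g \<odot>\<^bsub>M'\<^esub> m)"
  using assms by (simp add: M'.smult_assoc1[symmetric] S'.grp_coef)

lemma grp_mult_M':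
  assumes "g \<in> carrier G" "h \<in> carrier G" "m \<in> carrier M'"
  shows "S'.grp (g \<otimes>\<^bsub>G\<^esub> h) \<odot>\<^bsub>M'\<^esub> m = S'.grp g \<odot>\<^bsub>M'\<^esub> (S'.grp h \<odot>\<^bsub>M'\<^esub> m)"
  using assms by (simp add: M'.smult_assoc1 S'.grp_mult)

lemma tensor_coef:
  assumes "s \<in> carrier S" "r \<in> carrier S'" "m \<in> carrier M'"
  shows "E.tensor s (S'.coef r \<odot>\<^bsub>M'\<^esub> m) = E.tensor (s \<otimes>\<^bsub>S\<^esub> f r) m"
  using E.tensor_balanced[of s r m] assms by simp

lemma tensor_add_M':
  assumes "s \<in> carrier S" "m \<in> carrier M'" "n \<in> carrier M'"
  shows "E.tensor s (m \<oplus>\<^bsub>M'\<^esub> n) = E.tensor s m \<oplus>\<^bsub>E.T\<^esub> E.tensor s n"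
  using E.tensor_add_r[of s m n] assms by simp

text \<open>Since \<open>h\<close> acts semilinearly on \<open>M'\<close>, moving \<open>r\<close>
  out of \<open>h (r m)\<close> produces \<open>f (act' h r)\<close> to the right of the inverse of
  \<open>\<beta> h\<close>. By \<open>inv_beta_act\<close> it becomes \<open>f r\<close> on the left
  of that inverse, as the relation demands.\<close>

lemma balanced_star: "h \<in> H \<Longrightarrow> E.balanced_map (\<lambda>(s, m). (s \<otimes>\<^bsub>S\<^esub> inv\<^bsub>S\<^esub> (\<beta> h), S'.grp h \<odot>\<^bsub>M'\<^esub> m))"
  by (auto simp: E.balanced_map_def S.S.l_distr E.tensor_add_l tensor_add_M' M'.smult_r_distr
      grp_coef_M' tensor_coef f_act S.S.m_assoc S.inv_beta_act)

lemma balanced_gact: "g \<in> carrier G \<Longrightarrow> E.balanced_map (\<lambda>(s, m). (act g s, S'.grp g \<odot>\<^bsub>M'\<^esub> m))"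
  by (auto simp: E.balanced_map_def S.act_add S.act_times E.tensor_add_l tensor_add_M' M'.smult_r_distr
      grp_coef_M' tensor_coef f_act)

lemma star_hom: "h \<in> H \<Longrightarrow> star h \<in> hom (add_monoid E.T) (add_monoid E.T)"
  unfolding secret_action_def by (rule E.tensor_endo_hom[OF balanced_star])

lemma star_tensor: "\<lbrakk>h \<in> H; s \<in> carrier S; m \<in> carrier M'\<rbrakk> \<Longrightarrow>
    star h (E.tensor s m) = E.tensor (s \<otimes>\<^bsub>S\<^esub> inv\<^bsub>S\<^esub> (\<beta> h)) (S'.grp h \<odot>\<^bsub>M'\<^esub> m)"
  unfolding secret_action_def by (simp add: E.tensor_endo_tensor[OF balanced_star])

lemma gact_hom: "g \<in> carrier G \<Longrightarrow> gact g \<in> hom (add_monoid E.T) (add_monoid E.T)"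
  unfolding gact_def by (rule E.tensor_endo_hom[OF balanced_gact])

lemma gact_tensor: "\<lbrakk>g \<in> carrier G; s \<in> carrier S; m \<in> carrier M'\<rbrakk> \<Longrightarrow>
    gact g (E.tensor s m) = E.tensor (act g s) (S'.grp g \<odot>\<^bsub>M'\<^esub> m)"
  unfolding gact_def by (simp add: E.tensor_endo_tensor[OF balanced_gact])

lemma tau_lin: "\<tau> \<in> lin_hom S' N' (restrict_scalars f MS)"
  by (rule lin_homI) (use lin_homD[OF tau] in \<open>simp_all add: skew_map_coef\<close>)

lemma tau_closed [simp]: "m \<in> carrier M' \<Longrightarrow> \<tau> m \<in> carrier M"
  using lin_homD(1)[OF tau] by simp

lemma tau_grp: "\<lbrakk>g \<in> carrier G; m \<in> carrier M'\<rbrakk> \<Longrightarrow> \<tau> (S'.grp g \<odot>\<^bsub>M'\<^esub> m) = S.grp g \<odot>\<^bsub>M\<^esub> \<tau> m"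
  using lin_homD(3)[OF tau, of "S'.grp g" m] by (simp add: skew_map_grp)

lemma Phi_hom: "\<Phi> \<in> hom (add_monoid E.T) (add_monoid MS)"
  by (rule E.base_change_lift_hom[OF MS.left_module_axioms tau_lin])

lemma Phi_tensor: "\<lbrakk>s \<in> carrier S; m \<in> carrier M'\<rbrakk> \<Longrightarrow> \<Phi> (E.tensor s m) = S.coef s \<odot>\<^bsub>M\<^esub> \<tau> m"
  using E.base_change_lift_tensor[OF MS.left_module_axioms tau_lin, of s m] by simp

lemma Phi_smult: "\<lbrakk>s \<in> carrier S; x \<in> carrier E.T\<rbrakk> \<Longrightarrow> \<Phi> (s \<odot>\<^bsub>E.T\<^esub> x) = s \<odot>\<^bsub>MS\<^esub> \<Phi> x"
  by (rule E.base_change_lift_smult[OF MS.left_module_axioms tau_lin])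

lemma Phi_star:
  assumes h: "h \<in> H" and x: "x \<in> carrier E.T"
  shows "\<Phi> (star h x) = \<Phi> x"
proof (rule E.tensor_ext[OF MS.M.abelian_group_axioms E.hom_T_comp[OF star_hom[OF h] Phi_hom] Phi_hom _ x])
  fix s m assume sm: "s \<in> carrier S" "m \<in> carrier N'"
  have "S.coef (s \<otimes>\<^bsub>S\<^esub> inv\<^bsub>S\<^esub> (\<beta> h)) \<odot>\<^bsub>M\<^esub> (S.coef (\<beta> h) \<odot>\<^bsub>M\<^esub> \<tau> m)
      = S.coef (s \<otimes>\<^bsub>S\<^esub> inv\<^bsub>S\<^esub> (\<beta> h) \<otimes>\<^bsub>S\<^esub> \<beta> h) \<odot>\<^bsub>M\<^esub> \<tau> m"
    using sm h by (simp add: M.smult_assoc1[symmetric] ring_hom_mult[OF S.coef_hom, symmetric])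
  also have "s \<otimes>\<^bsub>S\<^esub> inv\<^bsub>S\<^esub> (\<beta> h) \<otimes>\<^bsub>S\<^esub> \<beta> h = s"
    using sm h by (simp add: S.S.m_assoc S.beta_Units)
  finally show "\<Phi> (star h (E.tensor s m)) = \<Phi> (E.tensor s m)"
    using sm h by (simp add: star_tensor Phi_tensor tau_grp S.grp_eq_coef_beta)
qed

text \<open>This keeps the kernel of \<open>\<Phi>\<close> stable under \<open>G\<close>;
  \<open>\<tau>\<close> commutes with group elements because the ring map induced by
  \<open>f\<close> fixes their classes.\<close>

lemma Phi_gact:
  assumes g: "g \<in> carrier G" and x: "x \<in> carrier E.T"
  shows "\<Phi> (gact g x) = S.grp g \<odot>\<^bsub>M\<^esub> \<Phi> x"
proof (rule E.tensor_ext[OF MS.M.abelian_group_axioms E.hom_T_comp[OF gact_hom[OF g] Phi_hom] _ _ x])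
  show "(\<lambda>x. S.grp g \<odot>\<^bsub>M\<^esub> \<Phi> x) \<in> hom (add_monoid E.T) (add_monoid MS)"
    using Phi_hom g by (auto simp: hom_def Pi_iff M.smult_closed M.smult_r_distr)
  fix s m assume "s \<in> carrier S" "m \<in> carrier N'"
  then show "\<Phi> (gact g (E.tensor s m)) = S.grp g \<odot>\<^bsub>M\<^esub> \<Phi> (E.tensor s m)"
    using g by (simp add: gact_tensor Phi_tensor tau_grp M.smult_assoc1[symmetric] S.grp_coef)
qed

definition iota :: "'l \<Rightarrow> 's" where "iota a = a \<odot>\<^bsub>S\<^esub> \<one>\<^bsub>S\<^esub>"

lemma iota_hom: "iota \<in> ring_hom L S"
  by (rule ring_hom_memI)
    (simp_all add: iota_def SA.smult_l_distr SA.smult_assoc1 SA.smult_mult_left)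

lemma iota_closed [simp]: "a \<in> carrier L \<Longrightarrow> iota a \<in> carrier S"
  by (simp add: iota_def)

lemma iota_mult: "\<lbrakk>a \<in> carrier L; s \<in> carrier S\<rbrakk> \<Longrightarrow> iota a \<otimes>\<^bsub>S\<^esub> s = a \<odot>\<^bsub>S\<^esub> s"
  by (simp add: iota_def SA.smult_mult_left)

lemma star_closed: "\<lbrakk>h \<in> H; x \<in> carrier E.T\<rbrakk> \<Longrightarrow> star h x \<in> carrier E.T"
  using star_hom by (auto simp: hom_def)

lemma gact_closed: "\<lbrakk>g \<in> carrier G; x \<in> carrier E.T\<rbrakk> \<Longrightarrow> gact g x \<in> carrier E.T"
  using gact_hom by (auto simp: hom_def)

lemmas T_ext = E.tensor_ext[OF E.T.abelian_group_axioms]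

lemma H_closed: "\<lbrakk>h \<in> H; k \<in> H\<rbrakk> \<Longrightarrow> h \<otimes>\<^bsub>G\<^esub> k \<in> H"
  using normal_imp_subgroup[OF S.N] by (rule subgroup.m_closed)

lemma H_conj: "\<lbrakk>g \<in> carrier G; h \<in> H\<rbrakk> \<Longrightarrow> g \<otimes>\<^bsub>G\<^esub> h \<otimes>\<^bsub>G\<^esub> inv\<^bsub>G\<^esub> g \<in> H"
  using normal.inv_op_closed2[OF S.N] .

lemma star_smult:
  assumes "h \<in> H" "s \<in> carrier S" "x \<in> carrier E.T"
  shows "star h (s \<odot>\<^bsub>E.T\<^esub> x) = s \<odot>\<^bsub>E.T\<^esub> star h x"
  by (rule T_ext[OF E.hom_T_comp[OF E.smult_hom star_hom] E.hom_T_comp[OF star_hom E.smult_hom] _ assms(3)])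
    (use assms in \<open>auto simp: E.smult_tensor star_tensor S.S.m_assoc\<close>)

text \<open>Inverting values of \<open>\<beta>\<close> reverses products, and so does multiplying
  from the right; together they give a left action.\<close>

lemma star_mult:
  assumes "h \<in> H" "k \<in> H" "x \<in> carrier E.T"
  shows "star (h \<otimes>\<^bsub>G\<^esub> k) x = star h (star k x)"
  by (rule T_ext[OF star_hom E.hom_T_comp[OF star_hom star_hom] _ assms(3)])
    (use assms in \<open>auto simp: H_closed star_tensor S.inv_beta_mult S.S.m_assoc grp_mult_M'\<close>)

text \<open>On \<open>M'\<close> such an \<open>h\<close> acts as \<open>\<beta>' h\<close>. This
  scalar crosses the tensor sign as \<open>f (\<beta>' h)\<close>, that is \<open>\<beta> h\<close>,
  and cancels the inverse already there. So the secret action factors through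
  \<open>H/H'\<close>.\<close>

lemma star_trivial:
  assumes "h \<in> H'" "x \<in> carrier E.T"
  shows "star h x = x"
proof (rule T_ext[OF star_hom E.id_hom_T _ assms(2)])
  show h: "h \<in> H" using assms N'_N by blast
  fix s m assume "s \<in> carrier S" "m \<in> carrier N'"
  then show "star h (E.tensor s m) = E.tensor s m"
    using assms h by (simp add: star_tensor S'.grp_eq_coef_beta tensor_coef f_beta S.S.m_assoc S.beta_Units)
qed

text \<open>\<open>gact g\<close> is semilinear over \<open>S\<close>; on the image of
  \<open>L\<close>, which \<open>G\<close> fixes, this becomes linearity.\<close>

lemma gact_iota:
  assumes "g \<in> carrier G" "a \<in> carrier L" "x \<in> carrier E.T"
  shows "gact g (iota a \<odot>\<^bsub>E.T\<^esub> x) = iota a \<odot>\<^bsub>E.T\<^esub> gact g x"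
  by (rule T_ext[OF E.hom_T_comp[OF E.smult_hom gact_hom] E.hom_T_comp[OF gact_hom E.smult_hom] _ assms(3)])
    (use assms in \<open>auto simp: E.smult_tensor gact_tensor iota_mult act_L\<close>)

lemma gact_inv:
  assumes "g \<in> carrier G" "x \<in> carrier E.T"
  shows "gact (inv\<^bsub>G\<^esub> g) (gact g x) = x"
  by (rule T_ext[OF E.hom_T_comp[OF gact_hom gact_hom] E.id_hom_T _ assms(2)])
    (use assms in \<open>auto simp: gact_tensor S.act_mult[symmetric] S.act_1 grp_mult_M'[symmetric] S'.grp_one M'.smult_one\<close>)

text \<open>In the factor \<open>S\<close>, equivariance turns the inverse of
  \<open>\<beta> h\<close> into that of \<open>\<beta>\<close> at the conjugate; in the factor
  \<open>M'\<close>, the conjugate times \<open>g\<close> is \<open>g\<close> times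
  \<open>h\<close>.\<close>

lemma gact_star:
  assumes "g \<in> carrier G" "h \<in> H" "x \<in> carrier E.T"
  shows "gact g (star h x) = star (g \<otimes>\<^bsub>G\<^esub> h \<otimes>\<^bsub>G\<^esub> inv\<^bsub>G\<^esub> g) (gact g x)"
proof (rule T_ext[OF E.hom_T_comp[OF star_hom gact_hom] E.hom_T_comp[OF gact_hom star_hom] _ assms(3)])
  fix s m assume "s \<in> carrier S" "m \<in> carrier N'"
  moreover have "g \<otimes>\<^bsub>G\<^esub> h \<otimes>\<^bsub>G\<^esub> inv\<^bsub>G\<^esub> g \<otimes>\<^bsub>G\<^esub> g = g \<otimes>\<^bsub>G\<^esub> h"
    using assms by (simp add: S.G.m_assoc)
  ultimately show "gact g (star h (E.tensor s m))
      = star (g \<otimes>\<^bsub>G\<^esub> h \<otimes>\<^bsub>G\<^esub> inv\<^bsub>G\<^esub> g) (gact g (E.tensor s m))"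
    using assms by (simp add: star_tensor gact_tensor H_conj S.act_times S.act_inv_beta grp_mult_M'[symmetric])
qed (use assms H_conj in auto)

lemma iota_central: "\<lbrakk>a \<in> carrier L; s \<in> carrier S\<rbrakk> \<Longrightarrow> iota a \<otimes>\<^bsub>S\<^esub> s = s \<otimes>\<^bsub>S\<^esub> iota a"
  using SA.smult_mult_right[of a s "\<one>\<^bsub>S\<^esub>"] by (simp add: iota_mult) (simp add: iota_def)

lemma star_add: "\<lbrakk>h \<in> H; x \<in> carrier E.T; y \<in> carrier E.T\<rbrakk> \<Longrightarrow>
    star h (x \<oplus>\<^bsub>E.T\<^esub> y) = star h x \<oplus>\<^bsub>E.T\<^esub> star h y"
  using star_hom by (auto simp: hom_def)

lemma gact_add: "\<lbrakk>g \<in> carrier G; x \<in> carrier E.T; y \<in> carrier E.T\<rbrakk> \<Longrightarrow>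
    gact g (x \<oplus>\<^bsub>E.T\<^esub> y) = gact g x \<oplus>\<^bsub>E.T\<^esub> gact g y"
  using gact_hom by (auto simp: hom_def)

lemma gact_zeroD:
  assumes "g \<in> carrier G" "x \<in> carrier E.T" "gact g x = \<zero>\<^bsub>E.T\<^esub>"
  shows "x = \<zero>\<^bsub>E.T\<^esub>"
proof -
  have "gact (inv\<^bsub>G\<^esub> g) \<zero>\<^bsub>E.T\<^esub> = \<zero>\<^bsub>E.T\<^esub>"
    using hom_one[OF gact_hom E.T.add.is_group E.T.add.is_group, of "inv\<^bsub>G\<^esub> g"] assms(1) by simp
  then show ?thesis using gact_inv[OF assms(1,2)] assms(3) by simp
qed

sublocale SR: semilinear_rep L G S E.T iota H H' star gact
proof -
  interpret L: field L by (rule field_L)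
  show "semilinear_rep L G S E.T iota H H' star gact"
  proof (rule semilinear_rep.intro[OF L.field_axioms S.G.group_axioms E.T.left_module_axioms
        semilinear_rep_axioms.intro])
  qed (fact char_0 S.N S'.N N'_N finite_index iota_hom iota_central star_closed star_add star_smult star_mult
      star_trivial gact_closed gact_add gact_iota gact_zeroD gact_star)+
qed

section \<open>The kernel of \<open>\<Phi>\<close> and the induced map on coinvariants\<close>

lemma kernel_eq: "a_kernel E.T MS \<Phi> = {x \<in> carrier E.T. \<Phi> x = \<zero>\<^bsub>M\<^esub>}"
  by (simp add: a_kernel_def kernel_def)

lemma Phi_closed: "x \<in> carrier E.T \<Longrightarrow> \<Phi> x \<in> carrier M"
  using Phi_hom by (auto simp: hom_def)

lemma Phi_add: "\<lbrakk>x \<in> carrier E.T; y \<in> carrier E.T\<rbrakk> \<Longrightarrow> \<Phi> (x \<oplus>\<^bsub>E.T\<^esub> y) = \<Phi> x \<oplus>\<^bsub>M\<^esub> \<Phi> y"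
  using Phi_hom by (auto simp: hom_def)

lemma Phi_zero: "\<Phi> \<zero>\<^bsub>E.T\<^esub> = \<zero>\<^bsub>M\<^esub>"
  by (rule M.M.idem_zero) (simp_all add: Phi_closed Phi_add[symmetric])

lemma Phi_diff:
  assumes "x \<in> carrier E.T" "y \<in> carrier E.T"
  shows "\<Phi> (x \<ominus>\<^bsub>E.T\<^esub> y) = \<Phi> x \<ominus>\<^bsub>M\<^esub> \<Phi> y"
  by (rule M.M.add_eq_diffI)
    (use assms in \<open>simp_all add: Phi_closed Phi_add[symmetric] a_minus_def E.T.a_assoc E.T.l_neg\<close>)

lemma kernel_submodule: "submodule (a_kernel E.T MS \<Phi>) S E.T"
  by (rule E.T.submodule_leftI)
    (auto simp: kernel_eq Phi_zero Phi_add Phi_smult E.T.smult_closed)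

lemma diff_in_kernel: "\<lbrakk>h \<in> H; x \<in> carrier E.T\<rbrakk> \<Longrightarrow> star h x \<ominus>\<^bsub>E.T\<^esub> x \<in> a_kernel E.T MS \<Phi>"
  by (simp add: kernel_eq Phi_diff Phi_star star_closed Phi_closed M.M.diff_eq_zero_iff)

lemma kernel_eq_CK:
  assumes "\<exists>h\<in>H. \<exists>x\<in>carrier E.T. star h x \<noteq> x"
    and "card (orbits G (Irr L (subquot G H H')) (irr_action L G H H')) = 2"
    and "module_length S (E.T\<lparr>carrier := a_kernel E.T MS \<Phi>\<rparr>) \<le> enat (card (Irr L (subquot G H H')) - 1)"
  shows "a_kernel E.T MS \<Phi> = CK"
proof
  show "a_kernel E.T MS \<Phi> \<subseteq> CK"
    by (rule SR.kernel_subset_CK[OF kernel_submodule _ diff_in_kernel assms])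
      (auto simp: kernel_eq gact_closed Phi_gact)
  show "CK \<subseteq> a_kernel E.T MS \<Phi>"
    using kernel_submodule diff_in_kernel by (intro SR.CK_minimal) (auto simp: submodule_def)
qed

text \<open>With \<open>CK\<close> equal to the kernel, its cosets are the fibres of
  \<open>\<Phi>\<close>. Constancy on them gives the induced map, and different fibres having
  different values gives injectivity.\<close>

lemma factor_through_coinvariants:
  assumes ker: "a_kernel E.T MS \<Phi> = CK"
  shows "\<exists>\<Psi>\<in>lin_hom S (coinvariants star H E.T) MS.
    (\<forall>x\<in>carrier E.T. \<Psi> (CK +>\<^bsub>E.T\<^esub> x) = \<Phi> x) \<and> inj_on \<Psi> (carrier (coinvariants star H E.T))"
proof -
  interpret CK: abelian_subgroup CK E.T
    by (rule abelian_subgroupI3[OF _ E.T.abelian_group_axioms]) (simp add: additive_subgroup_def SR.CK_subgroup)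
  let ?c = "\<lambda>x. CK +>\<^bsub>E.T\<^esub> x"
  have coset_eqI: "?c x = ?c y" if "x \<in> carrier E.T" "y \<in> carrier E.T" "\<Phi> x = \<Phi> y" for x y
  proof -
    have "y \<ominus>\<^bsub>E.T\<^esub> x \<in> CK"
      using that unfolding ker[symmetric] kernel_eq
      by (simp add: Phi_diff M.M.diff_eq_zero_iff Phi_closed)
    then have "y \<in> ?c x"
      using CK.a_rcos_module[OF that(1,2)] by (simp add: a_minus_def)
    then show ?thesis by (rule CK.a_repr_independence'[OF _ that(1)])
  qed
  have in_coset: "y \<in> carrier E.T" "\<Phi> y = \<Phi> x" if x: "x \<in> carrier E.T" and y: "y \<in> ?c x" for x y
  proof -
    obtain k where k: "k \<in> CK" "y = k \<oplus>\<^bsub>E.T\<^esub> x" using y by (auto simp: a_r_coset_def')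
    have kT: "k \<in> carrier E.T" "\<Phi> k = \<zero>\<^bsub>M\<^esub>" using k(1) unfolding ker[symmetric] kernel_eq by auto
    show "y \<in> carrier E.T" using k kT x by simp
    show "\<Phi> y = \<Phi> x" using k kT x by (simp add: Phi_add Phi_closed)
  qed
  have self: "x \<in> ?c x" if "x \<in> carrier E.T" for x using CK.a_rcos_self[OF that] .
  \<comment> \<open>Whatever depends only on the value of \<open>\<Phi>\<close> can be evaluated at
    a representative. This serves for \<open>\<Phi>\<close> itself and for the scalar multiplication
    of the quotient, also defined through \<open>on_cosets\<close>.\<close>
  have on: "on_cosets u (?c x) = u x"
    if x: "x \<in> carrier E.T" and eq: "\<And>y. \<lbrakk>y \<in> carrier E.T; \<Phi> y = \<Phi> x\<rbrakk> \<Longrightarrow> u y = u x"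
    for x and u :: "_ \<Rightarrow> 'z"
  proof (rule on_cosets_const)
    show "?c x \<noteq> {}" using self[OF x] by blast
    show "u y = u x" if "y \<in> ?c x" for y
      by (rule eq; rule in_coset[OF x that])
  qed
  have Psi: "on_cosets \<Phi> (?c x) = \<Phi> x" if "x \<in> carrier E.T" for x
    using on[of x \<Phi>] that by simp
  let ?Q = "coinvariants star H E.T"
  have carrier: "carrier ?Q = ?c ` carrier E.T"
    by (auto simp: coinvariants_def quot_module_def A_RCOSETS_def')
  have add: "?c x \<oplus>\<^bsub>?Q\<^esub> ?c y = ?c (x \<oplus>\<^bsub>E.T\<^esub> y)" if "x \<in> carrier E.T" "y \<in> carrier E.T" for x y
    using CK.a_rcos_sum[OF that] by (simp add: coinvariants_def quot_module_def)
  have smult: "a \<odot>\<^bsub>?Q\<^esub> ?c x = ?c (a \<odot>\<^bsub>E.T\<^esub> x)" if "a \<in> carrier S" "x \<in> carrier E.T" for a x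
    unfolding coinvariants_def quot_module_def module.simps
    by (rule on[OF that(2)], rule coset_eqI) (use that in \<open>simp_all add: E.T.smult_closed Phi_smult\<close>)
  show ?thesis
  proof (intro bexI conjI ballI)
    show "on_cosets \<Phi> \<in> lin_hom S ?Q MS"
      by (rule lin_homI)
        (auto simp: carrier Psi Phi_closed add smult Phi_add Phi_smult E.T.smult_closed)
    show "inj_on (on_cosets \<Phi>) (carrier ?Q)"
    proof (rule inj_onI)
      fix A B assume "A \<in> carrier ?Q" "B \<in> carrier ?Q" and eq: "on_cosets \<Phi> A = on_cosets \<Phi> B"
      then obtain x y where xy: "x \<in> carrier E.T" "y \<in> carrier E.T" "A = ?c x" "B = ?c y"
        unfolding carrier by blast
      with eq have "\<Phi> x = \<Phi> y" by (simp add: Psi)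
      with xy show "A = B" using coset_eqI by blast
    qed
  qed (rule Psi)
qed

end


section \<open>Actions by algebra automorphisms and the stated setting\<close>

lemma skew_actionI:
  assumes "group G" "assoc_algebra L S" "group_action G (carrier S) act"
    and act: "\<And>g. g \<in> carrier G \<Longrightarrow> act g \<in> alg_hom L S S"
  shows "skew_action G S act"
proof -
  interpret G: group G by fact
  interpret S: assoc_algebra L S by fact
  interpret act: group_action G "carrier S" act by fact
  show ?thesis
  proof unfold_locales
    show "act g \<in> ring_hom S S" if "g \<in> carrier G" for g
      using act[OF that] by (simp add: alg_hom_def)
    show "act \<one>\<^bsub>G\<^esub> x = x" if "x \<in> carrier S" for x
      using fun_cong[OF act.id_eq_one, of x] that by simp
    show "act (g \<otimes>\<^bsub>G\<^esub> h) x = act g (act h x)"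
      if "g \<in> carrier G" "h \<in> carrier G" "x \<in> carrier S" for g h x
      using act.composition_rule[OF that(3,1,2)] .
  qed
qed

theorem theorem5p1p11:
  fixes L :: "'l ring" and G :: "'g monoid"
    and S :: "('l, 's) module" and act :: "'g \<Rightarrow> 's \<Rightarrow> 's"
    and S' :: "('l, 't) module" and act' :: "'g \<Rightarrow> 't \<Rightarrow> 't"
    and f :: "'t \<Rightarrow> 's" and H H' :: "'g set"
    and \<beta> :: "'g \<Rightarrow> 's" and \<beta>' :: "'g \<Rightarrow> 't"
    and M' :: "(('g \<Rightarrow> 't) set, 'm) module" and M :: "(('g \<Rightarrow> 's) set, 'n) module"
    and \<tau> :: "'m \<Rightarrow> 'n"
  defines "M_S \<equiv> restrict_scalars (skew_coeff G S act H \<beta>) M"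
    and "T \<equiv> base_change S S' f (restrict_scalars (skew_coeff G S' act' H' \<beta>') M')"
    and "star \<equiv> secret_action G S S' f act' H' \<beta> \<beta>' M'"
    and "\<Phi> \<equiv> base_change_lift (restrict_scalars (skew_coeff G S act H \<beta>) M) \<tau>"
    and "I \<equiv> Irr L (subquot G H H')"
  assumes L: "field L" "\<And>n::nat. n > 0 \<Longrightarrow> [n] \<cdot>\<^bsub>L\<^esub> \<one>\<^bsub>L\<^esub> \<noteq> \<zero>\<^bsub>L\<^esub>"
    and G: "group G"
    and S: "assoc_algebra L S"
      "group_action G (carrier S) act" "\<And>g. g \<in> carrier G \<Longrightarrow> act g \<in> alg_hom L S S"
    and S': "assoc_algebra L S'"
      "group_action G (carrier S') act'" "\<And>g. g \<in> carrier G \<Longrightarrow> act' g \<in> alg_hom L S' S'"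
    and f: "f \<in> alg_hom L S' S"
      "\<And>g x. \<lbrakk>g \<in> carrier G; x \<in> carrier S'\<rbrakk> \<Longrightarrow> f (act' g x) = act g (f x)"
    and H: "H \<lhd> G" "H' \<lhd> G" "H' \<subseteq> H" "finite (carrier (subquot G H H'))"
    and \<beta>: "equivariant_trivialisation G S act H \<beta>"
    and \<beta>': "equivariant_trivialisation G S' act' H' \<beta>'"
    and f_\<beta>': "\<And>h. h \<in> H' \<Longrightarrow> f (\<beta>' h) = \<beta> h"
    and M': "left_module (skew_quot G S' act' H' \<beta>') M'"
    and M: "left_module (skew_quot G S act H \<beta>) M"
    and \<tau>: "\<tau> \<in> lin_hom (skew_quot G S' act' H' \<beta>') M' (restrict_scalars (skew_map G S act H \<beta> f) M)"
    and a: "\<exists>h\<in>H. \<exists>x\<in>carrier T. star h x \<noteq> x"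
    and b: "card (orbits G I (irr_action L G H H')) = 2"
    and c: "module_length S (T\<lparr>carrier := a_kernel T M_S \<Phi>\<rparr>) \<le> enat (card I - 1)"
  shows "\<exists>\<Psi>\<in>lin_hom S (coinvariants star H T) M_S.
    (\<forall>x\<in>carrier T. \<Psi> (coinv_kernel star H T +>\<^bsub>T\<^esub> x) = \<Phi> x) \<and>
    inj_on \<Psi> (carrier (coinvariants star H T))"
proof -
  interpret S: skew_action G S act by (rule skew_actionI[OF G S])
  interpret S': skew_action G S' act' by (rule skew_actionI[OF G S'])
  interpret SA: assoc_algebra L S by (rule S)
  interpret M': left_module "skew_quot G S' act' H' \<beta>'" M' by (rule M')
  interpret M: left_module "skew_quot G S act H \<beta>" M by (rule M)
  have fr: "f \<in> ring_hom S' S" using f(1) by (simp add: alg_hom_def)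
  have act_L: "act g (a \<odot>\<^bsub>S\<^esub> s) = a \<odot>\<^bsub>S\<^esub> act g s"
    if "g \<in> carrier G" "a \<in> carrier L" "s \<in> carrier S" for g a s
    using S(3)[OF that(1)] that by (simp add: alg_hom_def)
  interpret secret_setting G L S act H \<beta> S' act' H' \<beta>' f M' M \<tau>
    by (intro secret_setting.intro secret_setting_axioms.intro skew_change.intro skew_change_axioms.intro
        skew_trivialisation.intro skew_trivialisation_axioms.intro)
      (fact S.skew_action_axioms S'.skew_action_axioms SA.assoc_algebra_axioms M' M L H \<beta> \<beta>' fr f(2) f_\<beta>' act_L \<tau>)+
  note defs = M_S_def T_def star_def \<Phi>_def I_def
  show ?thesis
    unfolding defs
    by (rule factor_through_coinvariants[OF kernel_eq_CK[OF a[unfolded defs] b[unfolded defs] c[unfolded defs]]])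
qed

end
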